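(* For each $\epsilon>0$, $\mathcal{U}_\epsilon$ is dense in $\mathcal{U}$ under the $L^\infty(\Omega_T)$-norm.
   Context: Setting: $0<\alpha<1$, $T>0$, $\Omega\subset\mathbb{R}^n$ is a bounded convex domain with $\partial\Omega$ of class $C^{2+\alpha}$ and outer unit normal $\mathbf{n}$, $\Omega_T=\Omega\times(0,T)$, and $u_0\in C^{2+\alpha}(\bar\Omega)$ satisfies $Du_0\not\equiv0$ in $\Omega$, $\partial u_0/\partial\mathbf{n}=0$ on $\partial\Omega$, $\int_\Omega u_0\,dx=0$. $D$, $\operatorname{div}$ are with respect to $x$; subscript $t$ is the time derivative. Put $M=\|Du_0\|_{L^\infty(\Omega)}>0$, $\sigma(p)=\frac{p}{1+|p|^2}$ ($p\in\mathbb{R}^n$), $\rho(s)=\frac{s}{1+s^2}$ ($s\ge0$), and for $0<\delta<1/2$, $m_\pm(\delta)=\frac{1\pm\sqrt{1-4\delta^2}}{2\delta}$. Choice of $\delta,\Lambda$: (i) if $0<M<1$, choose $0<\delta<\frac{M}{1+M^2}$ and any $1<\Lambda<m_+(\delta)$; (ii) if $M\ge1$, given $\lambda>0$, let $\delta=\frac{M+\lambda}{1+(M+\lambda)^2}$ (so $m_+(\delta)=M+\lambda$) and choose any $\Lambda\in(M,M+\lambda)$. Modified function: fix $\rho^*\in C^3([0,\infty))$ and constants $\Theta>\theta>0$ with $\rho^*(s)=\rho(s)$ for $0\le s\le m_-(\delta)$, $\rho^*(s)<\rho(s)$ for $m_-(\delta)<s\le\Lambda$, and $\theta\le(\rho^*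 )'(s)\le\Theta$ for all $s\ge0$ (such a function exists). Put $f(0)=1$, $f(s)=\rho^*(\sqrt s)/\sqrt s$ for $s>0$ (then $f\in C^3([0,\infty))$ and $\theta\le f(s)+2sf'(s)\le\Theta$), and $A(p)=f(|p|^2)p$ for $p\in\mathbb{R}^n$. Boundary function: $u^*\in C^{2+\alpha,\frac{2+\alpha}{2}}(\bar\Omega_T)$ is the unique classical solution of $u^*_t=\operatorname{div}(A(Du^* ))$ in $\Omega_T$, $\partial u^*/\partial\mathbf{n}=0$ on $\partial\Omega\times[0,T]$, $u^*(x,0)=u_0(x)$ for $x\in\Omega$; it satisfies $|Du^*|\le M$ in $\Omega_T$. Let $h\in C^{2+\alpha}(\bar\Omega)$ satisfy $\Delta h=u_0$ in $\Omega$, $\partial h/\partial\mathbf{n}=0$ on $\partial\Omega$, let $v_0=Dh$, and set $v^*(x,t)=v_0(x)+\int_0^tA(Du^*(x,s))\,ds$. $W^{1,\infty}_{u^*}(\Omega_T)$ and $W^{1,\infty}_{v^*}(\Omega_T;\mathbb{R}^n)$ are the Dirichlet classes of $W^{1,\infty}$ functions with the same trace on $\partial\Omega_T$ as $u^*$, respectively $v^*$. Sets: $\mathcal{S}_\delta=\{(p,\beta)\in\mathbb{R}^{n+n}\mid\delta|(1-p\cdot\beta)p-\beta|+|\beta|^2+(p\cdot\beta)^2-p\cdot\beta<0\}$ and $\mathcal{K}_\delta=\{(p,\sigma(p))\mid|p|\le m_-(\delta)\}$. A function $u$ is piecewise $C^1$ in $\Omega_T$, written $u\in C^1_{pc}(\Omega_T)$,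 if there is a sequence of disjoint open sets $\{G_j\}_{j=1}^\infty$ in $\Omega_T$ with $|\partial G_j|=0$, $u\in C^1(\bar G_j)$ for all $j$, and $|\Omega_T\setminus\bigcup_jG_j|=0$ (similarly for vector functions). Classes: let $\mu=\|u^*_t\|_{L^\infty(\Omega_T)}+1$. $\mathcal{U}$ is the set of $u\in C^1_{pc}\cap W^{1,\infty}_{u^*}(\Omega_T)$ with $\|u_t\|_{L^\infty(\Omega_T)}<\mu$ for which there exists $v\in C^1_{pc}\cap W^{1,\infty}_{v^*}(\Omega_T;\mathbb{R}^n)$ such that $\operatorname{div}v=u$ and $(Du,v_t)\in\mathcal{S}_\delta\cup\mathcal{K}_\delta$ a.e. in $\Omega_T$. For $\epsilon>0$, $\mathcal{U}_\epsilon$ is the set of $u\in\mathcal{U}$ for which there exists $v\in C^1_{pc}\cap W^{1,\infty}_{v^*}(\Omega_T;\mathbb{R}^n)$ such that $\operatorname{div}v=u$ and $(Du,v_t)\in\mathcal{S}_\delta\cup\mathcal{K}_\delta$ a.e. in $\Omega_T$, and $\int_{\Omega_T}|v_t-\sigma(Du)|\,dx\,dt\le\epsilon|\Omega_T|$. *)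

theory Defs
  imports "HOL-Analysis.Analysis" "HOL-Probability.Essential_Supremum"
begin

text \<open>Points of space-time are pairs \<open>(x, t)\<close> of type \<open>(real^'n) \<times> real\<close>.\<close>

definition ddir :: "'a::real_normed_vector \<Rightarrow> ('a \<Rightarrow> 'b::real_normed_vector) \<Rightarrow> 'a \<Rightarrow> 'b" where
  "ddir e f z = vector_derivative (\<lambda>s. f (z + s *\<^sub>R e)) (at 0)"

definition has_ddir_on :: "'a::real_normed_vector \<Rightarrow> ('a \<Rightarrow> 'b::real_normed_vector) \<Rightarrow> 'a set \<Rightarrow> bool" where
  "has_ddir_on e f S \<longleftrightarrow> (\<forall>z\<in>S. (\<lambda>s. f (z + s *\<^sub>R e)) differentiable (at 0))"

definition grad :: "(real^'n \<Rightarrow> real) \<Rightarrow> real^'n \<Rightarrow> real^'n" where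
  "grad f x = (\<chi> i. ddir (axis i 1) f x)"

definition laplacian :: "(real^'n \<Rightarrow> real) \<Rightarrow> real^'n \<Rightarrow> real" where
  "laplacian f x = (\<Sum>i\<in>UNIV. ddir (axis i 1) (ddir (axis i 1) f) x)"

definition Dx :: "((real^'n) \<times> real \<Rightarrow> real) \<Rightarrow> (real^'n) \<times> real \<Rightarrow> real^'n" where
  "Dx f z = (\<chi> i. ddir (axis i 1, 0) f z)"

definition Dt :: "((real^'n) \<times> real \<Rightarrow> real) \<Rightarrow> (real^'n) \<times> real \<Rightarrow> real" where
  "Dt f z = ddir (0, 1) f z"

definition divx :: "((real^'n) \<times> real \<Rightarrow> real^'n) \<Rightarrow> (real^'n) \<times> real \<Rightarrow> real" where
  "divx F z = (\<Sum>i\<in>UNIV. ddir (axis i 1, 0) (\<lambda>w. F w $ i) z)"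

definition extends_cont :: "'a::topological_space set \<Rightarrow> ('a \<Rightarrow> 'b::topological_space) \<Rightarrow> bool" where
  "extends_cont S f \<longleftrightarrow> (\<exists>g. continuous_on (closure S) g \<and> (\<forall>z\<in>S. g z = f z))"

text \<open>
  \<open>Ck_closure k S f\<close>, for open \<open>S\<close>, is the usual \<open>f \<in> C^k(closure S)\<close>: all partial derivatives of
  order at most \<open>k\<close> exist in \<open>S\<close> and extend continuously to the closure. The values of \<open>f\<close> itself
  outside \<open>S\<close> play no role. For \<open>S = UNIV\<close> this is just \<open>C^k\<close> on the whole space.
\<close>

fun Ck_closure :: "nat \<Rightarrow> 'a::euclidean_space set \<Rightarrow> ('a \<Rightarrow> 'b::real_normed_vector) \<Rightarrow> bool" where
  "Ck_closure 0 S f \<longleftrightarrow> extends_cont S f"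
| "Ck_closure (Suc k) S f \<longleftrightarrow> extends_cont S f \<and>
     (\<forall>e\<in>Basis. has_ddir_on e f S \<and> Ck_closure k S (ddir e f))"

definition hoelder_on :: "real \<Rightarrow> 'a::metric_space set \<Rightarrow> ('a \<Rightarrow> 'b::metric_space) \<Rightarrow> bool" where
  "hoelder_on a S f \<longleftrightarrow> (\<exists>C. \<forall>x\<in>S. \<forall>y\<in>S. dist (f x) (f y) \<le> C * dist x y powr a)"

text \<open>\<open>C^{2+a}(closure S)\<close> for bounded open \<open>S\<close>; here \<open>f\<close> is a function on the closure.\<close>

definition C2alpha :: "real \<Rightarrow> 'a::euclidean_space set \<Rightarrow> ('a \<Rightarrow> 'b::real_normed_vector) \<Rightarrow> bool" where
  "C2alpha a S f \<longleftrightarrow> continuous_on (closure S) f \<and> Ck_closure 2 S f \<and>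
     (\<forall>e\<in>Basis. \<forall>e'\<in>Basis. hoelder_on a S (ddir e (ddir e' f)))"

text \<open>
  Boundary of class \<open>C^{2+a}\<close>: locally straightened by a \<open>C^{2+a}\<close> diffeomorphism \<open>\<psi>\<close> of a ball \<open>B\<close>
  (with inverse \<open>\<phi>\<close>) that takes the part of \<open>B\<close> in \<open>\<Omega>\<close> into a half space and the part of \<open>B\<close> on the
  boundary into the bounding hyperplane.
\<close>

definition C2alpha_boundary :: "real \<Rightarrow> (real^'n) set \<Rightarrow> bool" where
  "C2alpha_boundary a \<Omega> \<longleftrightarrow> (\<forall>x\<in>frontier \<Omega>. \<exists>r>0. \<exists>(\<psi>::real^'n \<Rightarrow> real^'n) (\<phi>::real^'n \<Rightarrow> real^'n) k.
     let B = ball x r in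
       open (\<psi> ` B) \<and> (\<forall>y\<in>B. \<phi> (\<psi> y) = y) \<and> C2alpha a B \<psi> \<and> C2alpha a (\<psi> ` B) \<phi> \<and>
       (\<forall>y\<in>B \<inter> \<Omega>. \<psi> y $ k > 0) \<and> (\<forall>y\<in>B \<inter> frontier \<Omega>. \<psi> y $ k = 0))"

text \<open>
  \<open>\<nu>\<close> is orthogonal to the tangent hyperplane of the boundary at \<open>x\<close> and points out of \<open>\<Omega>\<close>.
  For a \<open>C^1\<close> boundary there is exactly one such \<open>\<nu>\<close> at every boundary point.
\<close>

definition outer_unit_normal :: "(real^'n) set \<Rightarrow> real^'n \<Rightarrow> real^'n \<Rightarrow> bool" where
  "outer_unit_normal \<Omega> x \<nu> \<longleftrightarrow> norm \<nu> = 1 \<and>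
     (\<forall>e>0. \<exists>r>0. \<forall>y\<in>frontier \<Omega> \<inter> ball x r. \<bar>\<nu> \<bullet> (y - x)\<bar> \<le> e * norm (y - x)) \<and>
     (\<exists>r>0. \<forall>s. 0 < s \<and> s < r \<longrightarrow> x + s *\<^sub>R \<nu> \<notin> closure \<Omega> \<and> x - s *\<^sub>R \<nu> \<in> \<Omega>)"

text \<open>
  Homogeneous Neumann conditions. Boundary values of the gradient are those of its continuous
  extension from the (space or space-time) domain, hence the limits taken within the domain.
\<close>

definition neumann0 :: "(real^'n) set \<Rightarrow> (real^'n \<Rightarrow> real) \<Rightarrow> bool" where
  "neumann0 \<Omega> f \<longleftrightarrow> (\<forall>x\<in>frontier \<Omega>. \<forall>\<nu>. outer_unit_normal \<Omega> x \<nu> \<longrightarrow>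
     ((\<lambda>y. grad f y \<bullet> \<nu>) \<longlongrightarrow> 0) (at x within \<Omega>))"

definition cyl :: "(real^'n) set \<Rightarrow> real \<Rightarrow> ((real^'n) \<times> real) set" where
  "cyl \<Omega> T = \<Omega> \<times> {0<..<T}"

definition neumann0_cyl :: "(real^'n) set \<Rightarrow> real \<Rightarrow> ((real^'n) \<times> real \<Rightarrow> real) \<Rightarrow> bool" where
  "neumann0_cyl \<Omega> T u \<longleftrightarrow> (\<forall>x\<in>frontier \<Omega>. \<forall>t\<in>{0..T}. \<forall>\<nu>. outer_unit_normal \<Omega> x \<nu> \<longrightarrow>
     ((\<lambda>z. Dx u z \<bullet> \<nu>) \<longlongrightarrow> 0) (at (x, t) within cyl \<Omega> T))"

text \<open>
  The parabolic Hoelder space \<open>C^{2+a,(2+a)/2}\<close> on the closed cylinder: the time derivative and the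
  second space derivatives have Hoelder exponents \<open>a\<close> in \<open>x\<close> and \<open>a/2\<close> in \<open>t\<close>, and the first space
  derivatives have Hoelder exponent \<open>(1+a)/2\<close> in \<open>t\<close>.
\<close>

definition par_hoelder_on :: "real \<Rightarrow> ((real^'n) \<times> real) set \<Rightarrow> ((real^'n) \<times> real \<Rightarrow> real) \<Rightarrow> bool" where
  "par_hoelder_on a Q g \<longleftrightarrow> (\<exists>C. \<forall>(x, t)\<in>Q. \<forall>(y, s)\<in>Q.
     \<bar>g (x, t) - g (y, s)\<bar> \<le> C * (dist x y powr a + \<bar>t - s\<bar> powr (a / 2)))"

definition C2alpha_par :: "real \<Rightarrow> ((real^'n) \<times> real) set \<Rightarrow> ((real^'n) \<times> real \<Rightarrow> real) \<Rightarrow> bool" where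
  "C2alpha_par a Q u \<longleftrightarrow> continuous_on (closure Q) u \<and>
     has_ddir_on (0, 1) u Q \<and> extends_cont Q (Dt u) \<and> par_hoelder_on a Q (Dt u) \<and>
     (\<forall>i. let ui = ddir (axis i 1, 0) u in
        has_ddir_on (axis i 1, 0) u Q \<and> extends_cont Q ui \<and>
        (\<exists>C. \<forall>x t s. (x, t) \<in> Q \<and> (x, s) \<in> Q \<longrightarrow>
           \<bar>ui (x, t) - ui (x, s)\<bar> \<le> C * \<bar>t - s\<bar> powr ((1 + a) / 2)) \<and>
        (\<forall>j. let uij = ddir (axis j 1, 0) ui in
           has_ddir_on (axis j 1, 0) ui Q \<and> extends_cont Q uij \<and> par_hoelder_on a Q uij))"

text \<open>The value is \<open>\<infinity>\<close> if \<open>f\<close> is not measurable on \<open>S\<close>.\<close>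

definition Linf_norm :: "'a::euclidean_space set \<Rightarrow> ('a \<Rightarrow> 'b::euclidean_space) \<Rightarrow> ennreal" where
  "Linf_norm S f = esssup (lebesgue_on S) (\<lambda>z. ennreal (norm (f z)))"

definition Linf :: "'a::euclidean_space set \<Rightarrow> ('a \<Rightarrow> 'b::euclidean_space) \<Rightarrow> bool" where
  "Linf S f \<longleftrightarrow> f \<in> borel_measurable (lebesgue_on S) \<and> Linf_norm S f < \<infinity>"

definition test_fun :: "'a::euclidean_space set \<Rightarrow> ('a \<Rightarrow> real) \<Rightarrow> bool" where
  "test_fun U \<phi> \<longleftrightarrow> (\<forall>k. Ck_closure k UNIV \<phi>) \<and>
     compact (closure {z. \<phi> z \<noteq> 0}) \<and> closure {z. \<phi> z \<noteq> 0} \<subseteq> U"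

definition locally_integrable :: "'a::euclidean_space set \<Rightarrow> ('a \<Rightarrow> 'b::euclidean_space) \<Rightarrow> bool" where
  "locally_integrable U f \<longleftrightarrow> (\<forall>K. compact K \<and> K \<subseteq> U \<longrightarrow> set_integrable lebesgue K f)"

definition has_weak_ddir ::
  "'a::euclidean_space set \<Rightarrow> 'a \<Rightarrow> ('a \<Rightarrow> 'b::euclidean_space) \<Rightarrow> ('a \<Rightarrow> 'b) \<Rightarrow> bool" where
  "has_weak_ddir U e u g \<longleftrightarrow> locally_integrable U u \<and> locally_integrable U g \<and>
     (\<forall>\<phi>. test_fun U \<phi> \<longrightarrow>
        (LINT z:U|lebesgue. ddir e \<phi> z *\<^sub>R u z) = - (LINT z:U|lebesgue. \<phi> z *\<^sub>R g z))"

text \<open>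
  Some representative of the weak derivative (unique up to null sets); only meaningful when one
  exists, as it does for all functions satisfying \<open>W1inf\<close> below.
\<close>

definition wddir :: "'a::euclidean_space set \<Rightarrow> 'a \<Rightarrow> ('a \<Rightarrow> 'b::euclidean_space) \<Rightarrow> 'a \<Rightarrow> 'b" where
  "wddir U e u = (SOME g. has_weak_ddir U e u g)"

definition W1inf :: "'a::euclidean_space set \<Rightarrow> ('a \<Rightarrow> 'b::euclidean_space) \<Rightarrow> bool" where
  "W1inf U u \<longleftrightarrow> Linf U u \<and> (\<forall>e\<in>Basis. \<exists>g. has_weak_ddir U e u g \<and> Linf U g)"

definition wDx :: "((real^'n) \<times> real) set \<Rightarrow> ((real^'n) \<times> real \<Rightarrow> real) \<Rightarrow> (real^'n) \<times> real \<Rightarrow> real^'n" where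
  "wDx Q u z = (\<chi> i. wddir Q (axis i 1, 0) u z)"

definition wDt :: "((real^'n) \<times> real) set \<Rightarrow> ((real^'n) \<times> real \<Rightarrow> 'b::euclidean_space) \<Rightarrow> (real^'n) \<times> real \<Rightarrow> 'b" where
  "wDt Q u = wddir Q (0, 1) u"

definition wdivx :: "((real^'n) \<times> real) set \<Rightarrow> ((real^'n) \<times> real \<Rightarrow> real^'n) \<Rightarrow> (real^'n) \<times> real \<Rightarrow> real" where
  "wdivx Q v z = (\<Sum>i\<in>UNIV. wddir Q (axis i 1, 0) (\<lambda>w. v w $ i) z)"

text \<open>
  On a bounded Lipschitz domain a \<open>W^{1,\<infinity>}\<close> function has a representative that is continuous up to
  the boundary, and its trace is the restriction of that representative to the boundary.
\<close>

definition same_trace :: "'a::euclidean_space set \<Rightarrow> ('a \<Rightarrow> 'b::euclidean_space) \<Rightarrow> ('a \<Rightarrow> 'b) \<Rightarrow> bool" where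
  "same_trace U u w \<longleftrightarrow> (\<exists>u' w'. continuous_on (closure U) u' \<and> continuous_on (closure U) w' \<and>
     (AE z in lebesgue_on U. u' z = u z) \<and> (AE z in lebesgue_on U. w' z = w z) \<and>
     (\<forall>z\<in>frontier U. u' z = w' z))"

definition W1inf_dir :: "'a::euclidean_space set \<Rightarrow> ('a \<Rightarrow> 'b::euclidean_space) \<Rightarrow> ('a \<Rightarrow> 'b) set" where
  "W1inf_dir U w = {u. W1inf U u \<and> same_trace U u w}"

definition C1pc :: "'a::euclidean_space set \<Rightarrow> ('a \<Rightarrow> 'b::euclidean_space) set" where
  "C1pc U = {u. \<exists>G::nat \<Rightarrow> 'a set. disjoint_family G \<and>
     (\<forall>j. open (G j) \<and> G j \<subseteq> U \<and> negligible (frontier (G j)) \<and> Ck_closure 1 (G j) u) \<and>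
     negligible (U - (\<Union>j. G j))}"

definition sigma :: "real^'n \<Rightarrow> real^'n" where
  "sigma p = p /\<^sub>R (1 + (norm p)\<^sup>2)"

definition rho :: "real \<Rightarrow> real" where
  "rho s = s / (1 + s\<^sup>2)"

definition m_plus :: "real \<Rightarrow> real" where
  "m_plus d = (1 + sqrt (1 - 4 * d\<^sup>2)) / (2 * d)"

definition m_minus :: "real \<Rightarrow> real" where
  "m_minus d = (1 - sqrt (1 - 4 * d\<^sup>2)) / (2 * d)"

text \<open>\<open>C^k\<close> on the half line \<open>[0,\<infinity>)\<close>, with one-sided derivatives at \<open>0\<close>.\<close>

definition deriv0 :: "(real \<Rightarrow> real) \<Rightarrow> real \<Rightarrow> real" where
  "deriv0 f s = vector_derivative f (at s within {0..})"

fun Ck_halfline :: "nat \<Rightarrow> (real \<Rightarrow> real) \<Rightarrow> bool" where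
  "Ck_halfline 0 f \<longleftrightarrow> continuous_on {0..} f"
| "Ck_halfline (Suc k) f \<longleftrightarrow> f differentiable_on {0..} \<and> Ck_halfline k (deriv0 f)"

definition modified_profile ::
  "real \<Rightarrow> real \<Rightarrow> real \<Rightarrow> real \<Rightarrow> (real \<Rightarrow> real) \<Rightarrow> bool" where
  "modified_profile \<delta> \<Lambda> \<theta> \<Theta> \<rho>s \<longleftrightarrow> 0 < \<theta> \<and> \<theta> < \<Theta> \<and> Ck_halfline 3 \<rho>s \<and>
     (\<forall>s. 0 \<le> s \<and> s \<le> m_minus \<delta> \<longrightarrow> \<rho>s s = rho s) \<and>
     (\<forall>s. m_minus \<delta> < s \<and> s \<le> \<Lambda> \<longrightarrow> \<rho>s s < rho s) \<and>
     (\<forall>s\<ge>0. \<theta> \<le> deriv0 \<rho>s s \<and> deriv0 \<rho>s s \<le> \<Theta>)"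

definition f_mod :: "(real \<Rightarrow> real) \<Rightarrow> real \<Rightarrow> real" where
  "f_mod \<rho>s s = (if s = 0 then 1 else \<rho>s (sqrt s) / sqrt s)"

definition A_mod :: "(real \<Rightarrow> real) \<Rightarrow> real^'n \<Rightarrow> real^'n" where
  "A_mod \<rho>s p = f_mod \<rho>s ((norm p)\<^sup>2) *\<^sub>R p"

definition S_set :: "real \<Rightarrow> ((real^'n) \<times> (real^'n)) set" where
  "S_set \<delta> = {(p, \<beta>). \<delta> * norm ((1 - p \<bullet> \<beta>) *\<^sub>R p - \<beta>) + (norm \<beta>)\<^sup>2 + (p \<bullet> \<beta>)\<^sup>2 - p \<bullet> \<beta> < 0}"

definition K_set :: "real \<Rightarrow> ((real^'n) \<times> (real^'n)) set" where
  "K_set \<delta> = {(p, sigma p) | p. norm p \<le> m_minus \<delta>}"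

definition classical_solution ::
  "real \<Rightarrow> (real^'n) set \<Rightarrow> real \<Rightarrow> (real \<Rightarrow> real) \<Rightarrow> (real^'n \<Rightarrow> real) \<Rightarrow> ((real^'n) \<times> real \<Rightarrow> real) \<Rightarrow> bool" where
  "classical_solution \<alpha> \<Omega> T \<rho>s u0 u \<longleftrightarrow> C2alpha_par \<alpha> (cyl \<Omega> T) u \<and>
     (\<forall>z\<in>cyl \<Omega> T. Dt u z = divx (\<lambda>w. A_mod \<rho>s (Dx u w)) z) \<and>
     neumann0_cyl \<Omega> T u \<and> (\<forall>x\<in>\<Omega>. u (x, 0) = u0 x)"

definition v_star ::
  "(real \<Rightarrow> real) \<Rightarrow> (real^'n \<Rightarrow> real) \<Rightarrow> ((real^'n) \<times> real \<Rightarrow> real) \<Rightarrow> (real^'n) \<times> real \<Rightarrow> real^'n" where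
  "v_star \<rho>s h u = (\<lambda>(x, t). grad h x + integral {0..t} (\<lambda>s. A_mod \<rho>s (Dx u (x, s))))"

definition companion ::
  "real \<Rightarrow> ((real^'n) \<times> real) set \<Rightarrow> ((real^'n) \<times> real \<Rightarrow> real^'n) \<Rightarrow>
   ((real^'n) \<times> real \<Rightarrow> real) \<Rightarrow> ((real^'n) \<times> real \<Rightarrow> real^'n) \<Rightarrow> bool" where
  "companion \<delta> Q vs u v \<longleftrightarrow> v \<in> C1pc Q \<inter> W1inf_dir Q vs \<and>
     (AE z in lebesgue_on Q. wdivx Q v z = u z) \<and>
     (AE z in lebesgue_on Q. (wDx Q u z, wDt Q v z) \<in> S_set \<delta> \<union> K_set \<delta>)"

definition U_class ::
  "real \<Rightarrow> ((real^'n) \<times> real) set \<Rightarrow> ((real^'n) \<times> real \<Rightarrow> real) \<Rightarrow> ((real^'n) \<times> real \<Rightarrow> real^'n) \<Rightarrow>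
   ((real^'n) \<times> real \<Rightarrow> real) set" where
  "U_class \<delta> Q us vs = {u \<in> C1pc Q \<inter> W1inf_dir Q us.
     Linf_norm Q (wDt Q u) < Linf_norm Q (Dt us) + 1 \<and> (\<exists>v. companion \<delta> Q vs u v)}"

definition U_eps_class ::
  "real \<Rightarrow> real \<Rightarrow> ((real^'n) \<times> real) set \<Rightarrow> ((real^'n) \<times> real \<Rightarrow> real) \<Rightarrow> ((real^'n) \<times> real \<Rightarrow> real^'n) \<Rightarrow>
   ((real^'n) \<times> real \<Rightarrow> real) set" where
  "U_eps_class \<epsilon> \<delta> Q us vs = {u \<in> U_class \<delta> Q us vs. \<exists>v. companion \<delta> Q vs u v \<and>
     (LINT z:Q|lebesgue. norm (wDt Q v z - sigma (wDx Q u z))) \<le> \<epsilon> * measure lebesgue Q}"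

end

theory Submission
  imports Defs
begin

text \<open>
  Let \<open>u\<close> be in the class, with companion \<open>v\<close>, and let \<open>H\<close> be the open set of points near which \<open>u\<close> and
  \<open>v\<close> are of class \<open>C\<^sup>1\<close> and at which \<open>(Du, v_t)\<close> lies in \<open>S_set \<delta>\<close>. Almost everywhere outside \<open>H\<close> one has
  \<open>(Du, v_t) \<in> K_set \<delta>\<close>, that is \<open>v_t = sigma (Du)\<close>, and nothing has to be done there. On \<open>H\<close> the pair
  \<open>(u, v)\<close> is changed by finitely many explicit perturbations \<open>(\<phi>, \<psi>)\<close> with disjoint supports.

  Geometry. Every point \<open>(p, \<beta>)\<close> of \<open>S_set \<delta>\<close> lies on a segment in \<open>S_set \<delta>\<close> whose end points are as
  close as desired to the graph of \<open>sigma\<close> and whose direction \<open>(c, \<gamma>)\<close> satisfies \<open>c \<noteq> 0\<close>,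
  \<open>c \<bullet> \<gamma> = 0\<close> (\<open>S_set_segment\<close>). With \<open>s = p \<bullet> \<beta>\<close> and \<open>F = |\<beta>|\<^sup>2 + s\<^sup>2 - s\<close> the set \<open>S_set \<delta>\<close> is
  \<open>\<delta> |(1 - s) p - \<beta>| + F < 0\<close>; on the line in the direction of \<open>c = ((1 - s) p - \<beta>) / F\<close> and
  \<open>\<gamma> = sigma w\<close>, where \<open>w\<close> is the component of \<open>p\<close> orthogonal to \<open>c\<close>, the vector \<open>(1 - s) p - \<beta>\<close>
  remains equal to \<open>F c\<close> and \<open>F\<close> is a convex quadratic polynomial. At its roots \<open>(1 - s) p = \<beta>\<close>,
  which means \<open>\<beta> = sigma p\<close>.

  Oscillation. Because \<open>c \<bullet> \<gamma> = 0\<close>, there are \<open>C\<^sup>1\<close> functions \<open>(\<phi>, \<psi>)\<close> supported in a given ball with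
  \<open>div \<psi> = \<phi>\<close>, with \<open>\<phi>\<close> and \<open>\<phi>_t\<close> small, and with \<open>(D\<phi>, \<psi>_t)\<close> close to that segment (translated to
  the origin) everywhere and close to its end points outside a set of small measure
  (\<open>ball_perturbation\<close>). Where \<open>(Du, v_t)\<close> is nearly constant, \<open>(Du + D\<phi>, v_t + \<psi>_t)\<close> therefore stays in
  \<open>S_set \<delta>\<close> and is mostly near the graph of \<open>sigma\<close>.

  Covering. By Vitali's theorem finitely many disjoint balls of this kind exhaust \<open>H\<close> up to a set of
  small measure (\<open>perturbable_exhaustion\<close>). On the exceptional sets the integrand
  \<open>|v_t - sigma (Du)|\<close> is at most \<open>1\<close>, so the integral becomes as small as desired. The total perturbation
  is of class \<open>C\<^sup>1\<close> with compact support in the cylinder, hence it preserves piecewise smoothness,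
  traces and the equation \<open>div v = u\<close>, and since \<open>\<phi>_t\<close> is small it preserves the strict bound on
  \<open>u_t\<close>. That almost everywhere the weak derivatives of \<open>u\<close> and \<open>v\<close> are the classical ones follows
  from the fundamental lemma of the calculus of variations (\<open>fundamental_lemma\<close>).
\<close>

section \<open>Smooth test functions\<close>

text \<open>\<open>smooth_upto k h\<close>: the function \<open>h\<close> of a real variable is of class \<open>C\<^sup>k\<close>. The recursion over
  the order makes closure under sums and products immediate.\<close>

primrec smooth_upto :: "nat \<Rightarrow> (real \<Rightarrow> real) \<Rightarrow> bool" where
  "smooth_upto 0 h \<longleftrightarrow> continuous_on UNIV h"
| "smooth_upto (Suc k) h \<longleftrightarrow> (\<exists>h'. (\<forall>x. (h has_real_derivative h' x) (at x)) \<and> smooth_upto k h')"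

lemma smooth_upto_Suc_D: "smooth_upto (Suc k) h \<Longrightarrow> smooth_upto k h"
proof (induction k arbitrary: h)
  case 0
  then show ?case
    by (auto intro!: continuous_at_imp_continuous_on intro: DERIV_isCont)
next
  case (Suc k)
  then show ?case by (metis smooth_upto.simps(2))
qed

lemma smooth_upto_add:
  "smooth_upto k f \<Longrightarrow> smooth_upto k g \<Longrightarrow> smooth_upto k (\<lambda>x. f x + g x)"
proof (induction k arbitrary: f g)
  case 0
  then show ?case by (auto intro: continuous_intros)
next
  case (Suc k)
  then obtain f' g' where
    f: "\<And>x. (f has_real_derivative f' x) (at x)" "smooth_upto k f'" and
    g: "\<And>x. (g has_real_derivative g' x) (at x)" "smooth_upto k g'" by auto
  have "((\<lambda>x. f x + g x) has_real_derivative f' x + g' x) (at x)" for x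
    using f(1) g(1) by (intro derivative_intros)
  with Suc.IH[OF f(2) g(2)] show ?case
    unfolding smooth_upto.simps by (intro exI[of _ "\<lambda>x. f' x + g' x"]) blast
qed

lemma smooth_upto_mult:
  "smooth_upto k f \<Longrightarrow> smooth_upto k g \<Longrightarrow> smooth_upto k (\<lambda>x. f x * g x)"
proof (induction k arbitrary: f g)
  case 0
  then show ?case by (auto intro: continuous_intros)
next
  case (Suc k)
  then obtain f' g' where
    f: "\<And>x. (f has_real_derivative f' x) (at x)" "smooth_upto k f'" and
    g: "\<And>x. (g has_real_derivative g' x) (at x)" "smooth_upto k g'" by auto
  have *: "((\<lambda>x. f x * g x) has_real_derivative f' x * g x + f x * g' x) (at x)" for x
    by (rule derivative_eq_intros f(1) g(1) refl)+ (simp add: algebra_simps)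
  have "smooth_upto k (\<lambda>x. f' x * g x + f x * g' x)"
    using Suc.prems f g Suc.IH smooth_upto_add smooth_upto_Suc_D by presburger
  with * show ?case
    unfolding smooth_upto.simps by (intro exI[of _ "\<lambda>x. f' x * g x + f x * g' x"]) blast
qed

lemma smooth_upto_affine:
  "smooth_upto k f \<Longrightarrow> smooth_upto k (\<lambda>x. f (c * x + d))"
proof (induction k arbitrary: f)
  case 0
  then have "continuous_on UNIV (\<lambda>x. f (c * x + d))"
    by (auto intro!: continuous_on_compose2[of UNIV f] continuous_intros)
  then show ?case by simp
next
  case (Suc k)
  then obtain f' where
    f: "\<And>x. (f has_real_derivative f' x) (at x)" "smooth_upto k f'" by auto
  have *: "((\<lambda>x. f (c * x + d)) has_real_derivative f' (c * x + d) * c) (at x)" for x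
    by (rule DERIV_chain2[OF f(1)]) (auto intro!: derivative_eq_intros)
  have c: "smooth_upto k (\<lambda>x. c)"
  proof -
    have "smooth_upto k (\<lambda>x. c)" for c
    proof (induction k arbitrary: c)
      case 0 then show ?case by simp
    next
      case (Suc k)
      show ?case
        by (auto intro!: exI[of _ "\<lambda>x. 0"] Suc)
    qed
    then show ?thesis .
  qed
  show ?case
    unfolding smooth_upto.simps using * smooth_upto_mult[OF Suc.IH[OF f(2)] c]
    by (intro exI[of _ "\<lambda>x. f' (c * x + d) * c"]) blast
qed

text \<open>The functions \<open>p(1/x) exp(-1/x)\<close> for \<open>x > 0\<close>, extended by zero; differentiation maps this
  class into itself, so all its members are smooth.\<close>

definition flat_exp :: "real poly \<Rightarrow> real \<Rightarrow> real" where
  "flat_exp p x = (if x > 0 then poly p (1 / x) * exp (- (1 / x)) else 0)"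

lemma poly_exp_tendsto_0: "((\<lambda>y. poly p y * exp (- y)) \<longlongrightarrow> (0::real)) at_top"
proof (induction p)
  case 0
  then show ?case by simp
next
  case (pCons c p)
  have gen: "((\<lambda>y. y * (poly p y * exp (- y))) \<longlongrightarrow> (0::real)) at_top" for p
  proof -
    have "((\<lambda>y. \<Sum>i\<le>degree p. coeff p i * (y ^ Suc i / exp y)) \<longlongrightarrow> (\<Sum>i\<le>degree p. coeff p i * (0::real))) at_top"
      by (intro tendsto_intros tendsto_power_div_exp_0)
    moreover have "(\<Sum>i\<le>degree p. coeff p i * (y ^ Suc i / exp y)) = y * (poly p y * exp (- y))" for y :: real
      by (simp add: poly_altdef sum_distrib_left sum_distrib_right exp_minus field_simps)
    ultimately show ?thesis by simp
  qed
  have "((\<lambda>y. c * (y ^ 0 / exp y) + y * (poly p y * exp (- y))) \<longlongrightarrow> c * 0 + 0) at_top"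
    by (intro tendsto_intros tendsto_power_div_exp_0 gen)
  then show ?case by (simp add: algebra_simps exp_minus divide_inverse)
qed

lemma flat_exp_deriv:
  "(flat_exp p has_real_derivative flat_exp (monom 1 2 * (p - pderiv p)) x) (at x)"
proof -
  consider "x > 0" | "x < 0" | "x = 0" by linarith
  then show ?thesis
  proof cases
    case 1
    have "((\<lambda>x. poly p (1 / x) * exp (- (1 / x))) has_real_derivative
        flat_exp (monom 1 2 * (p - pderiv p)) x) (at x)"
      using 1 by (auto intro!: derivative_eq_intros DERIV_chain2[OF poly_DERIV]
          simp: flat_exp_def poly_monom divide_simps power2_eq_square algebra_simps)
    then show ?thesis
      by (rule has_field_derivative_transform_within_open[where S="{0<..}"])
         (use 1 in \<open>auto simp: flat_exp_def\<close>)
  next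
    case 2
    have "((\<lambda>x. 0) has_real_derivative flat_exp (monom 1 2 * (p - pderiv p)) x) (at x)"
      using 2 by (simp add: flat_exp_def)
    then show ?thesis
      by (rule has_field_derivative_transform_within_open[where S="{..<0}"])
         (use 2 in \<open>auto simp: flat_exp_def\<close>)
  next
    case 3
    have "((\<lambda>y. y * (poly p y * exp (- y))) \<longlongrightarrow> (0::real)) at_top"
      using poly_exp_tendsto_0[of "pCons 0 p"] by (simp add: mult.assoc)
    then have "((\<lambda>x. inverse x * (poly p (inverse x) * exp (- inverse x))) \<longlongrightarrow> 0) (at_right (0::real))"
      by (rule filterlim_compose[OF _ filterlim_inverse_at_top_right])
    then have r: "((\<lambda>h. (flat_exp p (0 + h) - flat_exp p 0) / h) \<longlongrightarrow> 0) (at_right 0)"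
      by (rule Lim_transform_eventually)
         (auto simp: flat_exp_def eventually_at_filter divide_inverse)
    have l: "((\<lambda>h. (flat_exp p (0 + h) - flat_exp p 0) / h) \<longlongrightarrow> 0) (at_left 0)"
      by (rule Lim_transform_eventually[OF tendsto_const])
         (auto simp: flat_exp_def eventually_at_filter)
    show ?thesis
      using filterlim_split_at[OF l r] 3 by (simp add: DERIV_def flat_exp_def)
  qed
qed

lemma smooth_flat_exp: "smooth_upto k (flat_exp p)"
proof (induction k arbitrary: p)
  case 0
  then show ?case
    by (auto intro!: continuous_at_imp_continuous_on DERIV_isCont[OF flat_exp_deriv])
next
  case (Suc k)
  then show ?case
    using flat_exp_deriv by auto
qed

lemma ddirI:
  assumes "((\<lambda>s. f (z + s *\<^sub>R e)) has_vector_derivative d) (at 0)"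
  shows "ddir e f z = d"
  using assms by (simp add: ddir_def vector_derivative_at)

text \<open>A directional derivative of such a product along a basis vector is again such a product.\<close>

lemma Ck_closure_prod:
  fixes h :: "'a::euclidean_space \<Rightarrow> real \<Rightarrow> real"
  assumes "\<And>i. i \<in> Basis \<Longrightarrow> smooth_upto k (h i)"
  shows "Ck_closure k UNIV (\<lambda>z. \<Prod>i\<in>Basis. h i (z \<bullet> i))"
  using assms
proof (induction k arbitrary: h)
  case 0
  have "continuous_on UNIV (\<lambda>z::'a. h i (z \<bullet> i))" if "i \<in> Basis" for i
    by (rule continuous_on_compose2[of UNIV "h i"]) (use 0 that in \<open>auto intro!: continuous_intros\<close>)
  then have "continuous_on UNIV (\<lambda>z::'a. \<Prod>i\<in>Basis. h i (z \<bullet> i))"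
    by (rule continuous_on_prod)
  then show ?case
    by (auto simp: extends_cont_def)
next
  case (Suc k)
  then have "\<forall>i\<in>Basis. \<exists>h'. (\<forall>x. (h i has_real_derivative h' x) (at x)) \<and> smooth_upto k h'"
    by auto
  then obtain h' where h': "\<And>i x. i \<in> Basis \<Longrightarrow> (h i has_real_derivative h' i x) (at x)"
      "\<And>i. i \<in> Basis \<Longrightarrow> smooth_upto k (h' i)"
    by metis
  have "continuous_on UNIV (h i)" if "i \<in> Basis" for i
    using h'(1)[OF that] by (auto intro!: continuous_at_imp_continuous_on DERIV_isCont)
  then have "continuous_on UNIV (\<lambda>z::'a. h i (z \<bullet> i))" if "i \<in> Basis" for i
    by (rule continuous_on_compose2[of UNIV "h i"]) (use that in \<open>auto intro!: continuous_intros\<close>)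
  then have cont: "continuous_on UNIV (\<lambda>z::'a. \<Prod>i\<in>Basis. h i (z \<bullet> i))"
    by (rule continuous_on_prod)
  have vd: "((\<lambda>s. \<Prod>i\<in>Basis. h i ((z + s *\<^sub>R e) \<bullet> i)) has_vector_derivative
      (\<Prod>i\<in>Basis. (if i = e then h' i else h i) (z \<bullet> i))) (at 0)" if e: "e \<in> Basis" for e z :: 'a
  proof -
    have eq: "(\<Prod>i\<in>Basis. h i ((z + s *\<^sub>R e) \<bullet> i)) = h e (z \<bullet> e + s) * (\<Prod>i\<in>Basis - {e}. h i (z \<bullet> i))" for s
    proof -
      have "(\<Prod>i\<in>Basis. h i ((z + s *\<^sub>R e) \<bullet> i))
          = h e ((z + s *\<^sub>R e) \<bullet> e) * (\<Prod>i\<in>Basis - {e}. h i ((z + s *\<^sub>R e) \<bullet> i))"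
        using e by (simp add: prod.remove)
      also have "(\<Prod>i\<in>Basis - {e}. h i ((z + s *\<^sub>R e) \<bullet> i)) = (\<Prod>i\<in>Basis - {e}. h i (z \<bullet> i))"
        using e by (intro prod.cong) (auto simp: inner_add_left inner_Basis)
      finally show ?thesis using e by (simp add: inner_add_left)
    qed
    have eq2: "(\<Prod>i\<in>Basis. (if i = e then h' i else h i) (z \<bullet> i)) = h' e (z \<bullet> e) * (\<Prod>i\<in>Basis - {e}. h i (z \<bullet> i))"
    proof -
      have "(\<Prod>i\<in>Basis. (if i = e then h' i else h i) (z \<bullet> i))
          = h' e (z \<bullet> e) * (\<Prod>i\<in>Basis - {e}. (if i = e then h' i else h i) (z \<bullet> i))"
        using e by (simp add: prod.remove)
      also have "(\<Prod>i\<in>Basis - {e}. (if i = e then h' i else h i) (z \<bullet> i)) = (\<Prod>i\<in>Basis - {e}. h i (z \<bullet> i))"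
        by (intro prod.cong) auto
      finally show ?thesis .
    qed
    have "((\<lambda>s. h e (z \<bullet> e + s)) has_real_derivative h' e (z \<bullet> e + 0) * 1) (at 0)"
      by (rule DERIV_chain2[OF h'(1)[OF e]]) (auto intro!: derivative_eq_intros)
    then show ?thesis
      unfolding eq eq2 has_real_derivative_iff_has_vector_derivative[symmetric]
      by (auto intro: DERIV_cmult_right)
  qed
  have "Ck_closure k UNIV (ddir e (\<lambda>z. \<Prod>i\<in>Basis. h i (z \<bullet> i)))" if e: "e \<in> Basis" for e :: 'a
  proof -
    have "ddir e (\<lambda>z. \<Prod>i\<in>Basis. h i (z \<bullet> i)) = (\<lambda>z. \<Prod>i\<in>Basis. (if i = e then h' i else h i) (z \<bullet> i))"
      using vd[OF e] by (intro ext ddirI)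
    then show ?thesis
      using Suc.IH[of "\<lambda>i. if i = e then h' i else h i"] h'(2) smooth_upto_Suc_D[OF Suc.prems]
      by presburger
  qed
  moreover have "has_ddir_on e (\<lambda>z. \<Prod>i\<in>Basis. h i (z \<bullet> i)) UNIV" if e: "e \<in> Basis" for e :: 'a
    unfolding has_ddir_on_def using vd[OF e] by (auto intro: differentiableI_vector)
  ultimately show ?case
    using cont by (auto simp: extends_cont_def)
qed

text \<open>Smooth functions supported in the closure of a box that increase, as \<open>n\<close> tends to infinity, to the
  indicator function of the box.\<close>

lemma box_bump_test_fun:
  fixes a b :: "'a::euclidean_space" and n :: real
  defines "\<phi> \<equiv> \<lambda>z. \<Prod>i\<in>Basis. flat_exp 1 (n * (z \<bullet> i - a \<bullet> i)) * flat_exp 1 (n * (b \<bullet> i - z \<bullet> i))"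
  assumes "n > 0" "cbox a b \<subseteq> U"
  shows "test_fun U \<phi>" "z \<notin> box a b \<Longrightarrow> \<phi> z = 0" "\<bar>\<phi> z\<bar> \<le> 1" "continuous_on UNIV \<phi>"
proof -
  have Ck: "Ck_closure k UNIV \<phi>" for k
  proof -
    have "smooth_upto k (\<lambda>x. flat_exp 1 (n * (x - a \<bullet> i)) * flat_exp 1 (n * (b \<bullet> i - x)))" for i
      using smooth_upto_mult[OF smooth_upto_affine[OF smooth_flat_exp, of k 1 n "- n * (a \<bullet> i)"]
        smooth_upto_affine[OF smooth_flat_exp, of k 1 "-n" "n * (b \<bullet> i)"]]
      by (simp add: algebra_simps)
    then show ?thesis unfolding \<phi>_def
      by (rule Ck_closure_prod[of k "\<lambda>i x. flat_exp 1 (n * (x - a \<bullet> i)) * flat_exp 1 (n * (b \<bullet> i - x))"])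
  qed
  show out: "\<phi> z = 0" if z: "z \<notin> box a b" for z
  proof -
    obtain i where "i \<in> Basis" "\<not> (a \<bullet> i < z \<bullet> i \<and> z \<bullet> i < b \<bullet> i)"
      using z unfolding mem_box by blast
    then show ?thesis
      unfolding \<phi>_def using \<open>n > 0\<close> by (intro prod_zero) (auto simp: flat_exp_def zero_less_mult_iff intro!: bexI[of _ i])
  qed
  have "{z. \<phi> z \<noteq> 0} \<subseteq> cbox a b"
    using out box_subset_cbox by blast
  then have cl: "closure {z. \<phi> z \<noteq> 0} \<subseteq> cbox a b"
    by (intro closure_minimal) auto
  then have "compact (closure {z. \<phi> z \<noteq> 0})"
    by (meson bounded_cbox bounded_subset closed_closure compact_eq_bounded_closed)
  then show "test_fun U \<phi>"
    using Ck cl assms by (auto simp: test_fun_def)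
  have 1: "\<bar>flat_exp 1 x\<bar> \<le> 1" for x
    by (auto simp: flat_exp_def)
  show "\<bar>\<phi> z\<bar> \<le> 1"
    unfolding \<phi>_def abs_prod by (intro prod_le_1) (auto simp: abs_mult intro!: mult_le_one 1)
  show "continuous_on UNIV \<phi>"
    using Ck[of 0] by (auto simp: extends_cont_def cong: continuous_on_cong)
qed

lemma box_bump_tendsto:
  fixes a b z :: "'a::euclidean_space"
  shows "(\<lambda>n. \<Prod>i\<in>Basis. flat_exp 1 (real (Suc n) * (z \<bullet> i - a \<bullet> i)) * flat_exp 1 (real (Suc n) * (b \<bullet> i - z \<bullet> i)))
    \<longlonglongrightarrow> indicator (box a b) z"
proof (cases "z \<in> box a b")
  case True
  have *: "(\<lambda>n. flat_exp 1 (real (Suc n) * x)) \<longlonglongrightarrow> 1" if "x > 0" for x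
  proof -
    have "(\<lambda>n. inverse (real (Suc n)) * (1 / x)) \<longlonglongrightarrow> 0 * (1 / x)"
      by (rule tendsto_mult[OF LIMSEQ_inverse_real_of_nat tendsto_const])
    then have "(\<lambda>n. exp (- (inverse (real (Suc n)) * (1 / x)))) \<longlonglongrightarrow> exp (- (0 * (1 / x)))"
      by (intro tendsto_exp tendsto_minus)
    moreover have "flat_exp 1 (real (Suc n) * x) = exp (- (inverse (real (Suc n)) * (1 / x)))" for n
      using that by (simp add: flat_exp_def field_simps add_pos_nonneg)
    ultimately show ?thesis by simp
  qed
  have "(\<lambda>n. \<Prod>i\<in>Basis. flat_exp 1 (real (Suc n) * (z \<bullet> i - a \<bullet> i)) * flat_exp 1 (real (Suc n) * (b \<bullet> i - z \<bullet> i)))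
    \<longlonglongrightarrow> (\<Prod>i\<in>(Basis::'a set). 1 * 1)"
    using True by (intro tendsto_prod tendsto_mult *) (auto simp: mem_box)
  then show ?thesis using True by simp
next
  case False
  have "(\<Prod>i\<in>Basis. flat_exp 1 (real (Suc n) * (z \<bullet> i - a \<bullet> i)) * flat_exp 1 (real (Suc n) * (b \<bullet> i - z \<bullet> i))) = 0" for n
    using box_bump_test_fun(2)[of "real (Suc n)" a b UNIV z] False by simp
  moreover have "indicator (box a b) z = (0::real)" using False by simp
  ultimately show ?thesis by (simp only: tendsto_const)
qed

section \<open>Integration by parts\<close>

lemma test_funD:
  fixes \<phi> :: "'a::euclidean_space \<Rightarrow> real"
  assumes "test_fun U \<phi>"
  shows "continuous_on UNIV \<phi>"
    and "e \<in> Basis \<Longrightarrow> ((\<lambda>s. \<phi> (z + s *\<^sub>R e)) has_vector_derivative ddir e \<phi> z) (at 0)"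
    and "e \<in> Basis \<Longrightarrow> continuous_on UNIV (ddir e \<phi>)"
proof -
  have ext: "extends_cont UNIV f \<Longrightarrow> continuous_on UNIV f" for f :: "'a \<Rightarrow> real"
    by (auto simp: extends_cont_def cong: continuous_on_cong)
  have 1: "Ck_closure (Suc 0) UNIV \<phi>"
    using assms by (simp add: test_fun_def)
  show "continuous_on UNIV \<phi>"
    using 1 ext by auto
  show "e \<in> Basis \<Longrightarrow> continuous_on UNIV (ddir e \<phi>)"
    using 1 ext by auto
  show "e \<in> Basis \<Longrightarrow> ((\<lambda>s. \<phi> (z + s *\<^sub>R e)) has_vector_derivative ddir e \<phi> z) (at 0)"
    using 1 by (auto simp: has_ddir_on_def ddir_def vector_derivative_works)
qed

lemma extends_cont_imp_continuous_on: "extends_cont S f \<Longrightarrow> continuous_on S f"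
  unfolding extends_cont_def
  by (metis closure_subset continuous_on_cong continuous_on_subset)

lemma line_has_vector_derivative:
  fixes f :: "'a::real_normed_vector \<Rightarrow> 'b::real_normed_vector"
  assumes "((\<lambda>s. f ((z + t *\<^sub>R e) + s *\<^sub>R e)) has_vector_derivative d) (at 0)"
  shows "((\<lambda>s. f (z + s *\<^sub>R e)) has_vector_derivative d) (at t)"
proof -
  have "((\<lambda>s. f ((z + t *\<^sub>R e) + s *\<^sub>R e)) has_vector_derivative d) (at (t + (-t)))"
    using assms by simp
  then have "((\<lambda>s. f ((z + t *\<^sub>R e) + s *\<^sub>R e)) \<circ> (\<lambda>s. s + (-t)) has_vector_derivative 1 *\<^sub>R d) (at t)"
    by (intro vector_diff_chain_at) (auto intro!: derivative_eq_intros)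
  then show ?thesis
    by (simp add: o_def algebra_simps scaleR_diff_left)
qed

lemma ddir_eq_0_outside:
  fixes f :: "'a::real_normed_vector \<Rightarrow> 'b::real_normed_vector"
  assumes "closed K" "\<And>z. z \<notin> K \<Longrightarrow> f z = 0" "z \<notin> K"
  shows "((\<lambda>s. f (z + s *\<^sub>R e)) has_vector_derivative 0) (at 0)"
proof -
  have "open ((\<lambda>s. z + s *\<^sub>R e) -` (- K))"
    using assms(1) by (intro open_vimage) (auto simp: open_Compl intro!: continuous_intros)
  then show ?thesis
    by (intro has_vector_derivative_transform_within_open[OF has_vector_derivative_const[of 0]])
       (use assms in auto)
qed

lemma bounded_of_compact_support:
  fixes f :: "'a::topological_space \<Rightarrow> 'b::real_normed_vector"
  assumes "compact K" "continuous_on UNIV f" "\<And>z. z \<notin> K \<Longrightarrow> f z = 0"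
  obtains B where "B > 0" "\<And>z. norm (f z) \<le> B"
proof -
  have "compact (f ` K)"
    using assms by (meson compact_continuous_image continuous_on_subset subset_UNIV)
  then obtain B where "B > 0" "\<forall>y\<in>f ` K. norm y \<le> B"
    using compact_imp_bounded bounded_pos by blast
  then have "norm (f z) \<le> B" for z
    using assms(3)[of z] by (cases "z \<in> K") auto
  then show ?thesis using that \<open>B > 0\<close> by blast
qed

lemma integrable_compact_support:
  fixes f :: "'a::euclidean_space \<Rightarrow> 'b::euclidean_space"
  assumes "compact K" "continuous_on UNIV f" "\<And>z. z \<notin> K \<Longrightarrow> f z = 0"
  shows "integrable lborel f"
proof -
  have "integrable lborel (\<lambda>z. indicator K z *\<^sub>R f z)"
    using borel_integrable_compact[OF assms(1), of f] assms(2)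
    by (auto intro: continuous_on_subset simp: if_distrib indicator_def cong: if_cong)
  moreover have "indicator K z *\<^sub>R f z = f z" for z
    using assms(3)[of z] by (cases "z \<in> K") auto
  ultimately show ?thesis by simp
qed

text \<open>The integral of a directional derivative of a compactly supported function vanishes: the
  integral of every difference quotient vanishes by translation invariance.\<close>

lemma integral_ddir_eq_0:
  fixes f f' :: "'a::euclidean_space \<Rightarrow> 'b::euclidean_space"
  assumes K: "compact K" "\<And>z. z \<notin> K \<Longrightarrow> f z = 0"
    and cont: "continuous_on UNIV f" "continuous_on UNIV f'"
    and der: "\<And>z. ((\<lambda>s. f (z + s *\<^sub>R e)) has_vector_derivative f' z) (at 0)"
  shows "integral\<^sup>L lebesgue f' = 0"
proof -
  have f'0: "f' z = 0" if "z \<notin> K" for z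
    using vector_derivative_unique_at[OF der ddir_eq_0_outside[OF compact_imp_closed[OF K(1)] K(2) that]] .
  obtain B where B: "B > 0" "\<And>z. norm (f' z) \<le> B"
    using bounded_of_compact_support[OF K(1) cont(2) f'0] by blast
  have der': "((\<lambda>s. f (z + s *\<^sub>R e)) has_vector_derivative f' (z + t *\<^sub>R e)) (at t)" for z t
    by (rule line_has_vector_derivative[OF der])
  have lip: "norm (f (z + s *\<^sub>R e) - f z) \<le> B * \<bar>s\<bar>" for z s
  proof -
    have "norm (f (z + s *\<^sub>R e) - f (z + 0 *\<^sub>R e)) \<le> B * norm (s - 0)"
    proof (rule differentiable_bound[of UNIV "\<lambda>s. f (z + s *\<^sub>R e)" "\<lambda>t h. h *\<^sub>R f' (z + t *\<^sub>R e)"])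
      show "((\<lambda>s. f (z + s *\<^sub>R e)) has_derivative (\<lambda>h. h *\<^sub>R f' (z + x *\<^sub>R e))) (at x within UNIV)" for x
        using der'[of z x] by (simp add: has_vector_derivative_def)
      show "onorm (\<lambda>h. h *\<^sub>R f' (z + x *\<^sub>R e)) \<le> B" for x
        by (intro onorm_bound) (use B in \<open>auto simp: mult.commute[of B] intro: mult_left_mono\<close>)
    qed auto
    then show ?thesis by simp
  qed
  define h where "h n z = real (Suc n) *\<^sub>R (f (z + inverse (real (Suc n)) *\<^sub>R e) - f z)" for n z
  define K' where "K' = (\<lambda>(x, s). x - s *\<^sub>R e) ` (K \<times> {0..1::real})"
  have K': "compact K'"
    unfolding K'_def by (intro compact_continuous_image compact_Times K) (auto simp: case_prod_unfold intro!: continuous_intros)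
  have h0: "h n z = 0" if "z \<notin> K'" for n z
  proof -
    have "z + s *\<^sub>R e \<notin> K" if s: "0 \<le> s" "s \<le> 1" for s
    proof
      assume "z + s *\<^sub>R e \<in> K"
      then have "z \<in> K'" unfolding K'_def using s by (intro image_eqI[of _ _ "(z + s *\<^sub>R e, s)"]) auto
      with \<open>z \<notin> K'\<close> show False ..
    qed
    from this[of 0] this[of "inverse (real (Suc n))"] show ?thesis
      by (simp add: h_def K(2) inverse_le_1_iff)
  qed
  have hB: "norm (h n z) \<le> B" for n z
  proof -
    have "norm (h n z) = real (Suc n) * norm (f (z + inverse (real (Suc n)) *\<^sub>R e) - f z)"
      by (simp add: h_def)
    also have "\<dots> \<le> real (Suc n) * (B * \<bar>inverse (real (Suc n))\<bar>)"
      by (intro mult_left_mono lip) auto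
    also have "\<dots> = B" by simp
    finally show ?thesis .
  qed
  have conth: "continuous_on UNIV (h n)" for n
    unfolding h_def
    by (intro continuous_intros cont continuous_on_compose2[OF cont(1)]) auto
  have intf: "integrable lborel f"
    by (rule integrable_compact_support[OF K(1) cont(1) K(2)])
  have inth: "integral\<^sup>L lborel (h n) = 0" for n
  proof -
    have mf: "f \<in> borel_measurable borel"
      using cont(1) by (simp add: borel_measurable_continuous_onI)
    have "integral\<^sup>L lborel (\<lambda>z. f (z + c)) = integral\<^sup>L lborel f" "integrable lborel (\<lambda>z. f (z + c))" for c
    proof -
      have "integral\<^sup>L (distr lborel borel ((+) c)) f = integral\<^sup>L lborel (\<lambda>z. f (c + z))"
        by (rule integral_distr) (use mf in auto)
      then show "integral\<^sup>L lborel (\<lambda>z. f (z + c)) = integral\<^sup>L lborel f"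
        by (simp add: lborel_distr_plus add.commute)
      have "integrable (distr lborel borel ((+) c)) f = integrable lborel (\<lambda>z. f (c + z))"
        by (rule integrable_distr_eq) (use mf in auto)
      then show "integrable lborel (\<lambda>z. f (z + c))"
        using intf by (simp add: lborel_distr_plus add.commute)
    qed
    then show ?thesis
      unfolding h_def using intf by simp
  qed
  have lim: "(\<lambda>n. h n z) \<longlonglongrightarrow> f' z" for z
  proof -
    have "((\<lambda>y. norm ((f (z + y *\<^sub>R e) - f z - y *\<^sub>R f' z) /\<^sub>R \<bar>y\<bar>)) \<longlongrightarrow> 0) (at 0)"
      using der[of z] by (intro tendsto_norm_zero) (simp add: has_vector_derivative_def has_derivative_def)
    then have "((\<lambda>s. norm ((f (z + s *\<^sub>R e) - f z) /\<^sub>R s - f' z)) \<longlongrightarrow> 0) (at 0)"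
    proof (rule Lim_transform_eventually)
      have "norm ((f (z + y *\<^sub>R e) - f z - y *\<^sub>R f' z) /\<^sub>R \<bar>y\<bar>) = norm ((f (z + y *\<^sub>R e) - f z) /\<^sub>R y - f' z)"
        if "y \<noteq> 0" for y
      proof -
        have "(f (z + y *\<^sub>R e) - f z) /\<^sub>R y - f' z = (f (z + y *\<^sub>R e) - f z - y *\<^sub>R f' z) /\<^sub>R y"
          using that by (simp add: scaleR_diff_right)
        then show ?thesis by simp
      qed
      then show "\<forall>\<^sub>F y in at 0. norm ((f (z + y *\<^sub>R e) - f z - y *\<^sub>R f' z) /\<^sub>R \<bar>y\<bar>)
          = norm ((f (z + y *\<^sub>R e) - f z) /\<^sub>R y - f' z)"
        by (auto simp: eventually_at_filter)
    qed
    then have "((\<lambda>s. (f (z + s *\<^sub>R e) - f z) /\<^sub>R s) \<longlongrightarrow> f' z) (at 0)"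
      by (subst Lim_null) (rule tendsto_norm_zero_cancel)
    then have "(\<lambda>n. (f (z + inverse (real (Suc n)) *\<^sub>R e) - f z) /\<^sub>R inverse (real (Suc n))) \<longlonglongrightarrow> f' z"
      by (rule filterlim_compose) (auto simp: filterlim_at LIMSEQ_inverse_real_of_nat simp del: of_nat_Suc)
    then show ?thesis by (simp add: h_def)
  qed
  have "(\<lambda>n. integral\<^sup>L lborel (h n)) \<longlonglongrightarrow> integral\<^sup>L lborel f'"
  proof (rule integral_dominated_convergence[where w = "\<lambda>z. indicator K' z * B"])
    show "integrable lborel (\<lambda>z. indicator K' z * B)"
      using K' by (intro integrable_mult_left integrable_real_indicator)
                  (use emeasure_bounded_finite[OF compact_imp_bounded[OF K']] K' in \<open>auto intro: borel_compact\<close>)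
    show "AE x in lborel. norm (h n x) \<le> indicator K' x * B" for n
      using hB h0 by (auto simp: indicator_def)
  qed (use conth cont lim in \<open>auto intro: borel_measurable_continuous_onI\<close>)
  then have "integral\<^sup>L lborel f' = 0"
    using inth by (simp add: LIMSEQ_const_iff)
  then show ?thesis
    using cont(2) by (simp add: integral_completion borel_measurable_continuous_onI)
qed

section \<open>Weak derivatives\<close>

lemma set_integrable_lebesgue_bounded_mult:
  fixes g :: "'a::euclidean_space \<Rightarrow> 'b::euclidean_space" and \<phi> :: "'a \<Rightarrow> real"
  assumes "set_integrable lebesgue K g" "continuous_on UNIV \<phi>" "\<And>z. \<bar>\<phi> z\<bar> \<le> B"
  shows "integrable lebesgue (\<lambda>z. \<phi> z *\<^sub>R (indicator K z *\<^sub>R g z))"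
proof (rule Bochner_Integration.integrable_bound[where f = "\<lambda>z. B *\<^sub>R (indicator K z *\<^sub>R g z)"])
  show "integrable lebesgue (\<lambda>z. B *\<^sub>R (indicator K z *\<^sub>R g z))"
    using assms(1) by (intro integrable_scaleR_right) (simp add: set_integrable_def)
  have "\<phi> \<in> borel_measurable lebesgue"
    using assms(2) by (intro measurable_completion) (simp add: borel_measurable_continuous_onI)
  then show "(\<lambda>z. \<phi> z *\<^sub>R (indicator K z *\<^sub>R g z)) \<in> borel_measurable lebesgue"
    using borel_measurable_integrable[OF assms(1)[unfolded set_integrable_def]] by (rule borel_measurable_scaleR)
  show "AE z in lebesgue. norm (\<phi> z *\<^sub>R (indicator K z *\<^sub>R g z)) \<le> norm (B *\<^sub>R (indicator K z *\<^sub>R g z))"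
    using order_trans[OF assms(3) abs_ge_self] by (auto simp: abs_mult intro!: mult_right_mono)
qed

lemma box_integral_eq_0:
  fixes g :: "'a::euclidean_space \<Rightarrow> real"
  assumes g: "set_integrable lebesgue (cbox a b) g" and ab: "cbox a b \<subseteq> U"
    and test: "\<And>\<phi>. test_fun U \<phi> \<Longrightarrow> (LINT z:U|lebesgue. \<phi> z *\<^sub>R g z) = 0"
  shows "(LINT z:box a b|lebesgue. g z) = 0"
proof -
  define \<phi> where "\<phi> n z = (\<Prod>i\<in>Basis. flat_exp 1 (real (Suc n) * (z \<bullet> i - a \<bullet> i)) * flat_exp 1 (real (Suc n) * (b \<bullet> i - z \<bullet> i)))" for n z
  have \<phi>: "test_fun U (\<phi> n)" "z \<notin> box a b \<Longrightarrow> \<phi> n z = 0" "\<bar>\<phi> n z\<bar> \<le> 1" "continuous_on UNIV (\<phi> n)" for n z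
    using box_bump_test_fun[of "real (Suc n)" a b U] ab unfolding \<phi>_def[abs_def] by auto
  have lim: "(\<lambda>n. \<phi> n z) \<longlonglongrightarrow> indicator (box a b) z" for z
    unfolding \<phi>_def by (rule box_bump_tendsto)
  have eq: "indicator U z *\<^sub>R (\<phi> n z *\<^sub>R g z) = \<phi> n z *\<^sub>R (indicator (cbox a b) z *\<^sub>R g z)" for n z
    using ab \<phi>(2)[of z n] box_subset_cbox[of a b] by (auto simp: indicator_def)
  have int: "integrable lebesgue (\<lambda>z. \<phi> n z *\<^sub>R (indicator (cbox a b) z *\<^sub>R g z))" for n
    by (rule set_integrable_lebesgue_bounded_mult[OF g \<phi>(4,3)])
  have "(\<lambda>n. LINT z|lebesgue. \<phi> n z *\<^sub>R (indicator (cbox a b) z *\<^sub>R g z)) \<longlonglongrightarrow>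
      (LINT z|lebesgue. indicator (box a b) z *\<^sub>R g z)"
  proof (rule integral_dominated_convergence[where w = "\<lambda>z. norm (indicator (cbox a b) z *\<^sub>R g z)"])
    show "integrable lebesgue (\<lambda>z. norm (indicator (cbox a b) z *\<^sub>R g z))"
      using g by (intro integrable_norm) (simp add: set_integrable_def)
    have "set_integrable lebesgue (box a b) g"
      by (rule set_integrable_subset[OF g]) (auto simp: box_subset_cbox)
    then show "(\<lambda>z. indicator (box a b) z *\<^sub>R g z) \<in> borel_measurable lebesgue"
      by (auto simp: set_integrable_def)
    show "AE z in lebesgue. (\<lambda>n. \<phi> n z *\<^sub>R (indicator (cbox a b) z *\<^sub>R g z)) \<longlonglongrightarrow> indicator (box a b) z *\<^sub>R g z"
    proof (rule AE_I2)
      fix z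
      have "(\<lambda>n. \<phi> n z *\<^sub>R (indicator (cbox a b) z *\<^sub>R g z)) \<longlonglongrightarrow> indicator (box a b) z *\<^sub>R (indicator (cbox a b) z *\<^sub>R g z)"
        by (intro tendsto_scaleR lim tendsto_const)
      then show "(\<lambda>n. \<phi> n z *\<^sub>R (indicator (cbox a b) z *\<^sub>R g z)) \<longlonglongrightarrow> indicator (box a b) z *\<^sub>R g z"
        using box_subset_cbox[of a b] by (auto simp: indicator_def split: if_splits)
    qed
    show "AE z in lebesgue. norm (\<phi> n z *\<^sub>R (indicator (cbox a b) z *\<^sub>R g z)) \<le> norm (indicator (cbox a b) z *\<^sub>R g z)" for n
      using \<phi>(3) by (auto simp: abs_mult intro!: mult_left_le_one_le)
  qed (use int in auto)
  moreover have "(LINT z|lebesgue. \<phi> n z *\<^sub>R (indicator (cbox a b) z *\<^sub>R g z)) = 0" for n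
    using test[OF \<phi>(1)[of n]] by (simp only: set_lebesgue_integral_def eq)
  ultimately show ?thesis
    by (simp add: set_lebesgue_integral_def LIMSEQ_const_iff)
qed

text \<open>Open boxes are stable under intersection and generate the Borel sets, so the integrals over all
  Borel sets vanish as well.\<close>

lemma AE_eq_0_of_box_integrals:
  fixes f :: "'a::euclidean_space \<Rightarrow> real"
  assumes f: "integrable lebesgue f" and f0: "integral\<^sup>L lebesgue f = 0"
    and box: "\<And>a b. (LINT z:box a b|lebesgue. f z) = 0"
  shows "AE z in lebesgue. f z = 0"
proof -
  have si: "set_integrable lebesgue A f" if "A \<in> sets lebesgue" for A
    unfolding set_integrable_def using integrable_mult_indicator[OF that f] .
  have borel: "(LINT z:A|lebesgue. f z) = 0" if "A \<in> sets borel" for A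
  proof -
    let ?G = "range (\<lambda>(a, b). box a b :: 'a set)"
    have "Int_stable ?G" "?G \<subseteq> Pow UNIV" "A \<in> sigma_sets UNIV ?G"
      using that by (auto simp: borel_eq_box Int_stable_def box_Int_box)
    then show ?thesis
    proof (induction rule: sigma_sets_induct_disjoint)
      case (basic A) then show ?case using box by auto
    next
      case empty then show ?case by (simp add: set_lebesgue_integral_def)
    next
      case (compl A)
      then have [measurable]: "A \<in> sets borel" by (simp add: borel_eq_box)
      have "(LINT z:A \<union> (UNIV - A)|lebesgue. f z) = (LINT z:A|lebesgue. f z) + (LINT z:UNIV - A|lebesgue. f z)"
        by (rule set_integral_Un) (auto intro!: si)
      then show ?case using compl f0 by (simp add: set_lebesgue_integral_def)
    next
      case (union F)
      then have F[measurable]: "\<And>i. F i \<in> sets borel" by (simp add: borel_eq_box subset_eq)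
      have "(LINT z:(\<Union>i. F i)|lebesgue. f z) = (\<Sum>i. LINT z:F i|lebesgue. f z)"
        by (rule lebesgue_integral_countable_add)
           (use union(1) F in \<open>auto simp: disjoint_family_on_def intro!: si\<close>)
      then show ?case using union by simp
    qed
  qed
  have "AE z in lebesgue. f z = (\<lambda>_. 0) z"
  proof (rule density_unique_real)
    fix A :: "'a set" assume "A \<in> sets lebesgue"
    then obtain S N N' where A: "A = S \<union> N" "N \<subseteq> N'" "N' \<in> null_sets lborel" "S \<in> sets lborel"
      by (rule sets_completionE)
    have "AE z in lebesgue. z \<notin> N'"
      using A(3) by (intro AE_completion AE_not_in)
    then have "(LINT z|lebesgue. indicator A z *\<^sub>R f z) = (LINT z|lebesgue. indicator S z *\<^sub>R f z)"
    proof (intro integral_cong_AE)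
      show "(\<lambda>z. indicator A z *\<^sub>R f z) \<in> borel_measurable lebesgue" "(\<lambda>z. indicator S z *\<^sub>R f z) \<in> borel_measurable lebesgue"
        using si[OF \<open>A \<in> sets lebesgue\<close>] si[of S] A(4) by (auto simp: set_integrable_def)
    qed (use A in \<open>auto elim!: eventually_mono simp: indicator_def\<close>)
    then show "(LINT z:A|lebesgue. f z) = (LINT z:A|lebesgue. 0)"
      using borel[of S] A(4) by (simp add: set_lebesgue_integral_def)
  qed (use f in auto)
  then show ?thesis by simp
qed

text \<open>The fundamental lemma of the calculus of variations.\<close>

lemma fundamental_lemma_real:
  fixes g :: "'a::euclidean_space \<Rightarrow> real"
  assumes "open U" and g: "locally_integrable U g"
    and test: "\<And>\<phi>. test_fun U \<phi> \<Longrightarrow> (LINT z:U|lebesgue. \<phi> z *\<^sub>R g z) = 0"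
  shows "AE z in lebesgue. z \<in> U \<longrightarrow> g z = 0"
proof -
  have cb: "AE z in lebesgue. z \<in> cbox a b \<longrightarrow> g z = 0" if ab: "cbox a b \<subseteq> U" for a b
  proof -
    have gc: "set_integrable lebesgue (cbox c d) g" if "cbox c d \<subseteq> U" for c d
      using g that by (auto simp: locally_integrable_def)
    have gb: "set_integrable lebesgue (box a b) g"
      by (rule set_integrable_subset[OF gc[OF ab]]) (auto simp: box_subset_cbox)
    let ?f = "\<lambda>z. indicator (box a b) z *\<^sub>R g z"
    have "AE z in lebesgue. ?f z = 0"
    proof (rule AE_eq_0_of_box_integrals)
      show "integrable lebesgue ?f" using gb by (simp add: set_integrable_def)
      show "integral\<^sup>L lebesgue ?f = 0"
        using box_integral_eq_0[OF gc[OF ab] ab test] by (simp add: set_lebesgue_integral_def)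
      show "(LINT z:box c d|lebesgue. ?f z) = 0" for c d
      proof -
        obtain c' d' where cd: "box a b \<inter> box c d = box c' d'"
          using box_Int_box[of a b c d] by blast
        have "(LINT z:box c d|lebesgue. ?f z) = (LINT z:box c' d'|lebesgue. g z)"
          unfolding set_lebesgue_integral_def cd[symmetric]
          by (intro Bochner_Integration.integral_cong) (auto simp: indicator_def)
        also have "\<dots> = 0"
        proof (cases "box c' d' = {}")
          case True then show ?thesis by (simp add: set_lebesgue_integral_def)
        next
          case False
          have "cbox c' d' = closure (box c' d')" using False by (rule closure_box[symmetric])
          also have "\<dots> \<subseteq> cbox a b" using cd box_subset_cbox[of a b] by (intro closure_minimal) auto
          finally have "cbox c' d' \<subseteq> U" using ab by auto
          then show ?thesis using box_integral_eq_0[OF gc _ test] by blast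
        qed
        finally show ?thesis .
      qed
    qed
    moreover have "AE z in lebesgue. z \<notin> cbox a b - box a b"
      using negligible_frontier_interval[of a b] negligible_iff_null_sets by (intro AE_not_in) blast
    ultimately show ?thesis
      by eventually_elim (auto simp: indicator_def split: if_splits)
  qed
  obtain D where D: "countable D" "D \<subseteq> Pow U" "\<And>X. X \<in> D \<Longrightarrow> \<exists>a b. X = cbox a b" "\<Union>D = U"
    using open_countable_Union_open_cbox[OF \<open>open U\<close>] by metis
  have "AE z in lebesgue. \<forall>X\<in>D. z \<in> X \<longrightarrow> g z = 0"
    using D cb by (subst AE_ball_countable) (auto, metis Pow_iff subsetD)
  then show ?thesis
    by eventually_elim (use D(4) in blast)
qed

lemma locally_integrable_inner:
  "locally_integrable U f \<Longrightarrow> locally_integrable U (\<lambda>z. f z \<bullet> c)"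
  unfolding locally_integrable_def set_integrable_def
  by (metis (mono_tags, lifting) Bochner_Integration.integrable_cong inner_scaleR_left integrable_inner_left real_scaleR_def)

lemma locally_integrable_add:
  "locally_integrable U f \<Longrightarrow> locally_integrable U g \<Longrightarrow> locally_integrable U (\<lambda>z. f z + g z)"
  unfolding locally_integrable_def set_integrable_def by (simp add: scaleR_add_right)

lemma locally_integrable_diff:
  "locally_integrable U f \<Longrightarrow> locally_integrable U g \<Longrightarrow> locally_integrable U (\<lambda>z. f z - g z)"
  unfolding locally_integrable_def set_integrable_def by (simp add: scaleR_diff_right)

lemma locally_integrable_subset:
  "locally_integrable U f \<Longrightarrow> V \<subseteq> U \<Longrightarrow> locally_integrable V f"
  unfolding locally_integrable_def by blast

lemma test_fun_subset: "test_fun V \<phi> \<Longrightarrow> V \<subseteq> U \<Longrightarrow> test_fun U \<phi>"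
  unfolding test_fun_def by blast

lemma test_fun_support:
  assumes "test_fun U \<phi>"
  obtains K where "compact K" "K \<subseteq> U" "\<And>z. z \<notin> K \<Longrightarrow> \<phi> z = 0"
    "\<And>e z. e \<in> Basis \<Longrightarrow> z \<notin> K \<Longrightarrow> ddir e \<phi> z = 0"
proof -
  let ?K = "closure {z. \<phi> z \<noteq> 0}"
  have 0: "\<phi> z = 0" if "z \<notin> ?K" for z
    using that closure_subset[of "{z. \<phi> z \<noteq> 0}"] by blast
  have 1: "ddir e \<phi> z = 0" if "z \<notin> ?K" for e z
    by (intro ddirI ddir_eq_0_outside[OF closed_closure 0 that])
  have "compact ?K" "?K \<subseteq> U"
    using assms unfolding test_fun_def by blast+
  then show ?thesis
    using that 0 1 by blast
qed

lemma test_fun_integrable: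
  fixes g :: "'a::euclidean_space \<Rightarrow> 'b::euclidean_space"
  assumes "test_fun U \<phi>" "locally_integrable U g"
  shows "set_integrable lebesgue U (\<lambda>z. \<phi> z *\<^sub>R g z)"
    and "e \<in> Basis \<Longrightarrow> set_integrable lebesgue U (\<lambda>z. ddir e \<phi> z *\<^sub>R g z)"
proof -
  obtain K where K: "compact K" "K \<subseteq> U" "\<And>z. z \<notin> K \<Longrightarrow> \<phi> z = 0"
    "\<And>e z. e \<in> Basis \<Longrightarrow> z \<notin> K \<Longrightarrow> ddir e \<phi> z = 0"
    using test_fun_support[OF assms(1)] by metis
  have *: "set_integrable lebesgue U (\<lambda>z. \<zeta> z *\<^sub>R g z)"
    if cont: "continuous_on UNIV \<zeta>" and 0: "\<And>z. z \<notin> K \<Longrightarrow> \<zeta> z = 0" for \<zeta> :: "'a \<Rightarrow> real"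
  proof -
    obtain B where "\<And>z. norm (\<zeta> z) \<le> B"
      using bounded_of_compact_support[of K \<zeta>, OF K(1) cont 0] by blast
    then have "integrable lebesgue (\<lambda>z. \<zeta> z *\<^sub>R (indicator K z *\<^sub>R g z))"
      using assms(2) K cont by (intro set_integrable_lebesgue_bounded_mult[where B=B]) (auto simp: locally_integrable_def)
    moreover have "\<zeta> z *\<^sub>R (indicator K z *\<^sub>R g z) = indicator U z *\<^sub>R (\<zeta> z *\<^sub>R g z)" for z
      using 0[of z] K(2) by (auto simp: indicator_def)
    ultimately show ?thesis by (simp only: set_integrable_def)
  qed
  show "set_integrable lebesgue U (\<lambda>z. \<phi> z *\<^sub>R g z)"
    by (rule *[OF test_funD(1)[OF assms(1)] K(3)])
  show "set_integrable lebesgue U (\<lambda>z. ddir e \<phi> z *\<^sub>R g z)" if "e \<in> Basis"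
    by (rule *[OF test_funD(3)[OF assms(1) that] K(4)[OF that]])
qed

lemma test_integral_subset:
  assumes "test_fun V \<phi>" "V \<subseteq> U"
  shows "(LINT z:U|lebesgue. \<phi> z *\<^sub>R g z) = (LINT z:V|lebesgue. \<phi> z *\<^sub>R g z)"
    and "e \<in> Basis \<Longrightarrow> (LINT z:U|lebesgue. ddir e \<phi> z *\<^sub>R g z) = (LINT z:V|lebesgue. ddir e \<phi> z *\<^sub>R g z)"
proof -
  obtain K where K: "K \<subseteq> V" "\<And>z. z \<notin> K \<Longrightarrow> \<phi> z = 0"
    "\<And>e z. e \<in> Basis \<Longrightarrow> z \<notin> K \<Longrightarrow> ddir e \<phi> z = 0"
    using test_fun_support[OF assms(1)] by metis
  show "(LINT z:U|lebesgue. \<phi> z *\<^sub>R g z) = (LINT z:V|lebesgue. \<phi> z *\<^sub>R g z)"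
    unfolding set_lebesgue_integral_def
    by (intro Bochner_Integration.integral_cong) (use K assms(2) in \<open>auto simp: indicator_def\<close>)
  show "(LINT z:U|lebesgue. ddir e \<phi> z *\<^sub>R g z) = (LINT z:V|lebesgue. ddir e \<phi> z *\<^sub>R g z)" if "e \<in> Basis"
    unfolding set_lebesgue_integral_def
    by (intro Bochner_Integration.integral_cong) (use K(1) K(3)[OF that] assms(2) in \<open>auto simp: indicator_def\<close>)
qed

lemma fundamental_lemma:
  fixes g :: "'a::euclidean_space \<Rightarrow> 'b::euclidean_space"
  assumes "open U" and g: "locally_integrable U g"
    and test: "\<And>\<phi>. test_fun U \<phi> \<Longrightarrow> (LINT z:U|lebesgue. \<phi> z *\<^sub>R g z) = 0"
  shows "AE z in lebesgue. z \<in> U \<longrightarrow> g z = 0"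
proof -
  have "AE z in lebesgue. z \<in> U \<longrightarrow> g z \<bullet> c = 0" for c
  proof (rule fundamental_lemma_real[OF assms(1) locally_integrable_inner[OF g]])
    fix \<phi> :: "'a \<Rightarrow> real" assume \<phi>: "test_fun U \<phi>"
    have "(LINT z:U|lebesgue. \<phi> z *\<^sub>R (g z \<bullet> c)) = (LINT z|lebesgue. (indicator U z *\<^sub>R \<phi> z *\<^sub>R g z) \<bullet> c)"
      by (simp add: set_lebesgue_integral_def mult.assoc)
    also have "\<dots> = (LINT z:U|lebesgue. \<phi> z *\<^sub>R g z) \<bullet> c"
      unfolding set_lebesgue_integral_def
      by (rule integral_inner_left) (use test_fun_integrable(1)[OF \<phi> g] in \<open>simp add: set_integrable_def\<close>)
    finally show "(LINT z:U|lebesgue. \<phi> z *\<^sub>R (g z \<bullet> c)) = 0"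
      using test[OF \<phi>] by simp
  qed
  then have "AE z in lebesgue. \<forall>c\<in>Basis. z \<in> U \<longrightarrow> g z \<bullet> c = 0"
    by (subst AE_ball_countable) (auto simp: countable_finite)
  then show ?thesis
    by eventually_elim (auto intro: euclidean_eqI)
qed

lemma has_weak_ddir_unique:
  fixes u g1 g2 :: "'a::euclidean_space \<Rightarrow> 'b::euclidean_space"
  assumes "open U" "has_weak_ddir U e u g1" "has_weak_ddir U e u g2"
  shows "AE z in lebesgue. z \<in> U \<longrightarrow> g1 z = g2 z"
proof -
  have "AE z in lebesgue. z \<in> U \<longrightarrow> g1 z - g2 z = 0"
  proof (rule fundamental_lemma[OF assms(1)])
    show "locally_integrable U (\<lambda>z. g1 z - g2 z)"
      using assms by (intro locally_integrable_diff) (auto simp: has_weak_ddir_def)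
    fix \<phi> :: "'a \<Rightarrow> real" assume \<phi>: "test_fun U \<phi>"
    have "(LINT z:U|lebesgue. \<phi> z *\<^sub>R g1 z - \<phi> z *\<^sub>R g2 z) = (LINT z:U|lebesgue. \<phi> z *\<^sub>R g1 z) - (LINT z:U|lebesgue. \<phi> z *\<^sub>R g2 z)"
      using assms by (intro set_integral_diff test_fun_integrable[OF \<phi>]) (auto simp: has_weak_ddir_def)
    also have "\<dots> = 0"
      using assms(2,3) \<phi> unfolding has_weak_ddir_def by (metis minus_equation_iff right_minus_eq)
    finally show "(LINT z:U|lebesgue. \<phi> z *\<^sub>R (g1 z - g2 z)) = 0"
      by (simp add: scaleR_diff_right)
  qed
  then show ?thesis by simp
qed

lemma has_weak_ddir_subset:
  assumes "has_weak_ddir U e u g" "V \<subseteq> U" "e \<in> Basis"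
  shows "has_weak_ddir V e u g"
  unfolding has_weak_ddir_def
proof (intro conjI allI impI)
  show "locally_integrable V u" "locally_integrable V g"
    using assms locally_integrable_subset unfolding has_weak_ddir_def by blast+
  fix \<phi> :: "'a \<Rightarrow> real" assume \<phi>: "test_fun V \<phi>"
  show "(LINT z:V|lebesgue. ddir e \<phi> z *\<^sub>R u z) = - (LINT z:V|lebesgue. \<phi> z *\<^sub>R g z)"
    using assms(1) test_fun_subset[OF \<phi> assms(2)]
    unfolding has_weak_ddir_def test_integral_subset[OF \<phi> assms(2), symmetric]
      test_integral_subset(2)[OF \<phi> assms(2,3), symmetric] by blast
qed

lemma has_weak_ddir_add:
  assumes "has_weak_ddir U e u g" "has_weak_ddir U e v h" "e \<in> Basis"
  shows "has_weak_ddir U e (\<lambda>z. u z + v z) (\<lambda>z. g z + h z)"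
  unfolding has_weak_ddir_def
proof (intro conjI allI impI)
  have li: "locally_integrable U u" "locally_integrable U g" "locally_integrable U v" "locally_integrable U h"
    using assms by (auto simp: has_weak_ddir_def)
  then show "locally_integrable U (\<lambda>z. u z + v z)" "locally_integrable U (\<lambda>z. g z + h z)"
    by (auto intro: locally_integrable_add)
  fix \<phi> :: "'a \<Rightarrow> real" assume \<phi>: "test_fun U \<phi>"
  show "(LINT z:U|lebesgue. ddir e \<phi> z *\<^sub>R (u z + v z)) = - (LINT z:U|lebesgue. \<phi> z *\<^sub>R (g z + h z))"
    using assms(1,2) \<phi> unfolding has_weak_ddir_def scaleR_add_right
    by (simp add: set_integral_add test_fun_integrable[OF \<phi>] li assms(3))
qed

lemma has_weak_ddir_inner:
  assumes "has_weak_ddir U e u g" "e \<in> Basis"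
  shows "has_weak_ddir U e (\<lambda>z. u z \<bullet> c) (\<lambda>z. g z \<bullet> c)"
  unfolding has_weak_ddir_def
proof (intro conjI allI impI)
  have li: "locally_integrable U u" "locally_integrable U g"
    using assms by (auto simp: has_weak_ddir_def)
  then show "locally_integrable U (\<lambda>z. u z \<bullet> c)" "locally_integrable U (\<lambda>z. g z \<bullet> c)"
    by (auto intro: locally_integrable_inner)
  fix \<phi> :: "'a \<Rightarrow> real" assume \<phi>: "test_fun U \<phi>"
  have *: "(LINT z:U|lebesgue. \<zeta> z *\<^sub>R (f z \<bullet> c)) = (LINT z:U|lebesgue. \<zeta> z *\<^sub>R f z) \<bullet> c"
    if "set_integrable lebesgue U (\<lambda>z. \<zeta> z *\<^sub>R f z)" for \<zeta> :: "'a \<Rightarrow> real" and f :: "'a \<Rightarrow> 'b"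
  proof -
    have "(LINT z:U|lebesgue. \<zeta> z *\<^sub>R (f z \<bullet> c)) = (LINT z|lebesgue. (indicator U z *\<^sub>R \<zeta> z *\<^sub>R f z) \<bullet> c)"
      by (simp add: set_lebesgue_integral_def mult.assoc)
    also have "\<dots> = (LINT z:U|lebesgue. \<zeta> z *\<^sub>R f z) \<bullet> c"
      unfolding set_lebesgue_integral_def
      by (rule integral_inner_left) (use that in \<open>simp add: set_integrable_def\<close>)
    finally show ?thesis .
  qed
  have "(LINT z:U|lebesgue. ddir e \<phi> z *\<^sub>R u z) = - (LINT z:U|lebesgue. \<phi> z *\<^sub>R g z)"
    using assms(1) \<phi> unfolding has_weak_ddir_def by blast
  then show "(LINT z:U|lebesgue. ddir e \<phi> z *\<^sub>R (u z \<bullet> c)) = - (LINT z:U|lebesgue. \<phi> z *\<^sub>R (g z \<bullet> c))"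
    unfolding *[OF test_fun_integrable(1)[OF \<phi> li(2)]] *[OF test_fun_integrable(2)[OF \<phi> li(1) assms(2)]]
    by simp
qed

lemma locally_integrable_continuous:
  fixes f :: "'a::euclidean_space \<Rightarrow> 'b::euclidean_space"
  assumes "continuous_on U f"
  shows "locally_integrable U f"
  unfolding locally_integrable_def
proof (intro allI impI)
  fix K assume K: "compact K \<and> K \<subseteq> U"
  then have "integrable lborel (\<lambda>z. indicator K z *\<^sub>R f z)"
    using assms by (intro borel_integrable_compact) (auto intro: continuous_on_subset)
  then show "set_integrable lebesgue K f"
    unfolding set_integrable_def
    using integrable_completion[OF borel_measurable_integrable] by blast
qed

text \<open>A classical directional derivative that is continuous is a weak one.\<close>

lemma has_weak_ddir_of_C1:
  fixes u :: "'a::euclidean_space \<Rightarrow> 'b::euclidean_space"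
  assumes G: "open G" and e: "e \<in> Basis" and u: "continuous_on G u" "has_ddir_on e u G" "continuous_on G (ddir e u)"
  shows "has_weak_ddir G e u (ddir e u)"
  unfolding has_weak_ddir_def
proof (intro conjI allI impI locally_integrable_continuous u)
  fix \<phi> :: "'a \<Rightarrow> real" assume \<phi>: "test_fun G \<phi>"
  obtain K where K: "compact K" "K \<subseteq> G" "\<And>z. z \<notin> K \<Longrightarrow> \<phi> z = 0"
    "\<And>e z. e \<in> Basis \<Longrightarrow> z \<notin> K \<Longrightarrow> ddir e \<phi> z = 0"
    using test_fun_support[OF \<phi>] by metis
  define P where "P z = \<phi> z *\<^sub>R u z" for z
  define P' where "P' z = \<phi> z *\<^sub>R ddir e u z + ddir e \<phi> z *\<^sub>R u z" for z
  have un: "G \<union> - K = UNIV" "open (- K)"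
    using K by (auto simp: open_Compl compact_imp_closed)
  have P0: "P z = 0" "P' z = 0" if "z \<notin> K" for z
    using K(3,4) that e by (auto simp: P_def P'_def)
  have cP: "continuous_on UNIV P" "continuous_on UNIV P'"
  proof -
    have "continuous_on (G \<union> - K) P"
    proof (rule continuous_on_open_Un[OF G un(2)])
      show "continuous_on G P" unfolding P_def
        by (intro continuous_intros u continuous_on_subset[OF test_funD(1)[OF \<phi>]]) auto
      show "continuous_on (- K) P"
        using P0(1) by (subst continuous_on_cong[OF refl, of _ _ "\<lambda>_. 0"]) auto
    qed
    then show "continuous_on UNIV P" by (simp add: un)
    have "continuous_on (G \<union> - K) P'"
    proof (rule continuous_on_open_Un[OF G un(2)])
      show "continuous_on G P'" unfolding P'_def
        by (intro continuous_intros u continuous_on_subset[OF test_funD(1)[OF \<phi>]]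
            continuous_on_subset[OF test_funD(3)[OF \<phi> e]]) auto
      show "continuous_on (- K) P'"
        using P0(2) by (subst continuous_on_cong[OF refl, of _ _ "\<lambda>_. 0"]) auto
    qed
    then show "continuous_on UNIV P'" by (simp add: un)
  qed
  have "integral\<^sup>L lebesgue P' = 0"
  proof (rule integral_ddir_eq_0[OF K(1) P0(1) cP])
    fix z
    show "((\<lambda>s. P (z + s *\<^sub>R e)) has_vector_derivative P' z) (at 0)"
    proof (cases "z \<in> G")
      case True
      have "((\<lambda>s. u (z + s *\<^sub>R e)) has_vector_derivative ddir e u z) (at 0)"
        using u(2) True by (auto simp: has_ddir_on_def ddir_def vector_derivative_works)
      moreover have "((\<lambda>s. \<phi> (z + s *\<^sub>R e)) has_real_derivative ddir e \<phi> z) (at 0)"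
        using test_funD(2)[OF \<phi> e] by (simp add: has_real_derivative_iff_has_vector_derivative)
      ultimately have "((\<lambda>s. \<phi> (z + s *\<^sub>R e) *\<^sub>R u (z + s *\<^sub>R e)) has_vector_derivative
          \<phi> (z + 0 *\<^sub>R e) *\<^sub>R ddir e u z + ddir e \<phi> z *\<^sub>R u (z + 0 *\<^sub>R e)) (at 0)"
        by (intro has_vector_derivative_scaleR)
      then show ?thesis by (simp add: P_def P'_def)
    next
      case False
      then have "z \<notin> K" using K(2) by blast
      then show ?thesis
        using ddir_eq_0_outside[of K P z e, OF compact_imp_closed[OF K(1)] P0(1)] P0(2)[of z] by simp
    qed
  qed auto
  moreover have "integral\<^sup>L lebesgue P' = (LINT z:G|lebesgue. \<phi> z *\<^sub>R ddir e u z + ddir e \<phi> z *\<^sub>R u z)"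
    unfolding set_lebesgue_integral_def
    by (intro Bochner_Integration.integral_cong) (use P0(2) K(2) in \<open>auto simp: P'_def[symmetric] indicator_def\<close>)
  moreover have "\<dots> = (LINT z:G|lebesgue. \<phi> z *\<^sub>R ddir e u z) + (LINT z:G|lebesgue. ddir e \<phi> z *\<^sub>R u z)"
    by (intro set_integral_add test_fun_integrable[OF \<phi>] locally_integrable_continuous u e)
  ultimately show "(LINT z:G|lebesgue. ddir e \<phi> z *\<^sub>R u z) = - (LINT z:G|lebesgue. \<phi> z *\<^sub>R ddir e u z)"
    by (simp add: eq_neg_iff_add_eq_0 add.commute)
qed

lemma has_weak_ddir_wddir: "has_weak_ddir U e u g \<Longrightarrow> has_weak_ddir U e u (wddir U e u)"
  unfolding wddir_def using someI[of "has_weak_ddir U e u" g] by simp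

lemma wddir_AE_eq:
  fixes u :: "'a::euclidean_space \<Rightarrow> 'b::euclidean_space"
  assumes "open U" "has_weak_ddir U e u g"
  shows "AE z in lebesgue. z \<in> U \<longrightarrow> wddir U e u z = g z"
  using has_weak_ddir_unique[OF assms(1) has_weak_ddir_wddir[OF assms(2)] assms(2)] .

text \<open>On an open set where the function is of class \<open>C\<^sup>1\<close> every weak derivative is the classical one.\<close>

lemma wddir_AE_eq_ddir:
  fixes u :: "'a::euclidean_space \<Rightarrow> 'b::euclidean_space"
  assumes "has_weak_ddir U e u g" "e \<in> Basis" "open G" "G \<subseteq> U" "Ck_closure 1 G u"
  shows "AE z in lebesgue. z \<in> G \<longrightarrow> wddir U e u z = ddir e u z"
proof -
  have "has_weak_ddir G e u (ddir e u)"
    using assms by (intro has_weak_ddir_of_C1 extends_cont_imp_continuous_on) auto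
  then show ?thesis
    using has_weak_ddir_unique[OF assms(3)] has_weak_ddir_subset[OF has_weak_ddir_wddir[OF assms(1)] assms(4,2)] by blast
qed

section \<open>Segments in the constraint set\<close>

lemma open_S_set: "open (S_set \<delta> :: ((real^'n) \<times> (real^'n)) set)"
proof -
  have "S_set \<delta> = {x::(real^'n) \<times> (real^'n). \<delta> * norm ((1 - fst x \<bullet> snd x) *\<^sub>R fst x - snd x)
      + (norm (snd x))\<^sup>2 + (fst x \<bullet> snd x)\<^sup>2 - fst x \<bullet> snd x < 0}"
    by (auto simp: S_set_def)
  also have "open \<dots>"
    by (intro open_Collect_less continuous_intros)
  finally show ?thesis .
qed

lemma S_set_norm_le:
  assumes "(p, \<beta>) \<in> S_set \<delta>" "\<delta> \<ge> 0"
  shows "norm \<beta> \<le> 1 / 2"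
proof -
  have "0 \<le> \<delta> * norm ((1 - p \<bullet> \<beta>) *\<^sub>R p - \<beta>)"
    using assms(2) by simp
  then have "(norm \<beta>)\<^sup>2 + (p \<bullet> \<beta>)\<^sup>2 - p \<bullet> \<beta> < 0"
    using assms(1) by (auto simp: S_set_def)
  moreover have "0 \<le> (p \<bullet> \<beta> - 1/2)\<^sup>2" by simp
  then have "0 \<le> (p \<bullet> \<beta>)\<^sup>2 - p \<bullet> \<beta> + 1/4" by (simp add: power2_eq_square algebra_simps)
  ultimately have "(norm \<beta>)\<^sup>2 \<le> (1/2)\<^sup>2" by (simp add: power2_eq_square)
  then show ?thesis by (rule power2_le_imp_le) simp
qed

lemma norm_sigma_le: "norm (sigma p) \<le> 1 / 2"
proof -
  have "0 \<le> (norm p - 1)\<^sup>2" by simp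
  then have "2 * norm p \<le> 1 + (norm p)\<^sup>2" by (simp add: power2_eq_square algebra_simps)
  moreover have "0 < 1 + (norm p)\<^sup>2" by (simp add: add_pos_nonneg)
  ultimately show ?thesis by (simp add: sigma_def field_simps)
qed

lemma continuous_on_sigma: "continuous_on UNIV (sigma :: real^'n \<Rightarrow> real^'n)"
proof -
  have "1 + (norm p)\<^sup>2 \<noteq> 0" for p :: "real^'n"
    using zero_le_power2[of "norm p"] by linarith
  then show ?thesis unfolding sigma_def by (intro continuous_intros) auto
qed

text \<open>Stereographic projection: \<open>(\<beta>, s)\<close> with \<open>s = p \<bullet> \<beta>\<close> is the image of \<open>p\<close> on the sphere
  \<open>|\<beta>|\<^sup>2 + s\<^sup>2 = s\<close> exactly if \<open>p\<close>, \<open>\<beta>\<close> satisfy the linear relation below.\<close>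

lemma eq_sigma:
  fixes p \<beta> :: "real^'n"
  assumes "(1 - p \<bullet> \<beta>) *\<^sub>R p = \<beta>"
  shows "\<beta> = sigma p"
proof -
  define s where "s = p \<bullet> \<beta>"
  have \<beta>: "\<beta> = (1 - s) *\<^sub>R p" using assms by (simp add: s_def)
  have "s = p \<bullet> ((1 - s) *\<^sub>R p)" unfolding \<beta>[symmetric] by (simp add: s_def)
  also have "\<dots> = (1 - s) * (norm p)\<^sup>2" by (simp add: power2_norm_eq_inner)
  finally have "(1 - s) * (1 + (norm p)\<^sup>2) = 1" by (simp add: algebra_simps)
  then have "1 - s = inverse (1 + (norm p)\<^sup>2)"
    by (metis inverse_unique mult.commute)
  then show ?thesis using \<beta> by (simp add: sigma_def)
qed

lemma quadratic_between_roots: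
  fixes K L F :: real
  assumes "K > 0" "F < 0"
  obtains t1 t2 where "t1 < 0" "0 < t2" "\<And>t. F + t * L + t\<^sup>2 * K = K * (t - t1) * (t - t2)"
proof -
  define D where "D = L\<^sup>2 - 4 * K * F"
  have "D > L\<^sup>2" using assms by (simp add: D_def mult_neg_pos mult_pos_neg)
  then have s: "sqrt D > \<bar>L\<bar>"
    by (metis real_sqrt_abs real_sqrt_less_iff)
  have D0: "D \<ge> 0" using \<open>D > L\<^sup>2\<close> zero_le_power2[of L] by linarith
  show ?thesis
  proof
    show "(- L - sqrt D) / (2 * K) < 0" using s assms by (simp add: field_simps)
    show "0 < (- L + sqrt D) / (2 * K)" using s assms by (simp add: field_simps)
    fix t
    have "K * (t - (- L - sqrt D) / (2 * K)) * (t - (- L + sqrt D) / (2 * K))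
       = ((2 * K * t + L + sqrt D) * (2 * K * t + L - sqrt D)) / (4 * K)"
      using assms by (simp add: field_simps)
    also have "\<dots> = ((2 * K * t + L)\<^sup>2 - D) / (4 * K)"
      using D0 by (simp add: algebra_simps power2_eq_square)
    also have "\<dots> = F + t * L + t\<^sup>2 * K"
      using assms by (simp add: D_def field_simps power2_eq_square)
    finally show "F + t * L + t\<^sup>2 * K = K * (t - (- L - sqrt D) / (2 * K)) * (t - (- L + sqrt D) / (2 * K))" ..
  qed
qed

text \<open>Write \<open>s = p \<bullet> \<beta>\<close> and \<open>F = |\<beta>|\<^sup>2 + s\<^sup>2 - s\<close>, so that \<open>S_set \<delta>\<close> is the set where
  \<open>\<delta> |(1 - s) p - \<beta>| + F < 0\<close>. Through every point of \<open>S_set \<delta>\<close> there is a line in a direction \<open>(c, \<gamma>)\<close> of the wave cone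
  \<open>c \<bullet> \<gamma> = 0\<close> along which the vector \<open>(1 - s) p - \<beta>\<close> stays equal to \<open>F c\<close>, where \<open>F\<close> is a
  strictly convex quadratic polynomial. Here \<open>\<gamma> = sigma w\<close> for the component \<open>w\<close> of \<open>p\<close> orthogonal
  to \<open>c\<close>, and \<open>s\<close> is affine along the line with slope \<open>\<kappa> = - 1 / (1 + |w|\<^sup>2)\<close>.\<close>

lemma S_set_line:
  fixes p \<beta> :: "real^'n"
  assumes S: "(p, \<beta>) \<in> S_set \<delta>" and "\<delta> > 0"
  obtains c \<gamma> :: "real^'n" and t1 t2 K :: real where "c \<noteq> 0" "\<gamma> \<bullet> c = 0" "\<delta> * norm c < 1" "t1 < 0" "0 < t2" "K > 0"
    "\<And>t. (norm (\<beta> + t *\<^sub>R \<gamma>))\<^sup>2 + ((p + t *\<^sub>R c) \<bullet> (\<beta> + t *\<^sub>R \<gamma>))\<^sup>2 - (p + t *\<^sub>R c) \<bullet> (\<beta> + t *\<^sub>R \<gamma>)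
       = K * (t - t1) * (t - t2)"
    "\<And>t. (1 - (p + t *\<^sub>R c) \<bullet> (\<beta> + t *\<^sub>R \<gamma>)) *\<^sub>R (p + t *\<^sub>R c) - (\<beta> + t *\<^sub>R \<gamma>) = (K * (t - t1) * (t - t2)) *\<^sub>R c"
proof -
  define s where "s = p \<bullet> \<beta>"
  define r where "r = (1 - s) *\<^sub>R p - \<beta>"
  define F where "F = \<beta> \<bullet> \<beta> + s\<^sup>2 - s"
  define c where "c = r /\<^sub>R F"
  have S': "\<delta> * norm r + F < 0"
    using S by (simp add: S_set_def F_def r_def s_def power2_norm_eq_inner algebra_simps)
  moreover have "0 \<le> \<delta> * norm r" using \<open>\<delta> > 0\<close> by simp
  ultimately have F: "F < 0" by linarith
  have r: "r = F *\<^sub>R c" using F by (simp add: c_def)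
  have dc: "\<delta> * norm c < 1"
  proof -
    have "norm r = - F * norm c" using F by (simp add: r)
    then have "F * (1 - \<delta> * norm c) < 0" using S' by (simp add: algebra_simps)
    then show ?thesis using F by (simp add: mult_less_0_iff)
  qed
  have \<beta>: "\<beta> = (1 - s) *\<^sub>R p - F *\<^sub>R c" using r by (simp add: r_def algebra_simps)
  have "F * (c \<bullet> \<beta>) = r \<bullet> \<beta>" by (simp add: r)
  also have "\<dots> = - F" by (simp add: r_def F_def s_def inner_diff_left power2_eq_square algebra_simps)
  finally have "F * (c \<bullet> \<beta>) = F * (- 1)" by simp
  then have c\<beta>: "c \<bullet> \<beta> = -1" using F by (metis mult_cancel_left less_irrefl)
  then have c0: "c \<noteq> 0" by auto
  define m where "m = c \<bullet> c"
  have m: "m > 0" using c0 by (simp add: m_def)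
  define a where "a = (p \<bullet> c) / m"
  define w where "w = p - a *\<^sub>R c"
  have pw: "p = a *\<^sub>R c + w" by (simp add: w_def)
  have cw: "w \<bullet> c = 0" using m by (simp add: w_def inner_diff_left m_def[symmetric] a_def)
  define W where "W = w \<bullet> w"
  have W: "W \<ge> 0" by (simp add: W_def)
  define \<kappa> where "\<kappa> = - 1 / (1 + W)"
  define \<gamma> where "\<gamma> = (- \<kappa>) *\<^sub>R w"
  have cw': "c \<bullet> w = 0" using cw by (simp add: inner_commute)
  have pc: "p \<bullet> c = a * m" and pw': "p \<bullet> w = W" and pp: "p \<bullet> p = a\<^sup>2 * m + W"
    by (simp_all add: pw inner_add_left inner_add_right cw cw' m_def W_def power2_eq_square)
  have e1: "(1 - s) * (a * m) - F * m = - 1"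
    using c\<beta> unfolding \<beta> by (simp add: inner_diff_right inner_commute[of c p] pc m_def)
  have e2: "s = (1 - s) * (a\<^sup>2 * m + W) - F * (a * m)"
    using \<beta> pc pp unfolding s_def by (metis inner_diff_right inner_scaleR_right s_def)
  have e3: "(1 - s) * (1 + W) = 1 + a"
  proof -
    have "s = (1 - s) * W + a * ((1 - s) * (a * m) - F * m)"
      using e2 by (simp add: power2_eq_square algebra_simps)
    then show ?thesis unfolding e1 by (simp add: algebra_simps)
  qed
  have s1: "1 - s = - \<kappa> * (1 + a)"
    using e3 W by (simp add: \<kappa>_def field_simps)
  have \<kappa>W: "\<kappa> * W = - 1 - \<kappa>" using W by (simp add: \<kappa>_def field_simps)
  have \<kappa>0: "\<kappa> < 0" using W by (simp add: \<kappa>_def field_simps)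
  have pg: "p \<bullet> \<gamma> = 1 + \<kappa>" using \<kappa>W by (simp add: \<gamma>_def pw')
  have cg: "c \<bullet> \<gamma> = 0" by (simp add: \<gamma>_def cw')
  have st: "(p + t *\<^sub>R c) \<bullet> (\<beta> + t *\<^sub>R \<gamma>) = s + t * \<kappa>" for t
    by (simp add: inner_add_left inner_add_right s_def[symmetric] pg cg c\<beta> algebra_simps)
  have \<beta>w: "\<beta> \<bullet> w = (1 - s) * W"
    unfolding \<beta> by (simp add: inner_diff_left pw' cw')
  define L where "L = 2 * (\<beta> \<bullet> \<gamma>) + 2 * s * \<kappa> - \<kappa>"
  have \<beta>g: "\<beta> \<bullet> \<gamma> = (1 - s) * (1 + \<kappa>)"
  proof -
    have "\<beta> \<bullet> \<gamma> = (1 - s) * - (\<kappa> * W)" by (simp add: \<gamma>_def \<beta>w)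
    then show ?thesis unfolding \<kappa>W by simp
  qed
  have L: "L = 2 * (1 - s) + \<kappa>"
    by (simp add: L_def \<beta>g algebra_simps)
  have gg: "\<gamma> \<bullet> \<gamma> = - \<kappa> - \<kappa>\<^sup>2"
  proof -
    have "\<gamma> \<bullet> \<gamma> = \<kappa> * (\<kappa> * W)" by (simp add: \<gamma>_def W_def)
    then show ?thesis unfolding \<kappa>W by (simp add: power2_eq_square algebra_simps)
  qed
  have Ft: "(norm (\<beta> + t *\<^sub>R \<gamma>))\<^sup>2 + ((p + t *\<^sub>R c) \<bullet> (\<beta> + t *\<^sub>R \<gamma>))\<^sup>2 - (p + t *\<^sub>R c) \<bullet> (\<beta> + t *\<^sub>R \<gamma>)
       = F + t * L + t\<^sup>2 * (- \<kappa>)" for t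
  proof -
    have "(norm (\<beta> + t *\<^sub>R \<gamma>))\<^sup>2 = \<beta> \<bullet> \<beta> + 2 * t * (\<beta> \<bullet> \<gamma>) + t\<^sup>2 * (\<gamma> \<bullet> \<gamma>)"
      unfolding power2_norm_eq_inner
      by (simp add: inner_add_left inner_add_right inner_commute[of \<gamma> \<beta>] power2_eq_square algebra_simps)
    then show ?thesis
      unfolding st gg by (simp add: F_def L_def power2_eq_square algebra_simps)
  qed
  have rt: "(1 - (p + t *\<^sub>R c) \<bullet> (\<beta> + t *\<^sub>R \<gamma>)) *\<^sub>R (p + t *\<^sub>R c) - (\<beta> + t *\<^sub>R \<gamma>) = (F + t * L + t\<^sup>2 * (- \<kappa>)) *\<^sub>R c" for t
  proof -
    have "(1 - (s + t * \<kappa>)) *\<^sub>R (p + t *\<^sub>R c) - (\<beta> + t *\<^sub>R \<gamma>)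
        = (F + t * (1 - s) - t * \<kappa> * a - t\<^sup>2 * \<kappa>) *\<^sub>R c"
      unfolding \<beta> \<gamma>_def by (simp add: w_def algebra_simps power2_eq_square)
    moreover have "F + t * (1 - s) - t * \<kappa> * a - t\<^sup>2 * \<kappa> = F + t * L + t\<^sup>2 * (- \<kappa>)"
      unfolding L s1 by (simp add: algebra_simps)
    ultimately show ?thesis unfolding st by simp
  qed
  obtain t1 t2 where t: "t1 < 0" "0 < t2" "\<And>t. F + t * L + t\<^sup>2 * (- \<kappa>) = (- \<kappa>) * (t - t1) * (t - t2)"
    using quadratic_between_roots[of "- \<kappa>" F L] \<kappa>0 F by auto
  show ?thesis
    using that[of c \<gamma> t1 t2 "- \<kappa>"] c0 cg dc t \<kappa>0 Ft rt by (simp add: inner_commute)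
qed

text \<open>Between the two roots of \<open>F\<close> the line stays in \<open>S_set \<delta>\<close>, and at the roots it meets the graph of
  \<open>sigma\<close>. Stopping short of the roots gives a compact segment in the open set \<open>S_set \<delta>\<close>.\<close>

lemma S_set_segment:
  fixes p \<beta> :: "real^'n"
  assumes S: "(p, \<beta>) \<in> S_set \<delta>" and "\<delta> > 0" "e > 0"
  obtains c \<gamma> :: "real^'n" and a b :: real where "c \<noteq> 0" "\<gamma> \<bullet> c = 0" "a > 0" "b > 0"
    "\<And>t. t \<in> {-a..b} \<Longrightarrow> (p + t *\<^sub>R c, \<beta> + t *\<^sub>R \<gamma>) \<in> S_set \<delta>"
    "\<And>t. t \<in> {-a, b} \<Longrightarrow> norm (\<beta> + t *\<^sub>R \<gamma> - sigma (p + t *\<^sub>R c)) < e"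
proof -
  obtain c \<gamma> :: "real^'n" and t1 t2 K where *: "c \<noteq> 0" "\<gamma> \<bullet> c = 0" "\<delta> * norm c < 1" "t1 < 0" "0 < t2" "K > 0"
    and F: "\<And>t. (norm (\<beta> + t *\<^sub>R \<gamma>))\<^sup>2 + ((p + t *\<^sub>R c) \<bullet> (\<beta> + t *\<^sub>R \<gamma>))\<^sup>2 - (p + t *\<^sub>R c) \<bullet> (\<beta> + t *\<^sub>R \<gamma>)
       = K * (t - t1) * (t - t2)"
    and r: "\<And>t. (1 - (p + t *\<^sub>R c) \<bullet> (\<beta> + t *\<^sub>R \<gamma>)) *\<^sub>R (p + t *\<^sub>R c) - (\<beta> + t *\<^sub>R \<gamma>) = (K * (t - t1) * (t - t2)) *\<^sub>R c"
    using S_set_line[OF assms(1,2)] by metis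
  have inS: "(p + t *\<^sub>R c, \<beta> + t *\<^sub>R \<gamma>) \<in> S_set \<delta>" if "t1 < t" "t < t2" for t
  proof -
    define f where "f = K * (t - t1) * (t - t2)"
    have f: "f < 0" using that *(6) by (simp add: f_def mult_pos_neg)
    have "f * (1 - \<delta> * norm c) < 0" using f *(3) by (simp add: mult_neg_pos)
    then have "\<delta> * norm (f *\<^sub>R c) + f < 0" using f by (simp add: algebra_simps)
    then show ?thesis
      using r[of t] F[of t] by (simp add: S_set_def f_def[symmetric] add.assoc diff_add_eq add_diff_eq)
  qed
  define N where "N t = norm (\<beta> + t *\<^sub>R \<gamma> - sigma (p + t *\<^sub>R c))" for t
  have contN: "continuous_on UNIV N"
    unfolding N_def by (intro continuous_intros continuous_on_compose2[OF continuous_on_sigma]) auto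
  have N0: "N t1 = 0" "N t2 = 0"
    using eq_sigma[of "p + t1 *\<^sub>R c" "\<beta> + t1 *\<^sub>R \<gamma>"] eq_sigma[of "p + t2 *\<^sub>R c" "\<beta> + t2 *\<^sub>R \<gamma>"] r[of t1] r[of t2]
    by (simp_all add: N_def)
  have "open {t. N t < e}"
    by (intro open_Collect_less contN continuous_intros)
  then obtain d1 d2 where d: "d1 > 0" "\<And>t. \<bar>t - t1\<bar> < d1 \<Longrightarrow> N t < e" "d2 > 0" "\<And>t. \<bar>t - t2\<bar> < d2 \<Longrightarrow> N t < e"
    using N0 \<open>e > 0\<close> unfolding open_dist dist_real_def by (metis mem_Collect_eq)
  define a where "a = - t1 - min d1 (- t1) / 2"
  define b where "b = t2 - min d2 t2 / 2"
  show ?thesis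
  proof (rule that[of c \<gamma> a b])
    show "a > 0" "b > 0" using d *(4,5) by (auto simp: a_def b_def)
    show "(p + t *\<^sub>R c, \<beta> + t *\<^sub>R \<gamma>) \<in> S_set \<delta>" if "t \<in> {-a..b}" for t
      using that d *(4,5) by (intro inS) (auto simp: a_def b_def min_def split: if_splits)
    have "N (-a) < e" using d(1) *(4) by (intro d(2)) (auto simp: a_def min_def)
    moreover have "N b < e" using d(3) *(5) by (intro d(4)) (auto simp: b_def min_def)
    ultimately show "norm (\<beta> + t *\<^sub>R \<gamma> - sigma (p + t *\<^sub>R c)) < e" if "t \<in> {-a, b}" for t
      using that by (auto simp: N_def)
  qed (use * in auto)
qed

section \<open>Oscillation profile and cutoff functions\<close>

lemma antiderivative_UNIV:
  fixes k :: "real \<Rightarrow> real"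
  assumes "continuous_on UNIV k"
  obtains g where "\<And>x. (g has_real_derivative k x) (at x)" "g 0 = 0"
proof -
  have "\<exists>F. \<forall>x. -\<infinity> < ereal x \<longrightarrow> ereal x < \<infinity> \<longrightarrow> (F has_vector_derivative k x) (at x)"
    using assms by (intro einterval_antiderivative) (auto simp: continuous_on_eq_continuous_at)
  then obtain F where "\<And>x. (F has_real_derivative k x) (at x)"
    by (auto simp: has_real_derivative_iff_has_vector_derivative)
  then have "((\<lambda>x. F x - F 0) has_real_derivative k x) (at x)" for x
    by (auto intro!: derivative_eq_intros)
  then show ?thesis using that[of "\<lambda>x. F x - F 0"] by auto
qed

lemma DERIV_bounded_diff:
  fixes F f :: "real \<Rightarrow> real"
  assumes "\<And>x. (F has_real_derivative f x) (at x)" "\<And>x. \<bar>f x\<bar> \<le> m"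
  shows "\<bar>F x - F y\<bar> \<le> m * \<bar>x - y\<bar>"
  using field_differentiable_bound[of UNIV F f m x y] assms
  by (auto intro: has_field_derivative_at_within)

lemma periodic_reduce:
  fixes F :: "real \<Rightarrow> real"
  assumes per: "\<And>x. F (x + p) = F x" and "p > 0"
  obtains y where "0 \<le> y" "y \<le> p" "F x = F y"
proof -
  have n: "F (x + real n * p) = F x" for n x
  proof (induction n)
    case (Suc n)
    then show ?case using per[of "x + real n * p"] by (simp add: algebra_simps)
  qed simp
  define j where "j = \<lfloor>x / p\<rfloor>"
  define y where "y = x - real_of_int j * p"
  have y: "0 \<le> y" "y \<le> p"
    using floor_divide_lower[OF \<open>p > 0\<close>, of x] floor_divide_upper[OF \<open>p > 0\<close>, of x]
    by (auto simp: y_def j_def algebra_simps)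
  have "F x = F y"
  proof (cases "j \<ge> 0")
    case True
    then show ?thesis using n[of y "nat j"] by (simp add: y_def)
  next
    case False
    then show ?thesis using n[of x "nat (- j)"] by (simp add: y_def)
  qed
  then show ?thesis using y that by blast
qed

lemma periodic_antiderivative_bounded:
  fixes F f :: "real \<Rightarrow> real"
  assumes F: "\<And>x. (F has_real_derivative f x) (at x)" and m: "\<And>x. \<bar>f x\<bar> \<le> m"
    and per: "\<And>x. f (x + 2 * pi) = f x" and "F pi = F (- pi)" "F 0 = 0"
  shows "F (x + 2 * pi) = F x" "\<bar>F x\<bar> \<le> 2 * pi * m"
proof -
  have "((\<lambda>x. F (x + 2 * pi) - F x) has_real_derivative f (x + 2 * pi) * 1 - f x) (at x)" for x
    by (intro DERIV_diff F DERIV_chain2[OF F]) (auto intro!: derivative_eq_intros)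
  then have "\<And>x. ((\<lambda>x. F (x + 2 * pi) - F x) has_real_derivative 0) (at x)"
    by (simp add: per)
  from DERIV_isconst_all[OF allI[OF this], of x "- pi" for x] assms(4)
  show per': "F (x + 2 * pi) = F x" for x by simp
  obtain y where y: "0 \<le> y" "y \<le> 2 * pi" "F x = F y"
    using periodic_reduce[of F "2 * pi" x, OF per'] by auto
  have "\<bar>F y - F 0\<bar> \<le> m * \<bar>y - 0\<bar>"
    by (rule DERIV_bounded_diff[OF F m])
  also have "\<dots> \<le> m * (2 * pi)"
    using y m[of 0] by (intro mult_left_mono) auto
  finally show "\<bar>F x\<bar> \<le> 2 * pi * m"
    using y assms(5) by (simp add: algebra_simps)
qed

lemma DERIV_mult_abs: "((\<lambda>x::real. x * \<bar>x\<bar>) has_real_derivative 2 * \<bar>x\<bar>) (at x)"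
proof -
  consider "x > 0" | "x < 0" | "x = 0" by linarith
  then show ?thesis
  proof cases
    case 1
    have "((\<lambda>x. x * x) has_real_derivative 2 * \<bar>x\<bar>) (at x)"
      using 1 by (auto intro!: derivative_eq_intros)
    then show ?thesis
      by (rule has_field_derivative_transform_within_open[where S="{0<..}"]) (use 1 in auto)
  next
    case 2
    have "((\<lambda>x. - (x * x)) has_real_derivative 2 * \<bar>x\<bar>) (at x)"
      using 2 by (auto intro!: derivative_eq_intros)
    then show ?thesis
      by (rule has_field_derivative_transform_within_open[where S="{..<0}"]) (use 2 in auto)
  next
    case 3
    have "((\<lambda>h. \<bar>h::real\<bar>) \<longlongrightarrow> 0) (at 0)" using tendsto_rabs_zero[OF tendsto_ident_at] .
    then have "((\<lambda>h::real. ((0 + h) * \<bar>0 + h\<bar> - 0 * \<bar>0\<bar>) / h) \<longlongrightarrow> 0) (at 0)"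
      by (rule Lim_transform_eventually) (auto simp: eventually_at_filter)
    then show ?thesis using 3 by (simp add: DERIV_def)
  qed
qed

text \<open>The oscillation profile: \<open>k\<close> has period \<open>2 pi\<close> and mean zero, takes values in \<open>[-a, b]\<close>, and
  takes only the values \<open>-a\<close> and \<open>b\<close> except where the triangle wave \<open>arccos (cos \<tau>)\<close> is near the
  switching level \<open>pi b / (a + b)\<close>. Since it is also even, it has periodic first and second
  antiderivatives \<open>g\<close> and \<open>G\<close>; their bounds do not depend on the steepness \<open>L\<close> of the transition.\<close>

lemma oscillation_profile:
  fixes a b L :: real
  assumes ab: "a > 0" "b > 0" and L: "L > 0" "1 \<le> L * (pi * b / (a + b))" "1 \<le> L * (pi - pi * b / (a + b))"
  obtains k g G :: "real \<Rightarrow> real" where "continuous_on UNIV k"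
    "\<And>x. (g has_real_derivative k x) (at x)" "\<And>x. (G has_real_derivative g x) (at x)"
    "\<And>x. -a \<le> k x" "\<And>x. k x \<le> b" "\<And>x. \<bar>g x\<bar> \<le> 2 * pi * (a + b)" "\<And>x. \<bar>G x\<bar> \<le> 2 * pi * (2 * pi * (a + b))"
    "\<And>x. 1 / L \<le> \<bar>arccos (cos x) - pi * b / (a + b)\<bar> \<Longrightarrow> k x = -a \<or> k x = b"
proof -
  define c0 where "c0 = pi * b / (a + b)"
  \<comment> \<open>\<open>cl\<close> truncates to \<open>[-1, 1]\<close>, and \<open>E\<close> is its even antiderivative, equal to \<open>|x|\<close> for \<open>|x| \<ge> 1\<close>; the
    symmetry about \<open>c0\<close> makes the mean of \<open>\<kappa>\<close> over \<open>[0, pi]\<close> independent of the steepness \<open>L\<close>.\<close>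
  define cl where "cl x = (\<bar>x + 1\<bar> - \<bar>x - 1\<bar>) / 2" for x :: real
  define E where "E x = ((x + 1) * \<bar>x + 1\<bar> - (x - 1) * \<bar>x - 1\<bar>) / 4" for x :: real
  define \<kappa> where "\<kappa> y = (b - a) / 2 + (a + b) / 2 * cl (L * (y - c0))" for y
  define H where "H y = (b - a) / 2 * y + (a + b) / 2 * (E (L * (y - c0)) / L)" for y
  define k where "k x = \<kappa> (arccos (cos x))" for x
  have cl1: "-1 \<le> cl x" "cl x \<le> 1" "1 \<le> \<bar>x\<bar> \<Longrightarrow> cl x = -1 \<or> cl x = 1" for x
    by (simp_all add: cl_def abs_if split: if_splits)
  have DE: "(E has_real_derivative cl x) (at x)" for x
  proof -
    have 1: "((\<lambda>x. (x + 1) * \<bar>x + 1\<bar>) has_real_derivative 2 * \<bar>x + 1\<bar> * 1) (at x)"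
      by (rule DERIV_chain2[OF DERIV_mult_abs]) (auto intro!: derivative_eq_intros)
    have 2: "((\<lambda>x. (x - 1) * \<bar>x - 1\<bar>) has_real_derivative 2 * \<bar>x - 1\<bar> * 1) (at x)"
      by (rule DERIV_chain2[OF DERIV_mult_abs]) (auto intro!: derivative_eq_intros)
    show ?thesis unfolding E_def cl_def
      by (rule DERIV_cong[OF DERIV_cdivide[OF DERIV_diff[OF 1 2], of 4]]) simp
  qed
  have DH: "(H has_real_derivative \<kappa> y) (at y)" for y
  proof -
    have "((\<lambda>y. E (L * (y - c0))) has_real_derivative cl (L * (y - c0)) * L) (at y)"
      by (rule DERIV_chain2[OF DE]) (auto intro!: derivative_eq_intros)
    from DERIV_cmult[OF DERIV_cdivide[OF this, of L], of "(a + b) / 2"]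
    have "((\<lambda>y. (a + b) / 2 * (E (L * (y - c0)) / L)) has_real_derivative (a + b) / 2 * cl (L * (y - c0))) (at y)"
      using L(1) by simp
    then show ?thesis unfolding H_def \<kappa>_def
      by (rule DERIV_add[OF DERIV_cmult_Id])
  qed
  have E1: "E x = \<bar>x\<bar>" if "1 \<le> \<bar>x\<bar>" for x
  proof (cases "x \<ge> 0")
    case True
    then show ?thesis using that by (simp add: E_def field_simps)
  next
    case False
    then have "\<bar>x + 1\<bar> = - (x + 1)" "\<bar>x - 1\<bar> = - (x - 1)" "\<bar>x\<bar> = - x" using that by auto
    then show ?thesis unfolding E_def by (simp add: field_simps)
  qed
  have "E (L * (pi - c0)) = L * (pi - c0)" "E (L * (0 - c0)) = L * c0"
    using E1[of "L * (pi - c0)"] E1[of "L * (0 - c0)"] L(2,3) unfolding c0_def[symmetric] by simp_all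
  then have "H pi - H 0 = ((b - a) / 2 * pi + (a + b) / 2 * (L * (pi - c0) / L)) - ((b - a) / 2 * 0 + (a + b) / 2 * (L * c0 / L))"
    by (simp only: H_def)
  also have "\<dots> = b * pi - (a + b) * c0"
    using L(1) by (simp add: field_simps)
  finally have "H pi - H 0 = b * pi - (a + b) * c0" .
  then have Hpi: "H pi = H 0" using ab by (simp add: c0_def)
  have "continuous_on UNIV \<kappa>"
    unfolding \<kappa>_def cl_def by (intro continuous_intros) auto
  moreover have "continuous_on UNIV (\<lambda>x. arccos (cos x))"
    by (intro continuous_intros) auto
  ultimately have kc: "continuous_on UNIV k"
    unfolding k_def by (rule continuous_on_compose2) auto
  have kb: "-a \<le> k x" "k x \<le> b" for x
  proof -
    define y where "y = (a + b) / 2 * cl (L * (arccos (cos x) - c0))"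
    have "(a + b) / 2 * -1 \<le> y" "y \<le> (a + b) / 2 * 1"
      unfolding y_def using cl1[of "L * (arccos (cos x) - c0)"] ab by (intro mult_left_mono; simp)+
    moreover have "k x = (b - a) / 2 + y" by (simp add: k_def \<kappa>_def y_def)
    ultimately show "-a \<le> k x" "k x \<le> b" by (simp_all add: field_simps)
  qed
  have km: "\<bar>k x\<bar> \<le> a + b" for x using kb[of x] ab by auto
  obtain g where g: "\<And>x. (g has_real_derivative k x) (at x)" "g 0 = 0"
    using antiderivative_UNIV[OF kc] by blast
  have gc: "continuous_on UNIV g"
    using g(1) by (auto intro!: continuous_at_imp_continuous_on intro: DERIV_isCont)
  obtain G where G: "\<And>x. (G has_real_derivative g x) (at x)" "G 0 = 0"
    using antiderivative_UNIV[OF gc] by blast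
  have "((\<lambda>x. g x + g (- x)) has_real_derivative k x + k (- x) * (-1)) (at x)" for x
    by (intro DERIV_add g DERIV_chain2[OF g(1)]) (auto intro!: derivative_eq_intros)
  then have "\<And>x. ((\<lambda>x. g x + g (- x)) has_real_derivative 0) (at x)"
    by (simp add: k_def)
  from DERIV_isconst_all[OF allI[OF this], of x 0 for x]
  have godd: "g (- x) = - g x" for x using g(2) by (metis add.right_neutral add_eq_0_iff minus_zero)
  have "((\<lambda>x. G x - G (- x)) has_real_derivative g x - g (- x) * (-1)) (at x)" for x
    by (intro DERIV_diff G DERIV_chain2[OF G(1)]) (auto intro!: derivative_eq_intros)
  then have "\<And>x. ((\<lambda>x. G x - G (- x)) has_real_derivative 0) (at x)"
    by (simp add: godd)
  from DERIV_isconst_all[OF allI[OF this], of pi 0]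
  have Geven: "G pi = G (- pi)" by simp
  have "g pi - H pi = g 0 - H 0"
  proof (rule DERIV_isconst_end[of 0 pi "\<lambda>x. g x - H x"])
    show "continuous_on {0..pi} (\<lambda>x. g x - H x)"
      using DERIV_diff[OF g(1) DH] by (auto intro!: continuous_at_imp_continuous_on intro: DERIV_isCont)
    show "((\<lambda>x. g x - H x) has_real_derivative 0) (at x)" if "0 < x" "x < pi" for x
    proof -
      have "k x = \<kappa> x" using that by (simp add: k_def arccos_cos)
      then show ?thesis using DERIV_diff[OF g(1) DH, of x] by simp
    qed
  qed simp
  then have gpi: "g pi = 0" using g(2) Hpi by simp
  then have gpi': "g pi = g (- pi)" using godd[of pi] by simp
  have kper: "k (x + 2 * pi) = k x" for x by (simp add: k_def)
  note gb = periodic_antiderivative_bounded[OF g(1) km kper gpi' g(2)]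
  note Gb = periodic_antiderivative_bounded[OF G(1) gb(2) gb(1) Geven G(2)]
  show ?thesis
  proof (rule that[OF kc g(1) G(1) kb gb(2) Gb(2)])
    fix x assume "1 / L \<le> \<bar>arccos (cos x) - pi * b / (a + b)\<bar>"
    then have "1 \<le> L * \<bar>arccos (cos x) - c0\<bar>"
      using L(1) by (simp add: c0_def[symmetric] field_simps)
    moreover have "\<bar>L * (arccos (cos x) - c0)\<bar> = L * \<bar>arccos (cos x) - c0\<bar>"
      using L(1) by (simp add: abs_mult)
    ultimately have "1 \<le> \<bar>L * (arccos (cos x) - c0)\<bar>" by linarith
    from cl1(3)[OF this] show "k x = -a \<or> k x = b"
      by (auto simp: k_def \<kappa>_def field_simps)
  qed
qed

lemma DERIV_max0_cube:
  "((\<lambda>x::real. (max 0 x) ^ 3) has_real_derivative 3 * (max 0 x)\<^sup>2) (at x)"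
  "((\<lambda>x::real. 3 * (max 0 x)\<^sup>2) has_real_derivative 6 * max 0 x) (at x)"
proof -
  have 2: "((\<lambda>x::real. (max 0 x)\<^sup>2) has_real_derivative 2 * max 0 x) (at x)" for x
  proof -
    have eq: "(max 0 x)\<^sup>2 = (x\<^sup>2 + x * \<bar>x\<bar>) / 2" "2 * max 0 x = (2 * x + 2 * \<bar>x\<bar>) / 2" for x :: real
      by (auto simp: max_def power2_eq_square abs_if)
    show ?thesis unfolding eq
      by (intro DERIV_cdivide DERIV_add DERIV_mult_abs) (auto intro!: derivative_eq_intros)
  qed
  show "((\<lambda>x::real. 3 * (max 0 x)\<^sup>2) has_real_derivative 6 * max 0 x) (at x)"
    using DERIV_cmult[OF 2, of 3] by simp
  have eq: "(max 0 x) ^ 3 = x * (max 0 x)\<^sup>2" for x :: real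
    by (auto simp: max_def power2_eq_square power3_eq_cube)
  have "((\<lambda>x::real. x * (max 0 x)\<^sup>2) has_real_derivative 1 * (max 0 x)\<^sup>2 + 2 * max 0 x * x) (at x)"
    by (intro DERIV_mult 2) (auto intro!: derivative_eq_intros)
  moreover have "1 * (max 0 x)\<^sup>2 + 2 * max 0 x * x = 3 * (max 0 x)\<^sup>2"
    by (auto simp: max_def power2_eq_square)
  ultimately show "((\<lambda>x::real. (max 0 x) ^ 3) has_real_derivative 3 * (max 0 x)\<^sup>2) (at x)"
    unfolding eq by (rule DERIV_cong)
qed

text \<open>With \<open>P x = (max 0 x)\<^sup>3\<close> the function \<open>P (1 - P x)\<close> falls from \<open>1\<close> to \<open>0\<close> on the unit interval and
  is of class \<open>C\<^sup>2\<close>.\<close>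

lemma C2_cutoff_real:
  fixes c d :: real
  assumes "c < d"
  obtains \<zeta> \<zeta>1 \<zeta>2 :: "real \<Rightarrow> real" where
    "\<And>x. (\<zeta> has_real_derivative \<zeta>1 x) (at x)" "\<And>x. (\<zeta>1 has_real_derivative \<zeta>2 x) (at x)"
    "continuous_on UNIV \<zeta>2" "\<And>x. 0 \<le> \<zeta> x" "\<And>x. \<zeta> x \<le> 1" "\<And>x. x \<le> c \<Longrightarrow> \<zeta> x = 1"
    "\<And>x. d \<le> x \<Longrightarrow> \<zeta> x = 0" "\<And>x. d \<le> x \<Longrightarrow> \<zeta>1 x = 0" "\<And>x. d \<le> x \<Longrightarrow> \<zeta>2 x = 0"
proof -
  define P where "P x = (max 0 x) ^ 3" for x :: real
  define P1 where "P1 x = 3 * (max 0 x)\<^sup>2" for x :: real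
  define P2 where "P2 x = 6 * max 0 x" for x :: real
  have D: "(P has_real_derivative P1 x) (at x)" "(P1 has_real_derivative P2 x) (at x)" for x
    using DERIV_max0_cube unfolding P_def[abs_def] P1_def[abs_def] P2_def by auto
  define y where "y x = (x - c) / (d - c)" for x
  define w where "w = 1 / (d - c)"
  have Dy: "(y has_real_derivative w) (at x)" for x
    unfolding y_def w_def using assms by (auto intro!: derivative_eq_intros)
  define \<zeta> where "\<zeta> x = P (1 - P (y x))" for x
  define \<zeta>1 where "\<zeta>1 x = P1 (1 - P (y x)) * (- (P1 (y x) * w))" for x
  define \<zeta>2 where "\<zeta>2 x = P2 (1 - P (y x)) * (- (P1 (y x) * w)) * (- (P1 (y x) * w))
      + (- (P2 (y x) * w * w)) * P1 (1 - P (y x))" for x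
  have in1: "((\<lambda>x. 1 - P (y x)) has_real_derivative - (P1 (y x) * w)) (at x)" for x
    using DERIV_diff[OF DERIV_const DERIV_chain2[OF D(1) Dy]] by simp
  have D1: "(\<zeta> has_real_derivative \<zeta>1 x) (at x)" for x
    unfolding \<zeta>_def \<zeta>1_def by (rule DERIV_chain2[OF D(1) in1])
  have in2: "((\<lambda>x. - (P1 (y x) * w)) has_real_derivative - (P2 (y x) * w * w)) (at x)" for x
    by (intro DERIV_minus DERIV_cmult_right DERIV_chain2[OF D(2) Dy])
  have D2: "(\<zeta>1 has_real_derivative \<zeta>2 x) (at x)" for x
    unfolding \<zeta>1_def \<zeta>2_def by (rule DERIV_mult[OF DERIV_chain2[OF D(2) in1] in2])
  have c2: "continuous_on UNIV \<zeta>2"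
    unfolding \<zeta>2_def P_def P1_def P2_def y_def using assms by (intro continuous_intros) auto
  have P01: "0 \<le> P x" "x \<le> 1 \<Longrightarrow> P x \<le> 1" "1 \<le> x \<Longrightarrow> 1 \<le> P x" "x \<le> 0 \<Longrightarrow> P x = 0" for x
    by (auto simp: P_def intro: power_le_one)
  have b: "0 \<le> \<zeta> x" "\<zeta> x \<le> 1" for x
    using P01(1)[of "y x"] by (auto simp: \<zeta>_def intro: P01)
  have one: "\<zeta> x = 1" if "x \<le> c" for x
  proof -
    have "y x \<le> 0" using that assms by (simp add: y_def divide_le_0_iff)
    then show ?thesis by (simp add: \<zeta>_def P01 P_def)
  qed
  have zero: "\<zeta> x = 0" "\<zeta>1 x = 0" "\<zeta>2 x = 0" if "d \<le> x" for x
  proof -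
    have "1 \<le> y x" using that assms by (simp add: y_def field_simps)
    then have "1 - P (y x) \<le> 0" using P01(3) by simp
    then show "\<zeta> x = 0" "\<zeta>1 x = 0" "\<zeta>2 x = 0"
      by (simp_all add: \<zeta>_def \<zeta>1_def \<zeta>2_def P1_def P2_def P01)
  qed
  show ?thesis
    by (rule that[OF D1 D2 c2 b one zero])
qed

text \<open>\<open>f\<close> is of class \<open>C\<^sup>1\<close> on the whole space and \<open>f' z w\<close> is its derivative at \<open>z\<close> in direction \<open>w\<close>.\<close>

definition C1_field :: "('a::euclidean_space \<Rightarrow> 'b::euclidean_space) \<Rightarrow> ('a \<Rightarrow> 'a \<Rightarrow> 'b) \<Rightarrow> bool" where
  "C1_field f f' \<longleftrightarrow> (\<forall>z. (f has_derivative f' z) (at z)) \<and> (\<forall>w. continuous_on UNIV (\<lambda>z. f' z w))"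

lemma C1_field_continuous: "C1_field f f' \<Longrightarrow> continuous_on UNIV f"
  unfolding C1_field_def by (meson continuous_at_imp_continuous_on has_derivative_continuous)

lemma C1_field_add:
  "C1_field f f' \<Longrightarrow> C1_field g g' \<Longrightarrow> C1_field (\<lambda>z. f z + g z) (\<lambda>z w. f' z w + g' z w)"
  unfolding C1_field_def by (auto intro: has_derivative_add continuous_intros)

lemma C1_field_const: "C1_field (\<lambda>z. c) (\<lambda>z w. 0)"
  unfolding C1_field_def by auto

lemma C1_field_scaleR:
  "C1_field f f' \<Longrightarrow> C1_field g g' \<Longrightarrow> C1_field (\<lambda>z. f z *\<^sub>R g z) (\<lambda>z w. f z *\<^sub>R g' z w + f' z w *\<^sub>R g z)"
proof -
  assume f: "C1_field f f'" and g: "C1_field g g'"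
  have "continuous_on UNIV (\<lambda>z. f' z w)" "continuous_on UNIV (\<lambda>z. g' z w)" for w
    using f g by (auto simp: C1_field_def)
  then show ?thesis
    using f g C1_field_continuous[OF f] C1_field_continuous[OF g]
    unfolding C1_field_def by (intro conjI allI has_derivative_scaleR continuous_intros) auto
qed

lemma C1_field_mult:
  fixes f g :: "'a::euclidean_space \<Rightarrow> real"
  shows "C1_field f f' \<Longrightarrow> C1_field g g' \<Longrightarrow> C1_field (\<lambda>z. f z * g z) (\<lambda>z w. f z * g' z w + f' z w * g z)"
  using C1_field_scaleR[of f f' g g'] by simp

lemma C1_field_compose_real:
  fixes f :: "'a::euclidean_space \<Rightarrow> real"
  assumes f: "C1_field f f'" and g: "\<And>x. (g has_real_derivative g' x) (at x)" "continuous_on UNIV g'"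
  shows "C1_field (\<lambda>z. g (f z)) (\<lambda>z w. g' (f z) * f' z w)"
  unfolding C1_field_def
proof (intro allI conjI)
  fix z
  have "(f has_derivative f' z) (at z)" using f by (simp add: C1_field_def)
  moreover have "(g has_derivative (\<lambda>h. g' (f z) * h)) (at (f z))"
    using g(1)[of "f z"] by (simp add: has_field_derivative_def)
  ultimately show "((\<lambda>z. g (f z)) has_derivative (\<lambda>w. g' (f z) * f' z w)) (at z)"
    by (rule has_derivative_compose)
  show "continuous_on UNIV (\<lambda>z. g' (f z) * f' z w)" for w
    using f by (intro continuous_intros continuous_on_compose2[OF g(2) C1_field_continuous[OF f]])
      (auto simp: C1_field_def)
qed

lemma C1_field_inner: "C1_field (\<lambda>z. z \<bullet> c) (\<lambda>z w. w \<bullet> c)"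
  unfolding C1_field_def by (auto intro!: derivative_eq_intros continuous_intros)

text \<open>In this lemma \<open>\<zeta>' z e\<close> is the derivative of \<open>\<zeta>\<close> in direction \<open>e\<close>, and \<open>\<zeta>'' e z d\<close> is the
  derivative of that in direction \<open>d\<close>.\<close>

lemma ball_cutoff:
  fixes z0 :: "'a::euclidean_space"
  assumes "0 \<le> r1" "r1 < r"
  obtains \<zeta> :: "'a \<Rightarrow> real" and \<zeta>' and \<zeta>'' where
    "C1_field \<zeta> \<zeta>'" "\<And>e. C1_field (\<lambda>z. \<zeta>' z e) (\<zeta>'' e)" "\<And>e d z. \<zeta>'' e z d = \<zeta>'' d z e"
    "\<And>z. 0 \<le> \<zeta> z" "\<And>z. \<zeta> z \<le> 1" "\<And>z. z \<in> cball z0 r1 \<Longrightarrow> \<zeta> z = 1"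
    "\<And>z. z \<notin> cball z0 r \<Longrightarrow> \<zeta> z = 0" "\<And>z e. z \<notin> cball z0 r \<Longrightarrow> \<zeta>' z e = 0"
    "\<And>z e d. z \<notin> cball z0 r \<Longrightarrow> \<zeta>'' e z d = 0"
proof -
  have "r1\<^sup>2 < r\<^sup>2" using assms by (simp add: power_strict_mono)
  then obtain h h1 h2 :: "real \<Rightarrow> real" where
    D: "\<And>x. (h has_real_derivative h1 x) (at x)" "\<And>x. (h1 has_real_derivative h2 x) (at x)"
    and c: "continuous_on UNIV h2" and b: "\<And>x. 0 \<le> h x" "\<And>x. h x \<le> 1" and one: "\<And>x. x \<le> r1\<^sup>2 \<Longrightarrow> h x = 1"
    and zero: "\<And>x. r\<^sup>2 \<le> x \<Longrightarrow> h x = 0" "\<And>x. r\<^sup>2 \<le> x \<Longrightarrow> h1 x = 0" "\<And>x. r\<^sup>2 \<le> x \<Longrightarrow> h2 x = 0"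
    using C2_cutoff_real[of "r1\<^sup>2" "r\<^sup>2"] by blast
  have c1: "continuous_on UNIV h1"
    using D(2) by (auto intro!: continuous_at_imp_continuous_on intro: DERIV_isCont)
  define N where "N z = (z - z0) \<bullet> (z - z0)" for z
  have CN: "C1_field N (\<lambda>z w. 2 * ((z - z0) \<bullet> w))"
    unfolding C1_field_def N_def
    by (auto intro!: derivative_eq_intros continuous_intros simp: inner_commute)
  have Cl: "C1_field (\<lambda>z. 2 * ((z - z0) \<bullet> e)) (\<lambda>z w. 2 * (w \<bullet> e))" for e
    unfolding C1_field_def by (auto intro!: derivative_eq_intros continuous_intros)
  have NN: "N z = (dist z0 z)\<^sup>2" for z
    by (simp only: N_def dist_norm norm_minus_commute[of z0 z] power2_norm_eq_inner)
  have in1: "N z \<le> r1\<^sup>2" if "z \<in> cball z0 r1" for z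
    using that by (simp add: NN power_mono)
  have out: "r\<^sup>2 \<le> N z" if "z \<notin> cball z0 r" for z
    using that assms by (simp add: NN power_mono)
  show ?thesis
  proof (rule that[of "\<lambda>z. h (N z)" "\<lambda>z w. h1 (N z) * (2 * ((z - z0) \<bullet> w))"
        "\<lambda>e z w. h1 (N z) * (2 * (w \<bullet> e)) + h2 (N z) * (2 * ((z - z0) \<bullet> w)) * (2 * ((z - z0) \<bullet> e))"])
    show "C1_field (\<lambda>z. h (N z)) (\<lambda>z w. h1 (N z) * (2 * ((z - z0) \<bullet> w)))"
      by (rule C1_field_compose_real[OF CN D(1) c1])
    show "C1_field (\<lambda>z. h1 (N z) * (2 * ((z - z0) \<bullet> e)))
        (\<lambda>z w. h1 (N z) * (2 * (w \<bullet> e)) + h2 (N z) * (2 * ((z - z0) \<bullet> w)) * (2 * ((z - z0) \<bullet> e)))" for e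
      by (rule C1_field_mult[OF C1_field_compose_real[OF CN D(2) c] Cl])
  qed (use b one zero in1 out in \<open>auto simp: inner_commute\<close>)
qed

text \<open>As \<open>L\<close> grows these sets shrink to a subset of countably many hyperplanes.\<close>

lemma level_set_measure_small:
  fixes Q :: "'a::euclidean_space"
  assumes S: "S \<in> lmeasurable" and "Q \<noteq> 0" and "\<eta> > 0"
  obtains L0 :: real where "L0 > 0" "\<And>L. L0 \<le> L \<Longrightarrow>
     {z\<in>S. \<bar>arccos (cos (z \<bullet> Q)) - c0\<bar> \<le> 1 / L} \<in> lmeasurable \<and>
     measure lebesgue {z\<in>S. \<bar>arccos (cos (z \<bullet> Q)) - c0\<bar> \<le> 1 / L} \<le> \<eta>"
proof -
  define D where "D d = S \<inter> {z. \<bar>arccos (cos (z \<bullet> Q)) - c0\<bar> \<le> d}" for d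
  have cl: "closed {z. \<bar>arccos (cos (z \<bullet> Q)) - c0\<bar> \<le> d}" for d
    by (intro closed_Collect_le continuous_intros) auto
  have lm: "D d \<in> lmeasurable" for d
    unfolding D_def using S cl by (intro fmeasurable_Int_fmeasurable) auto
  have "(\<lambda>n. measure lebesgue (D (1 / real (Suc n)))) \<longlonglongrightarrow> measure lebesgue (\<Inter>n. D (1 / real (Suc n)))"
  proof (rule Lim_measure_decseq)
    show "decseq (\<lambda>n. D (1 / real (Suc n)))"
    proof (rule decseq_SucI)
      fix n
      have "1 / real (Suc (Suc n)) \<le> 1 / real (Suc n)" by (simp add: field_simps)
      then show "D (1 / real (Suc (Suc n))) \<subseteq> D (1 / real (Suc n))" by (auto simp: D_def)
    qed
  qed (use lm fmeasurableD2[OF lm] in auto)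
  moreover have "measure lebesgue (\<Inter>n. D (1 / real (Suc n))) = 0"
  proof -
    have sub: "(\<Inter>n. D (1 / real (Suc n))) \<subseteq>
      (\<Union>m. {z. Q \<bullet> z = c0 + 2 * of_int m * pi}) \<union> (\<Union>m. {z. Q \<bullet> z = - c0 + 2 * of_int m * pi})"
    proof
      fix z assume z: "z \<in> (\<Inter>n. D (1 / real (Suc n)))"
      have "\<bar>arccos (cos (z \<bullet> Q)) - c0\<bar> \<le> e" if e: "e > 0" for e
      proof -
        obtain n where "inverse (real (Suc n)) < e" using reals_Archimedean[OF e] by blast
        moreover have "\<bar>arccos (cos (z \<bullet> Q)) - c0\<bar> \<le> 1 / real (Suc n)" using z unfolding D_def by blast
        ultimately show ?thesis by (simp add: inverse_eq_divide)
      qed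
      then have "\<bar>arccos (cos (z \<bullet> Q)) - c0\<bar> \<le> 0"
        by (rule field_le_epsilon[of _ 0, simplified])
      then have "cos (z \<bullet> Q) = cos c0" by (metis abs_le_zero_iff eq_iff_diff_eq_0 cos_arccos cos_ge_minus_one cos_le_one)
      then obtain n where "n \<in> \<int>" "z \<bullet> Q = c0 + 2 * n * pi \<or> z \<bullet> Q = - c0 + 2 * n * pi"
        unfolding cos_eq by blast
      then show "z \<in> (\<Union>m. {z. Q \<bullet> z = c0 + 2 * of_int m * pi}) \<union> (\<Union>m. {z. Q \<bullet> z = - c0 + 2 * of_int m * pi})"
        by (elim Ints_cases) (auto simp: inner_commute)
    qed
    have "negligible ((\<Union>m::int. {z. Q \<bullet> z = c0 + 2 * of_int m * pi}) \<union> (\<Union>m::int. {z. Q \<bullet> z = - c0 + 2 * of_int m * pi}))"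
      using \<open>Q \<noteq> 0\<close> by (intro negligible_Un negligible_countable_Union) (auto intro: negligible_hyperplane)
    then show ?thesis
      by (rule negligible_imp_measure0[OF negligible_subset[OF _ sub]])
  qed
  ultimately obtain n where n: "measure lebesgue (D (1 / real (Suc n))) < \<eta>"
    using order_tendstoD(2)[of _ 0 sequentially \<eta>] \<open>\<eta> > 0\<close> eventually_happens'[OF sequentially_bot] by force
  show ?thesis
  proof (rule that[of "real (Suc n)"])
    fix L assume L: "real (Suc n) \<le> L"
    have "1 / L \<le> 1 / real (Suc n)" using L by (intro divide_left_mono) (auto intro: mult_pos_pos order_less_le_trans)
    then have "D (1 / L) \<subseteq> D (1 / real (Suc n))" by (auto simp: D_def)
    then have "measure lebesgue (D (1 / L)) \<le> measure lebesgue (D (1 / real (Suc n)))"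
      by (rule measure_mono_fmeasurable) (use lm in auto)
    moreover have "{z\<in>S. \<bar>arccos (cos (z \<bullet> Q)) - c0\<bar> \<le> 1 / L} = D (1 / L)" by (auto simp: D_def)
    ultimately show "{z\<in>S. \<bar>arccos (cos (z \<bullet> Q)) - c0\<bar> \<le> 1 / L} \<in> lmeasurable \<and>
     measure lebesgue {z\<in>S. \<bar>arccos (cos (z \<bullet> Q)) - c0\<bar> \<le> 1 / L} \<le> \<eta>"
      using lm n by auto
  qed simp
qed

lemma inner_ball_measure:
  fixes z0 :: "'a::euclidean_space"
  assumes "r > 0" "\<eta> > 0"
  obtains r1 where "0 \<le> r1" "r1 < r"
    "measure lebesgue (cball z0 r - cball z0 r1) \<le> \<eta> * measure lebesgue (cball z0 r)"
proof -
  let ?d = "DIM('a)"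
  have "((\<lambda>x::real. x ^ ?d) \<longlongrightarrow> 1 ^ ?d) (at_left 1)" by (intro tendsto_intros)
  then have "\<forall>\<^sub>F x in at_left (1::real). 1 - \<eta> < x ^ ?d"
    using \<open>\<eta> > 0\<close> by (intro order_tendstoD(1)) auto
  moreover have "\<forall>\<^sub>F x in at_left (1::real). x \<in> {0<..<1}"
    by (rule eventually_at_left_real) simp
  ultimately have "\<forall>\<^sub>F x in at_left (1::real). 1 - \<eta> < x ^ ?d \<and> x \<in> {0<..<1}" by (rule eventually_conj)
  then obtain x :: real where x: "1 - \<eta> < x ^ ?d" "0 < x" "x < 1"
    using eventually_happens'[OF trivial_limit_at_left_real] by fastforce
  have "measure lebesgue (cball z0 r - cball z0 (r * x)) = measure lebesgue (cball z0 r) - measure lebesgue (cball z0 (r * x))"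
    using x \<open>r > 0\<close> by (intro measurable_measure_Diff subset_cball) auto
  also have "measure lebesgue (cball z0 (r * x)) = x ^ ?d * measure lebesgue (cball z0 r)"
    using x \<open>r > 0\<close> by (simp add: content_cball power_mult_distrib)
  also have "measure lebesgue (cball z0 r) - \<dots> = (1 - x ^ ?d) * measure lebesgue (cball z0 r)"
    by (simp add: algebra_simps)
  also have "\<dots> \<le> \<eta> * measure lebesgue (cball z0 r)"
    using x by (intro mult_right_mono) auto
  finally show ?thesis
    using x \<open>r > 0\<close> by (intro that[of "r * x"]) auto
qed

lemma finite_uniform_bound:
  fixes FS :: "('a \<Rightarrow> real) set"
  assumes "finite FS" "\<And>f. f \<in> FS \<Longrightarrow> \<exists>C. \<forall>z. \<bar>f z\<bar> \<le> C"
  obtains C where "C > 0" "\<And>f z. f \<in> FS \<Longrightarrow> \<bar>f z\<bar> \<le> C"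
proof -
  have "\<exists>C>0. \<forall>f\<in>FS. \<forall>z. \<bar>f z\<bar> \<le> C"
    using assms
  proof (induction FS)
    case empty
    then show ?case by (auto intro: exI[of _ 1])
  next
    case (insert f FS)
    from insert.prems[of f] obtain C2 where "\<forall>z. \<bar>f z\<bar> \<le> C2" by auto
    moreover from insert obtain C1 where "C1 > 0" "\<forall>f\<in>FS. \<forall>z. \<bar>f z\<bar> \<le> C1" by auto
    ultimately show ?case
      by (intro exI[of _ "max C1 C2"]) (auto simp: max.coboundedI1 max.coboundedI2)
  qed
  then show ?thesis using that by blast
qed

section \<open>Oscillating perturbations in a ball\<close>

lemma C1_field_cmult:
  fixes f :: "'a::euclidean_space \<Rightarrow> real"
  shows "C1_field f f' \<Longrightarrow> C1_field (\<lambda>z. c * f z) (\<lambda>z w. c * f' z w)"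
  using C1_field_mult[OF C1_field_const, of f f' c] by simp

lemma abs_mult_le: "\<bar>x\<bar> \<le> X \<Longrightarrow> \<bar>y\<bar> \<le> Y \<Longrightarrow> \<bar>x * y\<bar> \<le> X * (Y::real)"
  unfolding abs_mult by (rule mult_mono) auto

lemma sum_linear_axis:
  fixes l :: "(real^'n) \<times> real \<Rightarrow> real"
  assumes "linear l"
  shows "(\<Sum>i\<in>UNIV. l (axis i 1, 0) * v $ i) = l (v, 0)"
proof -
  have "(v, 0::real) = (\<Sum>i\<in>UNIV. v $ i *\<^sub>R (axis i 1, 0))"
  proof (rule prod_eqI)
    show "fst (v, 0::real) = fst (\<Sum>i\<in>UNIV. v $ i *\<^sub>R (axis i 1, 0::real))"
      using basis_expansion[of v] by (simp add: fst_sum scalar_mult_eq_scaleR)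
  qed (simp add: snd_sum)
  then have "l (v, 0) = (\<Sum>i\<in>UNIV. v $ i *\<^sub>R l (axis i 1, 0))"
    by (simp only: linear_sum[OF assms] linear_cmul[OF assms])
  then show ?thesis by (simp add: mult.commute)
qed

lemma axis_Basis: "(axis i 1, 0::real) \<in> (Basis :: ((real^'n) \<times> real) set)"
  by (simp add: Basis_prod_def axis_in_Basis_iff)

lemma time_Basis: "(0, 1::real) \<in> (Basis :: ((real^'n) \<times> real) set)"
  by (simp add: Basis_prod_def)

text \<open>A compactly supported pair \<open>(\<phi>, \<psi>)\<close> with \<open>div \<psi> = \<phi>\<close> whose derivatives \<open>(D\<phi>, \<psi>_t)\<close> oscillate
  along the segment from \<open>-a (q, \<gamma>)\<close> to \<open>b (q, \<gamma>)\<close>, near its end points except on a small set.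

  Let \<open>\<theta> = (q \<bullet> x + s t) / \<epsilon>\<close>, let \<open>G'' = g' = k\<close> be the oscillation profile, \<open>\<zeta>\<close> a cutoff
  function and \<open>c = 1 / |q|\<^sup>2\<close>. Put \<open>\<phi> = \<epsilon> \<zeta> g(\<theta>) + \<epsilon>\<^sup>2 c G(\<theta>) D_q \<zeta>\<close> and \<open>\<psi> = A q + (\<phi> / s) \<gamma>\<close> with
  \<open>A = \<epsilon>\<^sup>2 c G(\<theta>) (\<zeta> - D_\<gamma> \<zeta> / s)\<close>. Then \<open>div \<psi> = D_q A + D_\<gamma> \<phi> / s = \<phi>\<close>, because \<open>\<theta>\<close> is constant in
  the direction \<open>\<gamma>\<close> and the mixed second derivatives of \<open>\<zeta>\<close> agree. Up to terms of order \<open>\<epsilon>\<close> one has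
  \<open>D\<phi> = \<zeta> k(\<theta>) q\<close>, \<open>\<psi>_t = \<zeta> k(\<theta>) \<gamma>\<close> and \<open>\<phi>_t = s \<zeta> k(\<theta>)\<close>. The constants in these terms do not depend
  on the steepness of the profile, so one can choose first \<open>s\<close>, then \<open>\<epsilon>\<close>, and last the steepness.\<close>

lemma ball_perturbation:
  fixes q \<gamma> :: "real^'n" and z0 :: "(real^'n) \<times> real"
  assumes q: "q \<noteq> 0" "\<gamma> \<bullet> q = 0" and ab: "a > 0" "b > 0" and r: "r > 0" and \<eta>: "\<eta> > 0"
  obtains \<phi> \<phi>' \<psi> \<psi>' Bad where
    "C1_field \<phi> \<phi>'" "C1_field \<psi> \<psi>'"
    "\<And>z. z \<notin> cball z0 r \<Longrightarrow> \<phi> z = (0::real)" "\<And>z. z \<notin> cball z0 r \<Longrightarrow> \<psi> z = (0::real^'n)"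
    "\<And>z. (\<Sum>i\<in>UNIV. \<psi>' z (axis i 1, 0) $ i) = \<phi> z"
    "\<And>z. \<bar>\<phi> z\<bar> \<le> \<eta>" "\<And>z. \<bar>\<phi>' z (0, 1)\<bar> \<le> \<eta>"
    "Bad \<in> lmeasurable" "Bad \<subseteq> cball z0 r" "measure lebesgue Bad \<le> \<eta> * measure lebesgue (cball z0 r)"
    "\<And>z. \<exists>t\<in>{-a..b}. norm ((\<chi> i. \<phi>' z (axis i 1, 0)) - t *\<^sub>R q) \<le> \<eta> \<and> norm (\<psi>' z (0, 1) - t *\<^sub>R \<gamma>) \<le> \<eta> \<and>
       (z \<in> cball z0 r - Bad \<longrightarrow> t = -a \<or> t = b)"
proof -
  obtain r1 where r1: "0 \<le> r1" "r1 < r"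
    "measure lebesgue (cball z0 r - cball z0 r1) \<le> \<eta> / 2 * measure lebesgue (cball z0 r)"
    using inner_ball_measure[of r "\<eta> / 2" z0] r \<eta> by auto
  obtain \<zeta> :: "(real^'n) \<times> real \<Rightarrow> real" and \<zeta>' and \<zeta>'' where
    \<zeta>: "C1_field \<zeta> \<zeta>'" "\<And>e. C1_field (\<lambda>z. \<zeta>' z e) (\<zeta>'' e)" and sym: "\<And>e d z. \<zeta>'' e z d = \<zeta>'' d z e"
    and \<zeta>01: "\<And>z. 0 \<le> \<zeta> z" "\<And>z. \<zeta> z \<le> 1" and \<zeta>1: "\<And>z. z \<in> cball z0 r1 \<Longrightarrow> \<zeta> z = 1"
    and \<zeta>0: "\<And>z. z \<notin> cball z0 r \<Longrightarrow> \<zeta> z = 0" "\<And>z e. z \<notin> cball z0 r \<Longrightarrow> \<zeta>' z e = 0"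
      "\<And>z e d. z \<notin> cball z0 r \<Longrightarrow> \<zeta>'' e z d = 0"
    using ball_cutoff[OF r1(1,2)] by blast
  define Xq where "Xq z = \<zeta>' z (q, 0)" for z
  define Xg where "Xg z = \<zeta>' z (\<gamma>, 0)" for z
  define Xq' where "Xq' = \<zeta>'' (q, 0)"
  define Xg' where "Xg' = \<zeta>'' (\<gamma>, 0)"
  have CX: "C1_field Xq Xq'" "C1_field Xg Xg'"
    using \<zeta>(2) unfolding Xq_def[abs_def] Xq'_def Xg_def[abs_def] Xg'_def by auto
  \<comment> \<open>\<open>C\<close> bounds all derivatives of the cutoff function that occur in the estimates.\<close>
  define FS where "FS = {\<zeta>, Xq, Xg} \<union> (\<lambda>w z. \<zeta>' z w) ` Basis \<union> (\<lambda>w z. Xq' z w) ` Basis \<union> (\<lambda>w z. Xg' z w) ` Basis"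
  have "continuous_on UNIV f \<and> (\<forall>z. z \<notin> cball z0 r \<longrightarrow> f z = 0)" if "f \<in> FS" for f
    using that \<zeta> CX C1_field_continuous[OF \<zeta>(1)] C1_field_continuous[OF CX(1)] C1_field_continuous[OF CX(2)] \<zeta>0
    unfolding FS_def by (auto simp: C1_field_def Xq_def Xg_def Xq'_def Xg'_def)
  then have bd: "\<exists>C. \<forall>z. \<bar>f z\<bar> \<le> C" if "f \<in> FS" for f
    using bounded_of_compact_support[of "cball z0 r" f] that by (metis compact_cball real_norm_def)
  have "finite FS" by (simp add: FS_def)
  then obtain C where C: "C > 0" "\<And>f z. f \<in> FS \<Longrightarrow> \<bar>f z\<bar> \<le> C"
    using finite_uniform_bound[OF _ bd] by blast
  have Cb: "\<bar>\<zeta> z\<bar> \<le> C" "\<bar>Xq z\<bar> \<le> C" "\<bar>Xg z\<bar> \<le> C" for z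
    by (rule C(2); simp add: FS_def)+
  have CB: "\<bar>\<zeta>' z w\<bar> \<le> C" "\<bar>Xq' z w\<bar> \<le> C" "\<bar>Xg' z w\<bar> \<le> C" if "w \<in> Basis" for z w
    using C(2)[of "\<lambda>z. \<zeta>' z w" z] C(2)[of "\<lambda>z. Xq' z w" z] C(2)[of "\<lambda>z. Xg' z w" z] that
    unfolding FS_def by auto
  define c where "c = 1 / (q \<bullet> q)"
  have c: "c > 0" "c * (q \<bullet> q) = 1" using q by (auto simp: c_def)
  define mg where "mg = 2 * pi * (a + b)"
  define mG where "mG = 2 * pi * mg"
  have m: "mg > 0" "mG > 0" using ab by (auto simp: mg_def mG_def)
  \<comment> \<open>The speed \<open>s\<close> makes the leading part of \<open>\<phi>_t\<close> at most \<open>\<eta> / 2\<close>, and \<open>Kt\<close> collects the constants of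
    all terms of order \<open>\<epsilon>\<close>.\<close>
  define s where "s = \<eta> / (2 * (a + b))"
  have s: "s > 0" "(a + b) * s = \<eta> / 2" using ab \<eta> by (simp_all add: s_def divide_simps algebra_simps)
  define Q0 where "Q0 = (q, s)"
  define C0 where "C0 = C * mg + c * (mG * C) + c * (mg * norm Q0 * C)"
  define CA where "CA = c * (mG * (C + 1 / s * C)) + c * (mg * norm Q0 * (C + 1 / s * C))"
  define Kt where "Kt = real CARD('n) * C0 + C0 + (C * mg + c * (mG * C)) + CA * norm q + 1 / s * C0 * norm \<gamma> + 1"
  have pos: "0 \<le> C0" "0 \<le> CA" "0 \<le> C * mg + c * (mG * C)" "0 \<le> 1 / s * C0 * norm \<gamma>" "0 \<le> CA * norm q"
    using C(1) c m s by (auto simp: C0_def CA_def intro!: add_nonneg_nonneg mult_nonneg_nonneg)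
  have "0 \<le> real CARD('n) * C0" using pos by simp
  then have Kt: "Kt \<ge> 1" and Kt': "real CARD('n) * C0 \<le> Kt" "C0 \<le> Kt" "C * mg + c * (mG * C) \<le> Kt"
      "CA * norm q + 1 / s * C0 * norm \<gamma> \<le> Kt"
    using pos unfolding Kt_def by linarith+
  define \<epsilon> where "\<epsilon> = min 1 (\<eta> / (2 * Kt))"
  have \<epsilon>: "0 < \<epsilon>" "\<epsilon> \<le> 1" using Kt \<eta> by (auto simp: \<epsilon>_def)
  have "\<epsilon> * Kt \<le> \<eta> / (2 * Kt) * Kt" using Kt by (intro mult_right_mono) (auto simp: \<epsilon>_def)
  then have \<epsilon>K: "\<epsilon> * Kt \<le> \<eta> / 2" using Kt by simp
  have \<epsilon>le: "\<epsilon> * x \<le> \<eta> / 2" if "x \<le> Kt" for x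
    using mult_left_mono[OF that, of \<epsilon>] \<epsilon> \<epsilon>K by linarith
  \<comment> \<open>\<open>Q\<close> contains the factor \<open>1 / \<epsilon>\<close> of the phase \<open>\<theta> z = z \<bullet> Q\<close>.\<close>
  define Q where "Q = Q0 /\<^sub>R \<epsilon>"
  have "Q \<noteq> 0" using q \<epsilon> by (auto simp: Q_def Q0_def zero_prod_def)
  have wQ: "\<epsilon> * (w \<bullet> Q) = w \<bullet> Q0" for w using \<epsilon> by (simp add: Q_def)
  define c0 where "c0 = pi * b / (a + b)"
  have c0: "0 < c0" "c0 < pi" using ab by (auto simp: c0_def field_simps)
  have \<eta>': "0 < \<eta> / 2 * measure lebesgue (cball z0 r)" using \<eta> r by simp
  obtain L0 where L0: "L0 > 0" "\<And>L. L0 \<le> L \<Longrightarrow>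
     {z\<in>cball z0 r. \<bar>arccos (cos (z \<bullet> Q)) - c0\<bar> \<le> 1 / L} \<in> lmeasurable \<and>
     measure lebesgue {z\<in>cball z0 r. \<bar>arccos (cos (z \<bullet> Q)) - c0\<bar> \<le> 1 / L} \<le> \<eta> / 2 * measure lebesgue (cball z0 r)"
    using level_set_measure_small[OF lmeasurable_cball[of z0 r] \<open>Q \<noteq> 0\<close> \<eta>', of c0] by blast
  define L where "L = max L0 (max (1 / c0) (1 / (pi - c0)))"
  have L: "L0 \<le> L" "L > 0" "1 \<le> L * c0" "1 \<le> L * (pi - c0)"
  proof -
    show "L0 \<le> L" "L > 0" using L0(1) by (auto simp: L_def)
    have "1 / c0 \<le> L" "1 / (pi - c0) \<le> L" by (auto simp: L_def)
    then show "1 \<le> L * c0" "1 \<le> L * (pi - c0)" using c0 by (simp_all add: field_simps)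
  qed
  obtain k g G where kc: "continuous_on UNIV k"
    and Dg: "\<And>x. (g has_real_derivative k x) (at x)" and DG: "\<And>x. (G has_real_derivative g x) (at x)"
    and kb: "\<And>x. -a \<le> k x" "\<And>x. k x \<le> b" and gb: "\<And>x. \<bar>g x\<bar> \<le> mg" and Gb: "\<And>x. \<bar>G x\<bar> \<le> mG"
    and kab: "\<And>x. 1 / L \<le> \<bar>arccos (cos x) - c0\<bar> \<Longrightarrow> k x = -a \<or> k x = b"
    using oscillation_profile[OF ab L(2), folded c0_def, OF L(3,4), folded mg_def, folded mG_def] by blast
  have gc: "continuous_on UNIV g"
    using Dg by (auto intro!: continuous_at_imp_continuous_on intro: DERIV_isCont)
  define \<theta> where "\<theta> z = z \<bullet> Q" for z
  have C\<theta>: "C1_field \<theta> (\<lambda>z w. w \<bullet> Q)" unfolding \<theta>_def[abs_def] by (rule C1_field_inner)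
  note Cg = C1_field_compose_real[OF C\<theta> Dg kc] and CG = C1_field_compose_real[OF C\<theta> DG gc]
  define \<phi> where "\<phi> z = \<epsilon> * (\<zeta> z * g (\<theta> z)) + (\<epsilon>\<^sup>2 * c) * (G (\<theta> z) * Xq z)" for z
  define \<phi>' where "\<phi>' z w = \<epsilon> * (\<zeta> z * (k (\<theta> z) * (w \<bullet> Q)) + \<zeta>' z w * g (\<theta> z))
    + (\<epsilon>\<^sup>2 * c) * (G (\<theta> z) * Xq' z w + g (\<theta> z) * (w \<bullet> Q) * Xq z)" for z w
  have C\<phi>: "C1_field \<phi> \<phi>'"
    unfolding \<phi>_def[abs_def] \<phi>'_def[abs_def]
    by (rule C1_field_add[OF C1_field_cmult[OF C1_field_mult[OF \<zeta>(1) Cg]] C1_field_cmult[OF C1_field_mult[OF CG CX(1)]]])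
  define Y where "Y z = \<zeta> z + (- (1 / s)) * Xg z" for z
  define Y' where "Y' z w = \<zeta>' z w + (- (1 / s)) * Xg' z w" for z w
  have CY: "C1_field Y Y'"
    unfolding Y_def[abs_def] Y'_def[abs_def] by (rule C1_field_add[OF \<zeta>(1) C1_field_cmult[OF CX(2)]])
  define A where "A z = (\<epsilon>\<^sup>2 * c) * (G (\<theta> z) * Y z)" for z
  define A' where "A' z w = (\<epsilon>\<^sup>2 * c) * (G (\<theta> z) * Y' z w + g (\<theta> z) * (w \<bullet> Q) * Y z)" for z w
  have CA': "C1_field A A'"
    unfolding A_def[abs_def] A'_def[abs_def] by (rule C1_field_cmult[OF C1_field_mult[OF CG CY]])
  define B where "B z = (1 / s) * \<phi> z" for z
  define B' where "B' z w = (1 / s) * \<phi>' z w" for z w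
  have CB': "C1_field B B'"
    unfolding B_def[abs_def] B'_def[abs_def] by (rule C1_field_cmult[OF C\<phi>])
  define \<psi> where "\<psi> z = A z *\<^sub>R q + B z *\<^sub>R \<gamma>" for z
  define \<psi>' where "\<psi>' z w = A' z w *\<^sub>R q + B' z w *\<^sub>R \<gamma>" for z w
  have C\<psi>: "C1_field \<psi> \<psi>'"
    using C1_field_add[OF C1_field_scaleR[OF CA' C1_field_const] C1_field_scaleR[OF CB' C1_field_const]]
    unfolding \<psi>_def[abs_def] \<psi>'_def[abs_def] by simp
  have lin: "linear (A' z)" "linear (B' z)" for z
    using CA' CB' unfolding C1_field_def by (meson has_derivative_linear)+
  have qQ: "(q, 0) \<bullet> Q = (q \<bullet> q) / \<epsilon>" "(\<gamma>, 0) \<bullet> Q = 0" "(0, 1) \<bullet> Q0 = s"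
    using q by (simp_all add: Q_def Q0_def divide_inverse)
  have div: "(\<Sum>i\<in>UNIV. \<psi>' z (axis i 1, 0) $ i) = \<phi> z" for z
  proof -
    have "(\<Sum>i\<in>UNIV. \<psi>' z (axis i 1, 0) $ i) = (\<Sum>i\<in>UNIV. A' z (axis i 1, 0) * q $ i) + (\<Sum>i\<in>UNIV. B' z (axis i 1, 0) * \<gamma> $ i)"
      by (simp add: \<psi>'_def sum.distrib)
    also have "\<dots> = A' z (q, 0) + B' z (\<gamma>, 0)"
      by (simp only: sum_linear_axis[OF lin(1)] sum_linear_axis[OF lin(2)])
    also have "A' z (q, 0) = (\<epsilon>\<^sup>2 * c) * (G (\<theta> z) * (Xq z - Xg' z (q, 0) / s)) + \<epsilon> * (c * (q \<bullet> q)) * (g (\<theta> z) * Y z)"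
      using \<epsilon> by (simp add: A'_def Y'_def Xq_def[symmetric] qQ field_simps power2_eq_square)
    also have "\<dots> = (\<epsilon>\<^sup>2 * c) * (G (\<theta> z) * (Xq z - Xg' z (q, 0) / s)) + \<epsilon> * (g (\<theta> z) * (\<zeta> z - Xg z / s))"
      by (simp add: c Y_def)
    also have "B' z (\<gamma>, 0) = (\<epsilon> * (Xg z * g (\<theta> z)) + (\<epsilon>\<^sup>2 * c) * (G (\<theta> z) * Xg' z (q, 0))) / s"
      using sym[of "(q, 0)" z "(\<gamma>, 0)"] by (simp add: B'_def \<phi>'_def qQ Xg_def[symmetric] Xq'_def Xg'_def)
    also have "(\<epsilon>\<^sup>2 * c) * (G (\<theta> z) * (Xq z - Xg' z (q, 0) / s)) + \<epsilon> * (g (\<theta> z) * (\<zeta> z - Xg z / s))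
        + (\<epsilon> * (Xg z * g (\<theta> z)) + (\<epsilon>\<^sup>2 * c) * (G (\<theta> z) * Xg' z (q, 0))) / s = \<phi> z"
      by (simp add: \<phi>_def diff_divide_distrib add_divide_distrib algebra_simps)
    finally show ?thesis .
  qed
  have sq: "\<epsilon>\<^sup>2 * (w \<bullet> Q) = \<epsilon> * (w \<bullet> Q0)" for w
    using wQ[of w] by (simp add: power2_eq_square mult.assoc)
  \<comment> \<open>\<open>R\<close> is the remainder of \<open>D\<phi>\<close>, divided by \<open>\<epsilon>\<close>.\<close>
  define R where "R z w = \<zeta>' z w * g (\<theta> z) + c * (\<epsilon> * (G (\<theta> z) * Xq' z w)) + c * (g (\<theta> z) * (w \<bullet> Q0) * Xq z)" for z w
  have \<phi>'R: "\<phi>' z w = \<zeta> z * k (\<theta> z) * (w \<bullet> Q0) + \<epsilon> * R z w" for z w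
  proof -
    have "\<phi>' z w = \<zeta> z * k (\<theta> z) * (\<epsilon> * (w \<bullet> Q)) + \<epsilon> * (\<zeta>' z w * g (\<theta> z))
        + \<epsilon>\<^sup>2 * (c * (G (\<theta> z) * Xq' z w)) + c * (g (\<theta> z) * (\<epsilon>\<^sup>2 * (w \<bullet> Q)) * Xq z)"
      by (simp add: \<phi>'_def algebra_simps)
    then show ?thesis unfolding wQ sq by (simp add: R_def algebra_simps power2_eq_square)
  qed
  have wQ0: "\<bar>w \<bullet> Q0\<bar> \<le> norm Q0" if "w \<in> Basis" for w
    using that by (metis Basis_le_norm inner_commute)
  have \<epsilon>1: "\<bar>\<epsilon> * x\<bar> \<le> y" if "\<bar>x\<bar> \<le> y" for x y
  proof -
    have "\<bar>\<epsilon> * x\<bar> \<le> 1 * \<bar>x\<bar>" unfolding abs_mult using \<epsilon> by (intro mult_right_mono) auto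
    with that show ?thesis by simp
  qed
  have cx: "\<bar>c * x\<bar> \<le> c * y" if "\<bar>x\<bar> \<le> y" for x y
    using that c by (intro abs_mult_le) auto
  have R: "\<bar>R z w\<bar> \<le> C0" if w: "w \<in> Basis" for z w
  proof -
    have "\<bar>\<zeta>' z w * g (\<theta> z)\<bar> \<le> C * mg" by (intro abs_mult_le CB w gb)
    moreover have "\<bar>c * (\<epsilon> * (G (\<theta> z) * Xq' z w))\<bar> \<le> c * (mG * C)" by (intro cx \<epsilon>1 abs_mult_le CB w Gb)
    moreover have "\<bar>c * (g (\<theta> z) * (w \<bullet> Q0) * Xq z)\<bar> \<le> c * (mg * norm Q0 * C)" by (intro cx abs_mult_le Cb wQ0 w gb)
    ultimately show ?thesis unfolding R_def C0_def by linarith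
  qed
  have \<epsilon>R: "\<bar>\<epsilon> * R z w\<bar> \<le> \<epsilon> * C0" if w: "w \<in> Basis" for z w
    using R[OF w] \<epsilon> by (intro abs_mult_le) auto
  have Yb: "\<bar>Y z\<bar> \<le> C + 1 / s * C" for z
  proof -
    have "\<bar>(- (1 / s)) * Xg z\<bar> \<le> 1 / s * C" using s by (intro abs_mult_le Cb) auto
    then show ?thesis using Cb(1)[of z] unfolding Y_def by linarith
  qed
  have Y'b: "\<bar>Y' z w\<bar> \<le> C + 1 / s * C" if w: "w \<in> Basis" for z w
  proof -
    have "\<bar>(- (1 / s)) * Xg' z w\<bar> \<le> 1 / s * C" using s by (intro abs_mult_le CB w) auto
    then show ?thesis using CB(1)[OF w, of z] unfolding Y'_def by linarith
  qed
  have A'b: "\<bar>A' z w\<bar> \<le> \<epsilon> * CA" if w: "w \<in> Basis" for z w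
  proof -
    have "A' z w = \<epsilon>\<^sup>2 * (c * (G (\<theta> z) * Y' z w)) + c * (g (\<theta> z) * (\<epsilon>\<^sup>2 * (w \<bullet> Q)) * Y z)"
      by (simp add: A'_def algebra_simps)
    also have "\<dots> = \<epsilon> * (c * (\<epsilon> * (G (\<theta> z) * Y' z w)) + c * (g (\<theta> z) * (w \<bullet> Q0) * Y z))"
      unfolding sq by (simp add: algebra_simps power2_eq_square)
    finally have eq: "A' z w = \<epsilon> * (c * (\<epsilon> * (G (\<theta> z) * Y' z w)) + c * (g (\<theta> z) * (w \<bullet> Q0) * Y z))" .
    have "\<bar>c * (\<epsilon> * (G (\<theta> z) * Y' z w))\<bar> \<le> c * (mG * (C + 1 / s * C))" by (intro cx \<epsilon>1 abs_mult_le Y'b w Gb)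
    moreover have "\<bar>c * (g (\<theta> z) * (w \<bullet> Q0) * Y z)\<bar> \<le> c * (mg * norm Q0 * (C + 1 / s * C))" by (intro cx abs_mult_le Yb wQ0 w gb)
    ultimately show ?thesis unfolding eq CA_def using \<epsilon> by (intro abs_mult_le) linarith+
  qed
  define Bad where "Bad = (cball z0 r - cball z0 r1) \<union> {z\<in>cball z0 r. \<bar>arccos (cos (z \<bullet> Q)) - c0\<bar> \<le> 1 / L}"
  note LL = L0(2)[OF L(1)]
  show ?thesis
  proof (rule that[of \<phi> \<phi>' \<psi> \<psi>' Bad])
    show "C1_field \<phi> \<phi>'" "C1_field \<psi> \<psi>'" by (rule C\<phi> C\<psi>)+
    show out: "\<phi> z = 0" if "z \<notin> cball z0 r" for z
      using \<zeta>0[OF that] by (simp add: \<phi>_def Xq_def)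
    show "\<psi> z = 0" if "z \<notin> cball z0 r" for z
      using \<zeta>0[OF that] out[OF that] by (simp add: \<psi>_def A_def B_def Y_def Xg_def)
    show "(\<Sum>i\<in>UNIV. \<psi>' z (axis i 1, 0) $ i) = \<phi> z" for z by (rule div)
    show "\<bar>\<phi> z\<bar> \<le> \<eta>" for z
    proof -
      have "\<phi> z = \<epsilon> * (\<zeta> z * g (\<theta> z) + c * (\<epsilon> * (G (\<theta> z) * Xq z)))"
        by (simp add: \<phi>_def algebra_simps power2_eq_square)
      moreover have "\<bar>\<zeta> z * g (\<theta> z)\<bar> \<le> C * mg" by (intro abs_mult_le Cb gb)
      moreover have "\<bar>c * (\<epsilon> * (G (\<theta> z) * Xq z))\<bar> \<le> c * (mG * C)" by (intro cx \<epsilon>1 abs_mult_le Cb Gb)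
      ultimately have "\<bar>\<phi> z\<bar> \<le> \<epsilon> * (C * mg + c * (mG * C))"
        using \<epsilon> by (simp only:) (intro abs_mult_le; linarith)
      then show ?thesis using \<epsilon>le[OF Kt'(3)] \<eta> by linarith
    qed
    show "\<bar>\<phi>' z (0, 1)\<bar> \<le> \<eta>" for z
    proof -
      have "\<bar>\<zeta> z * k (\<theta> z)\<bar> \<le> 1 * (a + b)"
        using \<zeta>01[of z] kb[of "\<theta> z"] ab by (intro abs_mult_le) auto
      then have "\<bar>\<zeta> z * k (\<theta> z) * s\<bar> \<le> 1 * (a + b) * s" by (rule abs_mult_le) (use s(1) in auto)
      then show ?thesis
        using \<epsilon>R[OF time_Basis, of z] \<epsilon>le[OF Kt'(2)] s(2) unfolding \<phi>'R qQ(3) by linarith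
    qed
    show "Bad \<in> lmeasurable" unfolding Bad_def using LL by (intro fmeasurable.Un fmeasurable_Diff) auto
    show "Bad \<subseteq> cball z0 r" by (auto simp: Bad_def)
    have "measure lebesgue Bad \<le> measure lebesgue (cball z0 r - cball z0 r1) +
        measure lebesgue {z\<in>cball z0 r. \<bar>arccos (cos (z \<bullet> Q)) - c0\<bar> \<le> 1 / L}"
      unfolding Bad_def using LL by (intro measure_Un_le) auto
    also have "\<dots> \<le> \<eta> / 2 * measure lebesgue (cball z0 r) + \<eta> / 2 * measure lebesgue (cball z0 r)"
      by (rule add_mono[OF r1(3) conjunct2[OF LL]])
    finally show "measure lebesgue Bad \<le> \<eta> * measure lebesgue (cball z0 r)" by simp
    show "\<exists>t\<in>{-a..b}. norm ((\<chi> i. \<phi>' z (axis i 1, 0)) - t *\<^sub>R q) \<le> \<eta> \<and> norm (\<psi>' z (0, 1) - t *\<^sub>R \<gamma>) \<le> \<eta> \<and>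
       (z \<in> cball z0 r - Bad \<longrightarrow> t = -a \<or> t = b)" for z
    proof (intro bexI[of _ "\<zeta> z * k (\<theta> z)"] conjI impI)
      have "norm ((\<chi> i. \<phi>' z (axis i 1, 0)) - (\<zeta> z * k (\<theta> z)) *\<^sub>R q)
          \<le> (\<Sum>i\<in>UNIV. \<bar>((\<chi> i. \<phi>' z (axis i 1, 0)) - (\<zeta> z * k (\<theta> z)) *\<^sub>R q) $ i\<bar>)"
        by (rule norm_le_l1_cart)
      also have "\<dots> = (\<Sum>i\<in>(UNIV::'n set). \<bar>\<epsilon> * R z (axis i 1, 0)\<bar>)"
        unfolding \<phi>'R by (simp add: Q0_def inner_axis' )
      also have "\<dots> \<le> (\<Sum>i\<in>(UNIV::'n set). \<epsilon> * C0)"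
        by (intro sum_mono \<epsilon>R axis_Basis)
      also have "\<dots> = \<epsilon> * (real CARD('n) * C0)" by simp
      finally show "norm ((\<chi> i. \<phi>' z (axis i 1, 0)) - (\<zeta> z * k (\<theta> z)) *\<^sub>R q) \<le> \<eta>"
        using \<epsilon>le[OF Kt'(1)] \<eta> by linarith
      have "\<psi>' z (0, 1) - (\<zeta> z * k (\<theta> z)) *\<^sub>R \<gamma> = A' z (0, 1) *\<^sub>R q + (1 / s * (\<epsilon> * R z (0, 1))) *\<^sub>R \<gamma>"
        unfolding \<psi>'_def B'_def \<phi>'R qQ(3) using s(1) by (simp add: algebra_simps)
      also have "norm \<dots> \<le> \<bar>A' z (0, 1)\<bar> * norm q + \<bar>1 / s * (\<epsilon> * R z (0, 1))\<bar> * norm \<gamma>"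
        by (rule order_trans[OF norm_triangle_ineq]) simp
      also have "\<dots> \<le> (\<epsilon> * CA) * norm q + (1 / s * (\<epsilon> * C0)) * norm \<gamma>"
        using s by (intro add_mono mult_right_mono A'b time_Basis abs_mult_le \<epsilon>R) auto
      also have "\<dots> = \<epsilon> * (CA * norm q + 1 / s * C0 * norm \<gamma>)" by (simp add: algebra_simps)
      finally show "norm (\<psi>' z (0, 1) - (\<zeta> z * k (\<theta> z)) *\<^sub>R \<gamma>) \<le> \<eta>"
        using \<epsilon>le[OF Kt'(4)] \<eta> by linarith
      show "\<zeta> z * k (\<theta> z) = - a \<or> \<zeta> z * k (\<theta> z) = b" if "z \<in> cball z0 r - Bad"
      proof -
        have "z \<in> cball z0 r1" "1 / L \<le> \<bar>arccos (cos (\<theta> z)) - c0\<bar>" using that by (auto simp: Bad_def \<theta>_def)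
        then show ?thesis using kab \<zeta>1 by simp
      qed
      have "- a * \<zeta> z \<le> k (\<theta> z) * \<zeta> z" "k (\<theta> z) * \<zeta> z \<le> b * \<zeta> z"
        using kb \<zeta>01 by (intro mult_right_mono; simp)+
      moreover have "a * \<zeta> z \<le> a * 1" "b * \<zeta> z \<le> b * 1"
        using \<zeta>01 ab by (intro mult_left_mono; simp)+
      ultimately show "\<zeta> z * k (\<theta> z) \<in> {-a..b}" by (auto simp: mult.commute)
    qed
  qed
qed

section \<open>Exhaustion by perturbed balls\<close>

text \<open>The fields \<open>P\<close> and \<open>V\<close> stand for \<open>Du\<close> and \<open>v_t\<close>. The \<open>C\<^sup>1\<close> functions \<open>\<phi>\<close> and \<open>\<psi>\<close>, with
  derivatives \<open>\<phi>'\<close> and \<open>\<psi>'\<close>, vanish outside the compact set \<open>D\<close>; \<open>div \<psi> = \<phi>\<close>, and \<open>\<phi>\<close> and \<open>\<phi>_t\<close>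
  are of size at most \<open>\<eta>\<close>. On \<open>D\<close> the perturbed fields \<open>(P + D\<phi>, V + \<psi>_t)\<close> lie in \<open>S_set \<delta>\<close>, and outside
  the set \<open>Bad\<close>, whose measure is at most \<open>e\<close> times that of \<open>D\<close>, they satisfy
  \<open>|V + \<psi>_t - sigma (P + D\<phi>)| \<le> e\<close>.\<close>

definition perturbation ::
  "real \<Rightarrow> real \<Rightarrow> real \<Rightarrow> ((real^'n) \<times> real \<Rightarrow> real^'n) \<Rightarrow> ((real^'n) \<times> real \<Rightarrow> real^'n) \<Rightarrow> ((real^'n) \<times> real) set \<Rightarrow>
   ((real^'n) \<times> real \<Rightarrow> real) \<Rightarrow> ((real^'n) \<times> real \<Rightarrow> (real^'n) \<times> real \<Rightarrow> real) \<Rightarrow>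
   ((real^'n) \<times> real \<Rightarrow> real^'n) \<Rightarrow> ((real^'n) \<times> real \<Rightarrow> (real^'n) \<times> real \<Rightarrow> real^'n) \<Rightarrow> ((real^'n) \<times> real) set \<Rightarrow> bool" where
  "perturbation \<delta> \<eta> e P V D \<phi> \<phi>' \<psi> \<psi>' Bad \<longleftrightarrow> compact D \<and>
     C1_field \<phi> \<phi>' \<and> C1_field \<psi> \<psi>' \<and> (\<forall>z. z \<notin> D \<longrightarrow> \<phi> z = 0) \<and> (\<forall>z. z \<notin> D \<longrightarrow> \<psi> z = 0) \<and>
     (\<forall>z. (\<Sum>i\<in>UNIV. \<psi>' z (axis i 1, 0) $ i) = \<phi> z) \<and>
     (\<forall>z. \<bar>\<phi> z\<bar> \<le> \<eta>) \<and> (\<forall>z. \<bar>\<phi>' z (0, 1)\<bar> \<le> \<eta>) \<and>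
     Bad \<in> lmeasurable \<and> Bad \<subseteq> D \<and> measure lebesgue Bad \<le> e * measure lebesgue D \<and>
     (\<forall>z\<in>D. (P z + (\<chi> i. \<phi>' z (axis i 1, 0)), V z + \<psi>' z (0, 1)) \<in> S_set \<delta>) \<and>
     (\<forall>z\<in>D - Bad. norm (V z + \<psi>' z (0, 1) - sigma (P z + (\<chi> i. \<phi>' z (axis i 1, 0)))) \<le> e)"

text \<open>The set \<open>D\<close> carries a perturbation of the fields \<open>P\<close> and \<open>V\<close>.\<close>

definition perturbable ::
  "real \<Rightarrow> real \<Rightarrow> real \<Rightarrow> ((real^'n) \<times> real \<Rightarrow> real^'n) \<Rightarrow> ((real^'n) \<times> real \<Rightarrow> real^'n) \<Rightarrow> ((real^'n) \<times> real) set \<Rightarrow> bool" where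
  "perturbable \<delta> \<eta> e P V D \<longleftrightarrow> (\<exists>\<phi> \<phi>' \<psi> \<psi>' Bad. perturbation \<delta> \<eta> e P V D \<phi> \<phi>' \<psi> \<psi>' Bad)"

lemma C1_field_eq_0_outside:
  assumes f: "C1_field f f'" and D: "closed D" "\<And>z. z \<notin> D \<Longrightarrow> f z = 0" "z \<notin> D"
  shows "f' z w = 0"
proof -
  have "((\<lambda>_. 0) has_derivative (\<lambda>_. 0)) (at z)" by simp
  then have "(f has_derivative (\<lambda>_. 0)) (at z)"
    by (rule has_derivative_transform_within_open[of _ _ _ _ "- D"]) (use D in \<open>auto simp: open_Compl\<close>)
  moreover have "(f has_derivative f' z) (at z)" using f by (simp add: C1_field_def)
  ultimately have "f' z = (\<lambda>_. 0)" by (rule has_derivative_unique[rotated])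
  then show ?thesis by simp
qed

lemma perturbable_empty: "0 \<le> \<eta> \<Longrightarrow> perturbable \<delta> \<eta> e P V {}"
  unfolding perturbable_def perturbation_def
  by (intro exI conjI compact_empty exI[of _ "\<lambda>_. 0"] exI[of _ "\<lambda>_ _. 0"] exI[of _ "{}"] C1_field_const) auto

lemma perturbable_Un:
  fixes D1 D2 :: "((real^'n) \<times> real) set"
  assumes "perturbable \<delta> \<eta> e P V D1" "perturbable \<delta> \<eta> e P V D2" and disj: "D1 \<inter> D2 = {}"
  shows "perturbable \<delta> \<eta> e P V (D1 \<union> D2)"
proof -
  obtain \<phi>1 \<phi>1' \<psi>1 \<psi>1' B1 where h1: "perturbation \<delta> \<eta> e P V D1 \<phi>1 \<phi>1' \<psi>1 \<psi>1' B1"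
    using assms(1) unfolding perturbable_def by blast
  have 1: "compact D1" "C1_field \<phi>1 \<phi>1'" "C1_field \<psi>1 \<psi>1'"
     "\<And>z. z \<notin> D1 \<Longrightarrow> \<phi>1 z = (0::real)" "\<And>z. z \<notin> D1 \<Longrightarrow> \<psi>1 z = (0::real^'n)"
     "\<And>z. (\<Sum>i\<in>UNIV. \<psi>1' z (axis i 1, 0) $ i) = \<phi>1 z"
     "\<And>z. \<bar>\<phi>1 z\<bar> \<le> \<eta>" "\<And>z. \<bar>\<phi>1' z (0, 1)\<bar> \<le> \<eta>"
     "B1 \<in> lmeasurable" "B1 \<subseteq> D1" "measure lebesgue B1 \<le> e * measure lebesgue D1"
     "\<And>z. z\<in>D1 \<Longrightarrow> (P z + (\<chi> i. \<phi>1' z (axis i 1, 0)), V z + \<psi>1' z (0, 1)) \<in> S_set \<delta>"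
     "\<And>z. z\<in>D1 - B1 \<Longrightarrow> norm (V z + \<psi>1' z (0, 1) - sigma (P z + (\<chi> i. \<phi>1' z (axis i 1, 0)))) \<le> e"
    using h1 unfolding perturbation_def by blast+
  obtain \<phi>2 \<phi>2' \<psi>2 \<psi>2' B2 where h2: "perturbation \<delta> \<eta> e P V D2 \<phi>2 \<phi>2' \<psi>2 \<psi>2' B2"
    using assms(2) unfolding perturbable_def by blast
  have 2: "compact D2" "C1_field \<phi>2 \<phi>2'" "C1_field \<psi>2 \<psi>2'"
     "\<And>z. z \<notin> D2 \<Longrightarrow> \<phi>2 z = (0::real)" "\<And>z. z \<notin> D2 \<Longrightarrow> \<psi>2 z = (0::real^'n)"
     "\<And>z. (\<Sum>i\<in>UNIV. \<psi>2' z (axis i 1, 0) $ i) = \<phi>2 z"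
     "\<And>z. \<bar>\<phi>2 z\<bar> \<le> \<eta>" "\<And>z. \<bar>\<phi>2' z (0, 1)\<bar> \<le> \<eta>"
     "B2 \<in> lmeasurable" "B2 \<subseteq> D2" "measure lebesgue B2 \<le> e * measure lebesgue D2"
     "\<And>z. z\<in>D2 \<Longrightarrow> (P z + (\<chi> i. \<phi>2' z (axis i 1, 0)), V z + \<psi>2' z (0, 1)) \<in> S_set \<delta>"
     "\<And>z. z\<in>D2 - B2 \<Longrightarrow> norm (V z + \<psi>2' z (0, 1) - sigma (P z + (\<chi> i. \<phi>2' z (axis i 1, 0)))) \<le> e"
    using h2 unfolding perturbation_def by blast+
  have z1: "\<phi>1' z w = 0" "\<psi>1' z w = 0" if "z \<notin> D1" for z w
    using C1_field_eq_0_outside[OF 1(2) compact_imp_closed[OF 1(1)] 1(4) that]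
      C1_field_eq_0_outside[OF 1(3) compact_imp_closed[OF 1(1)] 1(5) that] by auto
  have z2: "\<phi>2' z w = 0" "\<psi>2' z w = 0" if "z \<notin> D2" for z w
    using C1_field_eq_0_outside[OF 2(2) compact_imp_closed[OF 2(1)] 2(4) that]
      C1_field_eq_0_outside[OF 2(3) compact_imp_closed[OF 2(1)] 2(5) that] by auto
  have cases: "z \<notin> D1 \<or> z \<notin> D2" for z using disj by blast
  have small: "\<bar>\<phi>1 z + \<phi>2 z\<bar> \<le> \<eta> \<and> \<bar>\<phi>1' z (0, 1) + \<phi>2' z (0, 1)\<bar> \<le> \<eta>" for z
    using cases[of z] 1(4,7,8) 2(4,7,8) z1 z2 by (metis add.left_neutral add.right_neutral)
  have "measure lebesgue (B1 \<union> B2) \<le> measure lebesgue B1 + measure lebesgue B2"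
    using 1(9) 2(9) by (intro measure_Un_le) auto
  also have "\<dots> \<le> e * measure lebesgue D1 + e * measure lebesgue D2" using 1(11) 2(11) by linarith
  also have "\<dots> = e * measure lebesgue (D1 \<union> D2)"
    using 1(1) 2(1) disj by (subst measure_Un3) (auto intro: lmeasurable_compact simp: algebra_simps)
  finally have meas: "measure lebesgue (B1 \<union> B2) \<le> e * measure lebesgue (D1 \<union> D2)" .
  have in1: "z \<notin> D2" if "z \<in> D1" for z using that disj by blast
  have in2: "z \<notin> D1" if "z \<in> D2" for z using that disj by blast
  show ?thesis
    unfolding perturbable_def perturbation_def
  proof (intro exI conjI)
    show "compact (D1 \<union> D2)" using 1 2 by blast
    show "C1_field (\<lambda>z. \<phi>1 z + \<phi>2 z) (\<lambda>z w. \<phi>1' z w + \<phi>2' z w)" by (rule C1_field_add[OF 1(2) 2(2)])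
    show "C1_field (\<lambda>z. \<psi>1 z + \<psi>2 z) (\<lambda>z w. \<psi>1' z w + \<psi>2' z w)" by (rule C1_field_add[OF 1(3) 2(3)])
    show "\<forall>z. z \<notin> D1 \<union> D2 \<longrightarrow> \<phi>1 z + \<phi>2 z = 0" "\<forall>z. z \<notin> D1 \<union> D2 \<longrightarrow> \<psi>1 z + \<psi>2 z = 0"
      using 1(4,5) 2(4,5) by simp_all
    show "\<forall>z. (\<Sum>i\<in>UNIV. (\<psi>1' z (axis i 1, 0) + \<psi>2' z (axis i 1, 0)) $ i) = \<phi>1 z + \<phi>2 z"
      using 1(6) 2(6) by (simp add: sum.distrib)
    show "\<forall>z. \<bar>\<phi>1 z + \<phi>2 z\<bar> \<le> \<eta>" "\<forall>z. \<bar>\<phi>1' z (0, 1) + \<phi>2' z (0, 1)\<bar> \<le> \<eta>"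
      using small by blast+
    show "B1 \<union> B2 \<in> lmeasurable" using 1(9) 2(9) by auto
    show "B1 \<union> B2 \<subseteq> D1 \<union> D2" using 1(10) 2(10) by auto
    show "measure lebesgue (B1 \<union> B2) \<le> e * measure lebesgue (D1 \<union> D2)" by (rule meas)
    show "\<forall>z\<in>D1 \<union> D2. (P z + (\<chi> i. \<phi>1' z (axis i 1, 0) + \<phi>2' z (axis i 1, 0)), V z + (\<psi>1' z (0, 1) + \<psi>2' z (0, 1))) \<in> S_set \<delta>"
    proof
      fix z assume "z \<in> D1 \<union> D2"
      then show "(P z + (\<chi> i. \<phi>1' z (axis i 1, 0) + \<phi>2' z (axis i 1, 0)), V z + (\<psi>1' z (0, 1) + \<psi>2' z (0, 1))) \<in> S_set \<delta>"
      proof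
        assume z: "z \<in> D1"
        show ?thesis using 1(12)[OF z] by (simp add: z2[OF in1[OF z]])
      next
        assume z: "z \<in> D2"
        show ?thesis using 2(12)[OF z] by (simp add: z1[OF in2[OF z]])
      qed
    qed
    show "\<forall>z\<in>D1 \<union> D2 - (B1 \<union> B2). norm (V z + (\<psi>1' z (0, 1) + \<psi>2' z (0, 1))
        - sigma (P z + (\<chi> i. \<phi>1' z (axis i 1, 0) + \<phi>2' z (axis i 1, 0)))) \<le> e"
    proof
      fix z assume z0: "z \<in> D1 \<union> D2 - (B1 \<union> B2)"
      then have "z \<in> D1 \<or> z \<in> D2" by blast
      then show "norm (V z + (\<psi>1' z (0, 1) + \<psi>2' z (0, 1))
        - sigma (P z + (\<chi> i. \<phi>1' z (axis i 1, 0) + \<phi>2' z (axis i 1, 0)))) \<le> e"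
      proof
        assume z: "z \<in> D1"
        show ?thesis using 1(13)[of z] z z0 by (simp add: z2[OF in1[OF z]])
      next
        assume z: "z \<in> D2"
        show ?thesis using 2(13)[of z] z z0 by (simp add: z1[OF in2[OF z]])
      qed
    qed
  qed
qed

lemma perturbable_Union:
  assumes "finite \<D>" "\<And>D. D \<in> \<D> \<Longrightarrow> perturbable \<delta> \<eta> e P V D" "disjoint \<D>" "0 \<le> \<eta>"
  shows "perturbable \<delta> \<eta> e P V (\<Union>\<D>)"
  using assms
proof (induction \<D>)
  case empty
  then show ?case by (simp add: perturbable_empty)
next
  case (insert D \<D>)
  have "D \<inter> D' = {}" if "D' \<in> \<D>" for D'
    by (rule disjointD[OF insert.prems(2)]) (use insert.hyps(2) that in auto)
  then have "D \<inter> \<Union>\<D> = {}" by blast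
  moreover have "disjoint \<D>" using insert.prems(2) by (rule pairwise_subset) auto
  ultimately show ?case
    using perturbable_Un[of \<delta> \<eta> e P V D "\<Union>\<D>"] insert by simp
qed

text \<open>On a small ball the fields are nearly constant, so the oscillation along the segment through
  \<open>(P z0, V z0)\<close> keeps the perturbed fields near that segment, hence in the open set \<open>S_set \<delta>\<close>.\<close>

lemma small_balls_perturbable:
  fixes P V :: "(real^'n) \<times> real \<Rightarrow> real^'n"
  assumes "isCont P z0" "isCont V z0" and S: "(P z0, V z0) \<in> S_set \<delta>" and "\<delta> > 0" "\<eta> > 0" "e > 0"
  obtains r0 where "r0 > 0" "\<And>r. 0 < r \<Longrightarrow> r < r0 \<Longrightarrow> perturbable \<delta> \<eta> e P V (cball z0 r)"
proof -
  define p \<beta> where "p = P z0" and "\<beta> = V z0"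
  obtain c \<gamma> :: "real^'n" and a b :: real where c: "c \<noteq> 0" "\<gamma> \<bullet> c = 0" and ab: "a > 0" "b > 0"
    and seg: "\<And>t. t \<in> {-a..b} \<Longrightarrow> (p + t *\<^sub>R c, \<beta> + t *\<^sub>R \<gamma>) \<in> S_set \<delta>"
    and fin: "\<And>t. t \<in> {-a, b} \<Longrightarrow> norm (\<beta> + t *\<^sub>R \<gamma> - sigma (p + t *\<^sub>R c)) < e"
    using S_set_segment[OF S[folded p_def \<beta>_def] \<open>\<delta> > 0\<close> \<open>e > 0\<close>] by blast
  define l where "l t = (p + t *\<^sub>R c, \<beta> + t *\<^sub>R \<gamma>)" for t
  have lS: "l ` {-a..b} \<subseteq> S_set \<delta>" using seg unfolding l_def by blast
  have "compact (l ` {-a..b})"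
    unfolding l_def by (intro compact_continuous_image continuous_intros) auto
  then obtain e1 where e1: "e1 > 0" "(\<Union>x\<in>l ` {-a..b}. ball x e1) \<subseteq> S_set \<delta>"
    using compact_subset_open_imp_ball_epsilon_subset[OF _ open_S_set lS] by blast
  define O' where "O' = {x::(real^'n) \<times> (real^'n). norm (snd x - sigma (fst x)) < e}"
  have "open O'"
    unfolding O'_def by (intro open_Collect_less continuous_intros continuous_on_compose2[OF continuous_on_sigma]) auto
  moreover have "compact (l ` {-a, b})" "l ` {-a, b} \<subseteq> O'"
    using fin[of "-a"] fin[of b] by (auto simp: l_def O'_def intro!: finite_imp_compact)
  ultimately obtain e2 where e2: "e2 > 0" "(\<Union>x\<in>l ` {-a, b}. ball x e2) \<subseteq> O'"
    using compact_subset_open_imp_ball_epsilon_subset by blast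
  \<comment> \<open>The four errors of size \<open>h\<close> (two from the fields, two from the oscillation) add up to less than \<open>5 h\<close>.\<close>
  define h where "h = min (min \<eta> e) (min e1 e2 / 5)"
  have h: "h > 0" "h \<le> \<eta>" "h \<le> e" "5 * h \<le> e1" "5 * h \<le> e2"
    using e1(1) e2(1) \<open>\<eta> > 0\<close> \<open>e > 0\<close> by (auto simp: h_def)
  obtain d1 d2 where d: "d1 > 0" "\<And>z. dist z z0 < d1 \<Longrightarrow> dist (P z) p < h"
      "d2 > 0" "\<And>z. dist z z0 < d2 \<Longrightarrow> dist (V z) \<beta> < h"
    using assms(1,2) h(1) unfolding continuous_at_eps_delta p_def \<beta>_def by metis
  show ?thesis
  proof (rule that[of "min d1 d2"])
    fix r assume r: "0 < r" "r < min d1 d2"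
    obtain \<phi> \<phi>' \<psi> \<psi>' Bad where *: "C1_field \<phi> \<phi>'" "C1_field \<psi> \<psi>'"
      "\<And>z. z \<notin> cball z0 r \<Longrightarrow> \<phi> z = (0::real)" "\<And>z. z \<notin> cball z0 r \<Longrightarrow> \<psi> z = (0::real^'n)"
      "\<And>z. (\<Sum>i\<in>UNIV. \<psi>' z (axis i 1, 0) $ i) = \<phi> z"
      "\<And>z. \<bar>\<phi> z\<bar> \<le> h" "\<And>z. \<bar>\<phi>' z (0, 1)\<bar> \<le> h"
      "Bad \<in> lmeasurable" "Bad \<subseteq> cball z0 r" "measure lebesgue Bad \<le> h * measure lebesgue (cball z0 r)"
      and osc: "\<And>z. \<exists>t\<in>{-a..b}. norm ((\<chi> i. \<phi>' z (axis i 1, 0)) - t *\<^sub>R c) \<le> h \<and> norm (\<psi>' z (0, 1) - t *\<^sub>R \<gamma>) \<le> h \<and>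
       (z \<in> cball z0 r - Bad \<longrightarrow> t = -a \<or> t = b)"
    proof (rule ball_perturbation[OF c ab r(1) h(1), of z0], goal_cases)
      case (1 \<phi> \<phi>' \<psi> \<psi>' Bad)
      show ?case by (rule that[OF 1(2-)])
    qed
    define W where "W z = (P z + (\<chi> i. \<phi>' z (axis i 1, 0)), V z + \<psi>' z (0, 1))" for z
    have near: "\<exists>t\<in>{-a..b}. dist (l t) (W z) < 5 * h \<and> (z \<notin> Bad \<longrightarrow> t = -a \<or> t = b)" if z: "z \<in> cball z0 r" for z
    proof -
      obtain t where t: "t \<in> {-a..b}" "norm ((\<chi> i. \<phi>' z (axis i 1, 0)) - t *\<^sub>R c) \<le> h"
        "norm (\<psi>' z (0, 1) - t *\<^sub>R \<gamma>) \<le> h" "z \<notin> Bad \<longrightarrow> t = -a \<or> t = b"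
        using osc[of z] z by blast
      have "dist z z0 < d1" "dist z z0 < d2" using z r by (auto simp: dist_commute)
      then have Pz: "norm (P z - p) < h" "norm (V z - \<beta>) < h" using d by (auto simp: dist_norm)
      have "dist (l t) (W z) = norm (W z - l t)" by (metis dist_commute dist_norm)
      also have "W z - l t = ((P z - p) + ((\<chi> i. \<phi>' z (axis i 1, 0)) - t *\<^sub>R c), (V z - \<beta>) + (\<psi>' z (0, 1) - t *\<^sub>R \<gamma>))"
        by (simp add: W_def l_def)
      also have "norm \<dots> \<le> norm ((P z - p) + ((\<chi> i. \<phi>' z (axis i 1, 0)) - t *\<^sub>R c)) + norm ((V z - \<beta>) + (\<psi>' z (0, 1) - t *\<^sub>R \<gamma>))"
        by (rule norm_Pair_le)
      also have "\<dots> \<le> (norm (P z - p) + norm ((\<chi> i. \<phi>' z (axis i 1, 0)) - t *\<^sub>R c)) + (norm (V z - \<beta>) + norm (\<psi>' z (0, 1) - t *\<^sub>R \<gamma>))"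
        by (intro add_mono norm_triangle_ineq)
      also have "\<dots> < 5 * h" using Pz t(2,3) h(1) by linarith
      finally show ?thesis using t by blast
    qed
    have inS: "W z \<in> S_set \<delta>" if z: "z \<in> cball z0 r" for z
    proof -
      obtain t where t: "t \<in> {-a..b}" "dist (l t) (W z) < 5 * h" using near[OF z] by blast
      then have "W z \<in> ball (l t) e1" using h(4) by simp
      then show ?thesis using t(1) by (intro subsetD[OF e1(2)] UN_I[of "l t"] imageI)
    qed
    have inO: "W z \<in> O'" if z: "z \<in> cball z0 r - Bad" for z
    proof -
      obtain t where t: "t \<in> {-a, b}" "dist (l t) (W z) < 5 * h" using near[of z] z by blast
      then have "W z \<in> ball (l t) e2" using h(5) by simp
      then show ?thesis using t(1) by (intro subsetD[OF e2(2)] UN_I[of "l t"] imageI)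
    qed
    show "perturbable \<delta> \<eta> e P V (cball z0 r)"
      unfolding perturbable_def perturbation_def
    proof (intro exI conjI)
      show "C1_field \<phi> \<phi>'" "C1_field \<psi> \<psi>'" by (rule *)+
      show "\<forall>z. z \<notin> cball z0 r \<longrightarrow> \<phi> z = 0" "\<forall>z. z \<notin> cball z0 r \<longrightarrow> \<psi> z = 0" using *(3,4) by blast+
      show "\<forall>z. (\<Sum>i\<in>UNIV. \<psi>' z (axis i 1, 0) $ i) = \<phi> z" using *(5) by blast
      show "\<forall>z. \<bar>\<phi> z\<bar> \<le> \<eta>" "\<forall>z. \<bar>\<phi>' z (0, 1)\<bar> \<le> \<eta>" using order_trans[OF *(6) h(2)] order_trans[OF *(7) h(2)] by blast+
      show "measure lebesgue Bad \<le> e * measure lebesgue (cball z0 r)"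
        using *(10) mult_right_mono[OF h(3), of "measure lebesgue (cball z0 r)"] by simp
      show "\<forall>z\<in>cball z0 r. (P z + (\<chi> i. \<phi>' z (axis i 1, 0)), V z + \<psi>' z (0, 1)) \<in> S_set \<delta>"
        using inS by (simp add: W_def)
      show "\<forall>z\<in>cball z0 r - Bad. norm (V z + \<psi>' z (0, 1) - sigma (P z + (\<chi> i. \<phi>' z (axis i 1, 0)))) \<le> e"
        using inO by (auto simp: W_def O'_def intro: less_imp_le)
    qed (use * in auto)
  qed (use d in auto)
qed

text \<open>By Vitali's covering theorem finitely many disjoint perturbable balls exhaust \<open>H\<close> up to measure
  \<open>\<tau>\<close>, and a finite disjoint union of perturbable sets is perturbable.\<close>

lemma perturbable_exhaustion:
  fixes P V :: "(real^'n) \<times> real \<Rightarrow> real^'n"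
  assumes H: "open H" "bounded H" and cont: "\<And>z. z \<in> H \<Longrightarrow> isCont P z" "\<And>z. z \<in> H \<Longrightarrow> isCont V z"
    and S: "\<And>z. z \<in> H \<Longrightarrow> (P z, V z) \<in> S_set \<delta>" and "\<delta> > 0" "\<eta> > 0" "e > 0" "\<tau> > 0"
  obtains D where "D \<subseteq> H" "perturbable \<delta> \<eta> e P V D" "measure lebesgue (H - D) \<le> \<tau>"
proof -
  define K where "K = {i. 0 < snd i \<and> cball (fst i) (snd i) \<subseteq> H \<and> perturbable \<delta> \<eta> e P V (cball (fst i) (snd i))}"
  have ex: "\<exists>i. i \<in> K \<and> x \<in> cball (fst i) (snd i) \<and> snd i < d" if x: "x \<in> H" and "0 < d" for x d
  proof -
    obtain r0 where r0: "r0 > 0" "\<And>r. 0 < r \<Longrightarrow> r < r0 \<Longrightarrow> perturbable \<delta> \<eta> e P V (cball x r)"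
      using small_balls_perturbable[OF cont(1)[OF x] cont(2)[OF x] S[OF x] \<open>\<delta> > 0\<close> \<open>\<eta> > 0\<close> \<open>e > 0\<close>] by blast
    obtain r1 where r1: "r1 > 0" "cball x r1 \<subseteq> H" using open_contains_cball H(1) x by metis
    define r where "r = min (min r0 r1) d / 2"
    have "0 < r" "r < r0" "r \<le> r1" "r < d" using r0(1) r1(1) \<open>0 < d\<close> by (auto simp: r_def)
    moreover from this have "cball x r \<subseteq> H" using r1(2) subset_cball by blast
    ultimately show ?thesis using r0(2) by (intro exI[of _ "(x, r)"]) (auto simp: K_def)
  qed
  obtain C where C: "countable C" "C \<subseteq> K"
     "pairwise (\<lambda>i j. disjnt (cball (fst i) (snd i)) (cball (fst j) (snd j))) C"
     "negligible (H - (\<Union>i \<in> C. cball (fst i) (snd i)))"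
  proof (rule Vitali_covering_theorem_cballs[of K snd H fst])
    show "\<And>i. i \<in> K \<Longrightarrow> 0 < snd i" by (auto simp: K_def)
  qed (use ex in blast)+
  define \<D> where "\<D> = (\<lambda>i. cball (fst i) (snd i)) ` C"
  have \<D>: "countable \<D>" "\<And>D. D \<in> \<D> \<Longrightarrow> D \<in> lmeasurable" "\<Union>\<D> \<subseteq> H"
      "\<And>D. D \<in> \<D> \<Longrightarrow> perturbable \<delta> \<eta> e P V D"
    using C(1,2) unfolding \<D>_def K_def by (blast intro: countable_image lmeasurable_cball)+
  have disj: "disjoint \<D>"
  proof (rule disjointI)
    fix A B assume AB: "A \<in> \<D>" "B \<in> \<D>" "A \<noteq> B"
    then obtain i j where ij: "i \<in> C" "j \<in> C" "A = cball (fst i) (snd i)" "B = cball (fst j) (snd j)"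
      unfolding \<D>_def by blast
    with AB(3) have "i \<noteq> j" by blast
    then show "A \<inter> B = {}" using pairwiseD[OF C(3) ij(1,2)] ij(3,4) by (simp add: disjnt_def)
  qed
  have Hm: "H \<in> lmeasurable" using H by (simp add: lmeasurable_open)
  obtain \<D>' where \<D>': "\<D>' \<subseteq> \<D>" "finite \<D>'" "measure lebesgue (\<Union>\<D>) - \<tau> < measure lebesgue (\<Union>\<D>')"
  proof (rule measure_countable_Union_approachable[OF \<D>(1) \<open>\<tau> > 0\<close> \<D>(2)])
    show "measure lebesgue (\<Union>D') \<le> measure lebesgue H" if "D' \<subseteq> \<D>" "finite D'" for D'
      using that \<D> Hm by (intro measure_mono_fmeasurable) (auto intro!: fmeasurableD fmeasurable.finite_Union)
  qed blast
  have "perturbable \<delta> \<eta> e P V (\<Union>\<D>')"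
    by (rule perturbable_Union) (use \<D>' \<D>(4) disj \<open>\<eta> > 0\<close> in \<open>auto intro: pairwise_subset\<close>)
  moreover have sub: "\<Union>\<D>' \<subseteq> H" using \<D>' \<D>(3) by blast
  moreover have "measure lebesgue (H - \<Union>\<D>') \<le> \<tau>"
  proof -
    have U: "\<Union>\<D> \<in> sets lebesgue" using \<D>(1,2) by (intro sets.countable_Union) auto
    have "measure lebesgue H = measure lebesgue (\<Union>\<D>)"
    proof (rule measure_negligible_symdiff)
      have "\<Union>\<D> - H \<union> (H - \<Union>\<D>) = H - (\<Union>i\<in>C. cball (fst i) (snd i))" using \<D>(3) unfolding \<D>_def by blast
      then show "negligible (\<Union>\<D> - H \<union> (H - \<Union>\<D>))" using C(4) by simp
    qed (rule fmeasurableI2[OF Hm \<D>(3) U])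
    moreover have "measure lebesgue (H - \<Union>\<D>') = measure lebesgue H - measure lebesgue (\<Union>\<D>')"
      using \<D>' \<D>(2) Hm sub by (intro measurable_measure_Diff) (auto intro!: fmeasurableD fmeasurable.finite_Union)
    ultimately show ?thesis using \<D>'(3) by linarith
  qed
  ultimately show ?thesis using that by blast
qed

section \<open>Perturbation of weakly differentiable functions\<close>

lemma AE_lebesgue_on_iff:
  "S \<in> sets lebesgue \<Longrightarrow> (AE z in lebesgue_on S. R z) \<longleftrightarrow> (AE z in lebesgue. z \<in> S \<longrightarrow> R z)"
  by (rule AE_restrict_space_iff) simp

lemma Linf_norm_le:
  fixes f :: "'a::euclidean_space \<Rightarrow> 'b::euclidean_space"
  assumes "f \<in> borel_measurable (lebesgue_on S)" "AE z in lebesgue_on S. ennreal (norm (f z)) \<le> c"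
  shows "Linf_norm S f \<le> c"
  unfolding Linf_norm_def by (rule esssup_I) (use assms in auto)

lemma Linf_norm_AE: "AE z in lebesgue_on S. ennreal (norm (f z)) \<le> Linf_norm S f"
  unfolding Linf_norm_def by (rule esssup_AE)

lemma Linf_norm_add_le:
  fixes f g h :: "'a::euclidean_space \<Rightarrow> 'b::euclidean_space"
  assumes h: "h \<in> borel_measurable (lebesgue_on S)" and "AE z in lebesgue_on S. norm (h z) \<le> norm (f z) + norm (g z)"
  shows "Linf_norm S h \<le> Linf_norm S f + Linf_norm S g"
  using h
proof (rule Linf_norm_le)
  show "AE z in lebesgue_on S. ennreal (norm (h z)) \<le> Linf_norm S f + Linf_norm S g"
    using assms(2) Linf_norm_AE[where S=S and f=f] Linf_norm_AE[where S=S and f=g]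
  proof eventually_elim
    case (elim z)
    have "ennreal (norm (h z)) \<le> ennreal (norm (f z)) + ennreal (norm (g z))"
      using elim(1) by (simp add: ennreal_plus[symmetric] ennreal_leI del: ennreal_plus)
    then show ?case using add_mono[OF elim(2,3)] by (rule order_trans)
  qed
qed

lemma Linf_add: "Linf S f \<Longrightarrow> Linf S g \<Longrightarrow> Linf S (\<lambda>z. f z + g z)"
proof -
  assume f: "Linf S f" and g: "Linf S g"
  have m: "(\<lambda>z. f z + g z) \<in> borel_measurable (lebesgue_on S)"
    using f g by (auto simp: Linf_def)
  have "Linf_norm S (\<lambda>z. f z + g z) \<le> Linf_norm S f + Linf_norm S g"
    by (rule Linf_norm_add_le[OF m]) (auto intro: norm_triangle_ineq)
  also have "\<dots> < \<infinity>" using f g by (auto simp: Linf_def)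
  finally show ?thesis using m by (simp add: Linf_def)
qed

lemma measurable_continuous_lebesgue_on:
  fixes f :: "'a::euclidean_space \<Rightarrow> 'b::euclidean_space"
  assumes "continuous_on UNIV f"
  shows "f \<in> borel_measurable (lebesgue_on S)"
  using assms by (intro measurable_restrict_space1 measurable_completion) (simp add: borel_measurable_continuous_onI)

lemma Linf_continuous_bounded:
  fixes f :: "'a::euclidean_space \<Rightarrow> 'b::euclidean_space"
  assumes "continuous_on UNIV f" "\<And>z. norm (f z) \<le> B"
  shows "Linf S f"
proof -
  have m: "f \<in> borel_measurable (lebesgue_on S)" by (rule measurable_continuous_lebesgue_on[OF assms(1)])
  have "Linf_norm S f \<le> ennreal B"
    by (rule Linf_norm_le[OF m]) (auto intro: ennreal_leI assms(2))
  also have "\<dots> < \<infinity>" by simp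
  finally show ?thesis using m by (simp add: Linf_def)
qed

lemma borel_measurable_lebesgue_on_AE:
  fixes f g :: "'a::euclidean_space \<Rightarrow> 'b::euclidean_space"
  assumes S: "S \<in> sets lebesgue" and f: "f \<in> borel_measurable (lebesgue_on S)"
    and fg: "AE z in lebesgue. z \<in> S \<longrightarrow> f z = g z"
  shows "g \<in> borel_measurable (lebesgue_on S)"
proof -
  have "(\<lambda>x. if x \<in> S then f x else 0) \<in> borel_measurable lebesgue"
    using borel_measurable_if[OF S] f by blast
  moreover have "AE x in lebesgue. (if x \<in> S then f x else 0) = (if x \<in> S then g x else 0)"
    using fg by eventually_elim auto
  ultimately have "(\<lambda>x. if x \<in> S then g x else 0) \<in> borel_measurable lebesgue"
    by (rule borel_measurable_AE)
  then show ?thesis by (rule borel_measurable_if_D)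
qed

lemma C1_field_ddir:
  assumes "C1_field f f'"
  shows "((\<lambda>s. f (z + s *\<^sub>R e)) has_vector_derivative f' z e) (at 0)" "ddir e f = (\<lambda>z. f' z e)"
proof -
  show *: "((\<lambda>s. f (z + s *\<^sub>R e)) has_vector_derivative f' z e) (at 0)" for z
  proof -
    have d: "((\<lambda>s. z + s *\<^sub>R e) has_derivative (\<lambda>s. s *\<^sub>R e)) (at 0)"
      by (auto intro!: derivative_eq_intros)
    have "(f has_derivative f' z) (at (z + 0 *\<^sub>R e))" using assms by (simp add: C1_field_def)
    from has_derivative_compose[OF d this]
    have "((\<lambda>s. f (z + s *\<^sub>R e)) has_derivative (\<lambda>s. f' z (s *\<^sub>R e))) (at 0)" .
    moreover have "linear (f' z)" using assms unfolding C1_field_def by (meson has_derivative_linear)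
    ultimately show ?thesis by (simp add: has_vector_derivative_def linear_cmul)
  qed
  show "ddir e f = (\<lambda>z. f' z e)" by (intro ext ddirI *)
qed

lemma C1_field_has_weak_ddir:
  assumes "C1_field f f'" "open Q" "e \<in> Basis"
  shows "has_weak_ddir Q e f (\<lambda>z. f' z e)"
proof -
  have "has_weak_ddir Q e f (ddir e f)"
  proof (rule has_weak_ddir_of_C1[OF assms(2,3)])
    show "continuous_on Q f" by (rule continuous_on_subset[OF C1_field_continuous[OF assms(1)]]) simp
    show "has_ddir_on e f Q" unfolding has_ddir_on_def
      using C1_field_ddir(1)[OF assms(1)] by (blast intro: differentiableI_vector)
    have "continuous_on UNIV (ddir e f)" unfolding C1_field_ddir(2)[OF assms(1)]
      using assms(1) by (simp add: C1_field_def)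
    then show "continuous_on Q (ddir e f)" by (rule continuous_on_subset) simp
  qed
  then show ?thesis by (simp only: C1_field_ddir(2)[OF assms(1)])
qed

lemma Ck_closure_1_add_C1_field:
  assumes "Ck_closure 1 G u" "C1_field f f'"
  shows "Ck_closure 1 G (\<lambda>z. u z + f z)"
proof -
  have ext: "extends_cont G (\<lambda>z. a z + b z)" if a: "extends_cont G a" and b: "continuous_on UNIV b" for a b :: "'a \<Rightarrow> 'b"
  proof -
    obtain g where g: "continuous_on (closure G) g" "\<forall>z\<in>G. g z = a z" using a by (auto simp: extends_cont_def)
    then show ?thesis unfolding extends_cont_def
      by (intro exI[of _ "\<lambda>z. g z + b z"]) (auto intro!: continuous_intros continuous_on_subset[OF b])
  qed
  have u: "extends_cont G u" "\<And>e. e \<in> Basis \<Longrightarrow> has_ddir_on e u G" "\<And>e. e \<in> Basis \<Longrightarrow> extends_cont G (ddir e u)"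
    using assms(1) by auto
  have vd: "((\<lambda>s. u (z + s *\<^sub>R e) + f (z + s *\<^sub>R e)) has_vector_derivative ddir e u z + f' z e) (at 0)"
    if "z \<in> G" "e \<in> Basis" for z e
    using u(2)[OF that(2)] that(1) C1_field_ddir(1)[OF assms(2)]
    by (intro has_vector_derivative_add) (auto simp: has_ddir_on_def ddir_def vector_derivative_works)
  have "extends_cont G (ddir e (\<lambda>z. u z + f z))" if e: "e \<in> Basis" for e
  proof -
    have "continuous_on UNIV (\<lambda>z. f' z e)" using assms(2) by (simp add: C1_field_def)
    from ext[OF u(3)[OF e] this] obtain g where "continuous_on (closure G) g" "\<forall>z\<in>G. g z = ddir e u z + f' z e"
      by (auto simp: extends_cont_def)
    then show ?thesis using ddirI[OF vd[OF _ e]] by (auto simp: extends_cont_def)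
  qed
  moreover have "has_ddir_on e (\<lambda>z. u z + f z) G" if "e \<in> Basis" for e
    using vd[OF _ that] unfolding has_ddir_on_def by (blast intro: differentiableI_vector)
  ultimately show ?thesis
    using ext[OF u(1) C1_field_continuous[OF assms(2)]] by simp
qed

lemma C1pc_add_C1_field: "u \<in> C1pc Q \<Longrightarrow> C1_field f f' \<Longrightarrow> (\<lambda>z. u z + f z) \<in> C1pc Q"
  unfolding C1pc_def using Ck_closure_1_add_C1_field[of _ u f f'] by blast

lemma W1inf_weak: "W1inf Q u \<Longrightarrow> e \<in> Basis \<Longrightarrow> has_weak_ddir Q e u (wddir Q e u)"
  unfolding W1inf_def using has_weak_ddir_wddir by blast

lemma W1inf_wddir_measurable:
  fixes u :: "'a::euclidean_space \<Rightarrow> 'b::euclidean_space"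
  assumes "open Q" "W1inf Q u" "e \<in> Basis"
  shows "wddir Q e u \<in> borel_measurable (lebesgue_on Q)"
proof -
  obtain g where g: "has_weak_ddir Q e u g" "Linf Q g" using assms by (auto simp: W1inf_def)
  have ae: "AE z in lebesgue. z \<in> Q \<longrightarrow> g z = wddir Q e u z"
    using wddir_AE_eq[OF assms(1) g(1)] by eventually_elim auto
  have "Q \<in> sets lebesgue" "g \<in> borel_measurable (lebesgue_on Q)"
    using g(2) assms(1) by (auto simp: Linf_def)
  from borel_measurable_lebesgue_on_AE[OF this ae] show ?thesis .
qed

lemma wddir_add_C1_field:
  fixes u f :: "'a::euclidean_space \<Rightarrow> 'b::euclidean_space"
  assumes "open Q" "W1inf Q u" "C1_field f f'" "e \<in> Basis"
  shows "AE z in lebesgue. z \<in> Q \<longrightarrow> wddir Q e (\<lambda>z. u z + f z) z = wddir Q e u z + f' z e"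
  by (intro wddir_AE_eq[OF assms(1)] has_weak_ddir_add W1inf_weak C1_field_has_weak_ddir assms)

text \<open>Adding a \<open>C\<^sup>1\<close> function with compact support in the open set does not change the trace.\<close>

lemma W1inf_dir_add_C1_field:
  fixes u f :: "'a::euclidean_space \<Rightarrow> 'b::euclidean_space"
  assumes Q: "open Q" and u: "u \<in> W1inf_dir Q w" and f: "C1_field f f'"
    and D: "compact D" "D \<subseteq> Q" "\<And>z. z \<notin> D \<Longrightarrow> f z = 0"
  shows "(\<lambda>z. u z + f z) \<in> W1inf_dir Q w"
proof -
  have uW: "W1inf Q u" and uT: "same_trace Q u w" using u by (auto simp: W1inf_dir_def)
  have cf: "continuous_on UNIV f" by (rule C1_field_continuous[OF f])
  have f'0: "f' z e = 0" if "z \<notin> D" for z e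
    by (rule C1_field_eq_0_outside[OF f compact_imp_closed[OF D(1)] D(3) that])
  have Lf: "Linf Q f"
    by (rule bounded_of_compact_support[OF D(1) cf D(3)]) (auto intro: Linf_continuous_bounded[OF cf])
  have Lf': "Linf Q (\<lambda>z. f' z e)" for e
  proof -
    have c: "continuous_on UNIV (\<lambda>z. f' z e)" using f by (simp add: C1_field_def)
    show ?thesis
      by (rule bounded_of_compact_support[OF D(1) c f'0]) (auto intro: Linf_continuous_bounded[OF c])
  qed
  have "W1inf Q (\<lambda>z. u z + f z)"
    unfolding W1inf_def
  proof (intro conjI ballI)
    show "Linf Q (\<lambda>z. u z + f z)" using uW Lf by (intro Linf_add) (auto simp: W1inf_def)
    fix e :: 'a assume e: "e \<in> Basis"
    obtain g where g: "has_weak_ddir Q e u g" "Linf Q g" using uW e by (auto simp: W1inf_def)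
    show "\<exists>g. has_weak_ddir Q e (\<lambda>z. u z + f z) g \<and> Linf Q g"
      using has_weak_ddir_add[OF g(1) C1_field_has_weak_ddir[OF f Q e] e] Linf_add[OF g(2) Lf'] by blast
  qed
  moreover have "same_trace Q (\<lambda>z. u z + f z) w"
  proof -
    obtain u' w' where *: "continuous_on (closure Q) u'" "continuous_on (closure Q) w'"
      "AE z in lebesgue_on Q. u' z = u z" "AE z in lebesgue_on Q. w' z = w z" "\<And>z. z\<in>frontier Q \<Longrightarrow> u' z = w' z"
      using uT unfolding same_trace_def by blast
    have "f z = 0" if "z \<in> frontier Q" for z
      using that D(2) Q by (intro D(3)) (auto simp: frontier_def interior_open)
    then show ?thesis
      unfolding same_trace_def using *
      by (intro exI[of _ "\<lambda>z. u' z + f z"] exI[of _ w'])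
         (auto intro!: continuous_intros continuous_on_subset[OF cf])
  qed
  ultimately show ?thesis by (simp add: W1inf_dir_def)
qed

lemma wddir_component:
  fixes v :: "(real^'n) \<times> real \<Rightarrow> real^'n"
  assumes "open Q" "W1inf Q v" "e \<in> Basis"
  shows "AE z in lebesgue. z \<in> Q \<longrightarrow> wddir Q e (\<lambda>w. v w $ i) z = wddir Q e v z $ i"
proof -
  have "has_weak_ddir Q e (\<lambda>w. v w \<bullet> axis i 1) (\<lambda>w. wddir Q e v w \<bullet> axis i 1)"
    by (intro has_weak_ddir_inner W1inf_weak assms)
  then have "has_weak_ddir Q e (\<lambda>w. v w $ i) (\<lambda>w. wddir Q e v w $ i)"
    by (simp add: inner_axis)
  then show ?thesis by (rule wddir_AE_eq[OF assms(1)])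
qed

lemma wdivx_eq:
  fixes v :: "(real^'n) \<times> real \<Rightarrow> real^'n"
  assumes "open Q" "W1inf Q v"
  shows "AE z in lebesgue. z \<in> Q \<longrightarrow> wdivx Q v z = (\<Sum>i\<in>UNIV. wddir Q (axis i 1, 0) v z $ i)"
proof -
  have "AE z in lebesgue. \<forall>i\<in>(UNIV::'n set). z \<in> Q \<longrightarrow> wddir Q (axis i 1, 0) (\<lambda>w. v w $ i) z = wddir Q (axis i 1, 0) v z $ i"
    using wddir_component[OF assms axis_Basis] by (subst AE_ball_countable) (auto simp: countable_finite)
  then show ?thesis by eventually_elim (simp add: wdivx_def)
qed

lemma wdivx_add_C1_field:
  fixes v f :: "(real^'n) \<times> real \<Rightarrow> real^'n"
  assumes Q: "open Q" and v: "W1inf Q v" "W1inf Q (\<lambda>z. v z + f z)" and f: "C1_field f f'"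
  shows "AE z in lebesgue. z \<in> Q \<longrightarrow> wdivx Q (\<lambda>z. v z + f z) z = wdivx Q v z + (\<Sum>i\<in>UNIV. f' z (axis i 1, 0) $ i)"
proof -
  have "AE z in lebesgue. \<forall>i\<in>(UNIV::'n set). z \<in> Q \<longrightarrow> wddir Q (axis i 1, 0) (\<lambda>z. v z + f z) z = wddir Q (axis i 1, 0) v z + f' z (axis i 1, 0)"
    using wddir_add_C1_field[OF Q v(1) f axis_Basis] by (subst AE_ball_countable) (auto simp: countable_finite)
  with wdivx_eq[OF Q v(1)] wdivx_eq[OF Q v(2)] show ?thesis
    by eventually_elim (simp add: sum.distrib)
qed

lemma wDx_add_C1_field:
  fixes u f :: "(real^'n) \<times> real \<Rightarrow> real"
  assumes Q: "open Q" and u: "W1inf Q u" and f: "C1_field f f'"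
  shows "AE z in lebesgue. z \<in> Q \<longrightarrow> wDx Q (\<lambda>z. u z + f z) z = wDx Q u z + (\<chi> i. f' z (axis i 1, 0))"
proof -
  have "AE z in lebesgue. \<forall>i\<in>(UNIV::'n set). z \<in> Q \<longrightarrow> wddir Q (axis i 1, 0) (\<lambda>z. u z + f z) z = wddir Q (axis i 1, 0) u z + f' z (axis i 1, 0)"
    using wddir_add_C1_field[OF Q u f axis_Basis] by (subst AE_ball_countable) (auto simp: countable_finite)
  then show ?thesis by eventually_elim (simp add: wDx_def vec_eq_iff)
qed

lemma wDt_add_C1_field:
  fixes u f :: "(real^'n) \<times> real \<Rightarrow> 'b::euclidean_space"
  assumes "open Q" "W1inf Q u" "C1_field f f'"
  shows "AE z in lebesgue. z \<in> Q \<longrightarrow> wDt Q (\<lambda>z. u z + f z) z = wDt Q u z + f' z (0, 1)"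
  unfolding wDt_def by (rule wddir_add_C1_field[OF assms time_Basis])

text \<open>For a piecewise \<open>C\<^sup>1\<close> function the weak derivatives are the classical ones on an open set of
  full measure, where moreover the classical ones are continuous.\<close>

lemma C1pc_classical:
  fixes u :: "'a::euclidean_space \<Rightarrow> 'b::euclidean_space"
  assumes "u \<in> C1pc Q" "W1inf Q u"
  obtains W where "open W" "W \<subseteq> Q" "negligible (Q - W)"
    "\<And>e. e \<in> Basis \<Longrightarrow> continuous_on W (ddir e u)"
    "\<And>e. e \<in> Basis \<Longrightarrow> AE z in lebesgue. z \<in> W \<longrightarrow> wddir Q e u z = ddir e u z"
proof -
  obtain G :: "nat \<Rightarrow> 'a set" where G: "\<And>j. open (G j)" "\<And>j. G j \<subseteq> Q" "\<And>j. Ck_closure 1 (G j) u" "negligible (Q - (\<Union>j. G j))"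
    using assms(1) unfolding C1pc_def by blast
  show ?thesis
  proof (rule that[of "\<Union>j. G j"])
    show "open (\<Union>j. G j)" using G(1) by blast
    show "(\<Union>j. G j) \<subseteq> Q" using G(2) by blast
    show "negligible (Q - (\<Union>j. G j))" by (rule G(4))
    fix e :: 'a assume e: "e \<in> Basis"
    show "continuous_on (\<Union>j. G j) (ddir e u)"
      using G(1,3) e by (intro continuous_on_open_UN extends_cont_imp_continuous_on) auto
    have "AE z in lebesgue. \<forall>j. z \<in> G j \<longrightarrow> wddir Q e u z = ddir e u z"
      unfolding AE_all_countable
      by (intro allI wddir_AE_eq_ddir[OF W1inf_weak[OF assms(2) e] e G(1,2,3)])
    then show "AE z in lebesgue. z \<in> (\<Union>j. G j) \<longrightarrow> wddir Q e u z = ddir e u z"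
      by eventually_elim auto
  qed
qed

section \<open>Density\<close>

lemma ennreal_add_small:
  fixes m \<mu> :: ennreal
  assumes "m < \<mu>"
  obtains \<eta> :: real where "\<eta> > 0" "m + ennreal \<eta> < \<mu>"
proof -
  obtain y where y: "m < y" "y < \<mu>" using dense[OF assms] by blast
  then have "m < \<infinity>" "y < \<infinity>" by (auto simp: less_top[symmetric] intro: order.strict_trans2 top_greatest)
  then obtain a b where ab: "m = ennreal a" "0 \<le> a" "y = ennreal b" "0 \<le> b"
    by (metis ennreal_cases infinity_ennreal_def less_irrefl)
  then have "a < b" using y(1) by (simp add: ennreal_less_iff)
  then have "m + ennreal (b - a) = y" using ab by (simp add: ennreal_plus[symmetric] del: ennreal_plus)
  then show ?thesis using that[of "b - a"] \<open>a < b\<close> y(2) by simp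
qed

text \<open>The density statement for an arbitrary nonempty bounded open set of space-time and arbitrary boundary
  functions.\<close>

lemma U_eps_class_dense:
  fixes Q :: "((real^'n) \<times> real) set" and us :: "(real^'n) \<times> real \<Rightarrow> real"
  assumes Q: "open Q" "bounded Q" "Q \<noteq> {}" and "\<delta> > 0" "\<epsilon> > 0" "\<eta> > 0"
    and uU: "u \<in> U_class \<delta> Q us vs"
  shows "\<exists>w \<in> U_eps_class \<epsilon> \<delta> Q us vs. Linf_norm Q (\<lambda>z. w z - u z) < ennreal \<eta>"
proof -
  obtain v where uC: "u \<in> C1pc Q" and uD: "u \<in> W1inf_dir Q us"
    and ut: "Linf_norm Q (wDt Q u) < Linf_norm Q (Dt us) + 1"
    and vC: "v \<in> C1pc Q" and vD: "v \<in> W1inf_dir Q vs"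
    and div0: "AE z in lebesgue_on Q. wdivx Q v z = u z"
    and SK0: "AE z in lebesgue_on Q. (wDx Q u z, wDt Q v z) \<in> S_set \<delta> \<union> K_set \<delta>"
    using uU unfolding U_class_def companion_def by blast
  have uW: "W1inf Q u" and vW: "W1inf Q v" using uD vD by (auto simp: W1inf_dir_def)
  have Qm: "Q \<in> sets lebesgue" "Q \<in> lmeasurable" using Q by (auto intro: lmeasurable_open)
  have Qpos: "measure lebesgue Q > 0"
  proof -
    have "\<not> negligible Q" using Q(1,3) by (rule open_not_negligible)
    then show ?thesis using Qm by (simp add: negligible_iff_measure zero_less_measure_iff)
  qed
  note div = div0[unfolded AE_lebesgue_on_iff[OF Qm(1)]] and SK = SK0[unfolded AE_lebesgue_on_iff[OF Qm(1)]]
  obtain Wu where Wu: "open Wu" "Wu \<subseteq> Q" "negligible (Q - Wu)"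
    "\<And>e. e \<in> Basis \<Longrightarrow> continuous_on Wu (ddir e u)"
    "\<And>e. e \<in> Basis \<Longrightarrow> AE z in lebesgue. z \<in> Wu \<longrightarrow> wddir Q e u z = ddir e u z"
    using C1pc_classical[OF uC uW] by blast
  obtain Wv where Wv: "open Wv" "Wv \<subseteq> Q" "negligible (Q - Wv)"
    "\<And>e. e \<in> Basis \<Longrightarrow> continuous_on Wv (ddir e v)"
    "\<And>e. e \<in> Basis \<Longrightarrow> AE z in lebesgue. z \<in> Wv \<longrightarrow> wddir Q e v z = ddir e v z"
    using C1pc_classical[OF vC vW] by blast
  define W where "W = Wu \<inter> Wv"
  define P where "P = Dx u"
  define V where "V = ddir (0, 1) v"
  have W: "open W" "W \<subseteq> Q" using Wu Wv by (auto simp: W_def)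
  have cP: "continuous_on W P"
    unfolding P_def Dx_def[abs_def] W_def
    by (intro continuous_on_vec_lambda continuous_on_subset[OF Wu(4)[OF axis_Basis]]) auto
  have cV: "continuous_on W V"
    unfolding V_def W_def by (intro continuous_on_subset[OF Wv(4)[OF time_Basis]]) auto
  have "AE z in lebesgue. \<forall>i\<in>(UNIV::'n set). z \<in> Wu \<longrightarrow> wddir Q (axis i 1, 0) u z = ddir (axis i 1, 0) u z"
    using Wu(5)[OF axis_Basis] by (subst AE_ball_countable) (auto simp: countable_finite)
  moreover have "AE z in lebesgue. z \<notin> Q - Wu" "AE z in lebesgue. z \<notin> Q - Wv"
    using Wu(3) Wv(3) unfolding negligible_iff_null_sets by (blast intro: AE_not_in)+
  ultimately have classical: "AE z in lebesgue. z \<in> Q \<longrightarrow> z \<in> W \<and> wDx Q u z = P z \<and> wDt Q v z = V z"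
    using Wv(5)[OF time_Basis]
    by eventually_elim (auto simp: W_def P_def V_def wDx_def Dx_def wDt_def)
  \<comment> \<open>Almost everywhere outside \<open>H\<close> the fields are in \<open>K_set \<delta>\<close>, where \<open>v_t = sigma (Du)\<close>.\<close>
  define H where "H = {z\<in>W. (P z, V z) \<in> S_set \<delta>}"
  have "open H"
  proof -
    have "H = W \<inter> (\<lambda>z. (P z, V z)) -` S_set \<delta>" by (auto simp: H_def)
    then show ?thesis
      using continuous_open_preimage[OF continuous_on_Pair[OF cP cV] W(1) open_S_set] by simp
  qed
  have HQ: "H \<subseteq> Q" using W(2) by (auto simp: H_def)
  \<comment> \<open>One third each for the perturbed set, its exceptional subset, and the rest of \<open>H\<close>.\<close>
  define e where "e = \<epsilon> / 3"
  have e: "e > 0" using \<open>\<epsilon> > 0\<close> by (simp add: e_def)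
  obtain \<eta>1 where \<eta>1: "\<eta>1 > 0" "Linf_norm Q (wDt Q u) + ennreal \<eta>1 < Linf_norm Q (Dt us) + 1"
    using ennreal_add_small[OF ut] by blast
  define \<eta>2 where "\<eta>2 = min \<eta>1 (\<eta> / 2)"
  have \<eta>2: "\<eta>2 > 0" "\<eta>2 \<le> \<eta>1" "\<eta>2 < \<eta>" using \<eta>1 \<open>\<eta> > 0\<close> by (auto simp: \<eta>2_def)
  obtain D where D: "D \<subseteq> H" "perturbable \<delta> \<eta>2 e P V D" "measure lebesgue (H - D) \<le> e * measure lebesgue Q"
  proof (rule perturbable_exhaustion[OF \<open>open H\<close>, where \<delta> = \<delta> and \<eta> = \<eta>2 and e = e
        and \<tau> = "e * measure lebesgue Q" and P = P and V = V])
    show "bounded H" using Q(2) HQ by (rule bounded_subset)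
    show "isCont P z" "isCont V z" if "z \<in> H" for z
      using that cP cV W(1) by (auto simp: H_def continuous_on_eq_continuous_at)
    show "(P z, V z) \<in> S_set \<delta>" if "z \<in> H" for z using that by (simp add: H_def)
    show "0 < e * measure lebesgue Q" using e Qpos by simp
  qed (use \<open>\<delta> > 0\<close> \<eta>2 e in auto)
  obtain \<phi> \<phi>' \<psi> \<psi>' Bad where pert: "perturbation \<delta> \<eta>2 e P V D \<phi> \<phi>' \<psi> \<psi>' Bad"
    using D(2) unfolding perturbable_def by blast
  have p: "compact D" "C1_field \<phi> \<phi>'" "C1_field \<psi> \<psi>'"
     "\<And>z. z \<notin> D \<Longrightarrow> \<phi> z = 0" "\<And>z. z \<notin> D \<Longrightarrow> \<psi> z = 0"
     "\<And>z. (\<Sum>i\<in>UNIV. \<psi>' z (axis i 1, 0) $ i) = \<phi> z"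
     "\<And>z. \<bar>\<phi> z\<bar> \<le> \<eta>2" "\<And>z. \<bar>\<phi>' z (0, 1)\<bar> \<le> \<eta>2"
     "Bad \<in> lmeasurable" "Bad \<subseteq> D" "measure lebesgue Bad \<le> e * measure lebesgue D"
     "\<And>z. z\<in>D \<Longrightarrow> (P z + (\<chi> i. \<phi>' z (axis i 1, 0)), V z + \<psi>' z (0, 1)) \<in> S_set \<delta>"
     "\<And>z. z\<in>D - Bad \<Longrightarrow> norm (V z + \<psi>' z (0, 1) - sigma (P z + (\<chi> i. \<phi>' z (axis i 1, 0)))) \<le> e"
    using pert unfolding perturbation_def by blast+
  have out: "\<phi>' z w = 0" "\<psi>' z w = 0" if "z \<notin> D" for z w
    using C1_field_eq_0_outside[OF p(2) compact_imp_closed[OF p(1)] p(4) that]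
      C1_field_eq_0_outside[OF p(3) compact_imp_closed[OF p(1)] p(5) that] by auto
  have DQ: "D \<subseteq> Q" using D(1) HQ by blast
  define w where "w z = u z + \<phi> z" for z
  define v2 where "v2 z = v z + \<psi> z" for z
  have wC: "w \<in> C1pc Q" and v2C: "v2 \<in> C1pc Q"
    unfolding w_def[abs_def] v2_def[abs_def] by (rule C1pc_add_C1_field[OF uC p(2)] C1pc_add_C1_field[OF vC p(3)])+
  have wD: "w \<in> W1inf_dir Q us"
    unfolding w_def[abs_def] by (rule W1inf_dir_add_C1_field[OF Q(1) uD p(2,1) DQ p(4)])
  have v2D: "v2 \<in> W1inf_dir Q vs"
    unfolding v2_def[abs_def] by (rule W1inf_dir_add_C1_field[OF Q(1) vD p(3,1) DQ p(5)])
  have wW: "W1inf Q w" and v2W: "W1inf Q v2" using wD v2D by (auto simp: W1inf_dir_def)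
  have wx: "AE z in lebesgue. z \<in> Q \<longrightarrow> wDx Q w z = wDx Q u z + (\<chi> i. \<phi>' z (axis i 1, 0))"
    unfolding w_def[abs_def] by (rule wDx_add_C1_field[OF Q(1) uW p(2)])
  have wt: "AE z in lebesgue. z \<in> Q \<longrightarrow> wDt Q w z = wDt Q u z + \<phi>' z (0, 1)"
    unfolding w_def[abs_def] by (rule wDt_add_C1_field[OF Q(1) uW p(2)])
  have v2t: "AE z in lebesgue. z \<in> Q \<longrightarrow> wDt Q v2 z = wDt Q v z + \<psi>' z (0, 1)"
    unfolding v2_def[abs_def] by (rule wDt_add_C1_field[OF Q(1) vW p(3)])
  have v2div: "AE z in lebesgue. z \<in> Q \<longrightarrow> wdivx Q v2 z = wdivx Q v z + \<phi> z"
    using wdivx_add_C1_field[OF Q(1) vW v2W[unfolded v2_def[abs_def]] p(3)] unfolding v2_def[abs_def] p(6) .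
  have div2: "AE z in lebesgue_on Q. wdivx Q v2 z = w z"
    unfolding AE_lebesgue_on_iff[OF Qm(1)] using v2div div by eventually_elim (simp add: w_def)
  have SK2: "AE z in lebesgue. z \<in> Q \<longrightarrow> (wDx Q w z, wDt Q v2 z) \<in> S_set \<delta> \<union> K_set \<delta>"
    using classical wx v2t SK
  proof eventually_elim
    case (elim z)
    show ?case
      by (cases "z \<in> D") (use elim p(12) out in \<open>auto simp: zero_vec_def[symmetric]\<close>)
  qed
  have comp: "companion \<delta> Q vs w v2"
    unfolding companion_def AE_lebesgue_on_iff[OF Qm(1)]
    using v2C v2D div2[unfolded AE_lebesgue_on_iff[OF Qm(1)]] SK2 by blast
  have "Linf_norm Q (wDt Q w) \<le> Linf_norm Q (wDt Q u) + Linf_norm Q (\<lambda>z. \<phi>' z (0, 1))"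
  proof (rule Linf_norm_add_le)
    show "wDt Q w \<in> borel_measurable (lebesgue_on Q)"
      unfolding wDt_def by (rule W1inf_wddir_measurable[OF Q(1) wW time_Basis])
    show "AE z in lebesgue_on Q. norm (wDt Q w z) \<le> norm (wDt Q u z) + norm (\<phi>' z (0, 1))"
      unfolding AE_lebesgue_on_iff[OF Qm(1)] using wt by eventually_elim auto
  qed
  also have "Linf_norm Q (\<lambda>z. \<phi>' z (0, 1)) \<le> ennreal \<eta>1"
  proof (rule Linf_norm_le)
    show "(\<lambda>z. \<phi>' z (0, 1)) \<in> borel_measurable (lebesgue_on Q)"
      using p(2) by (intro measurable_continuous_lebesgue_on) (simp add: C1_field_def)
    show "AE z in lebesgue_on Q. ennreal (norm (\<phi>' z (0, 1))) \<le> ennreal \<eta>1"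
      using order_trans[OF p(8) \<eta>2(2)] by (intro AE_I2 ennreal_leI) simp
  qed
  finally have "Linf_norm Q (wDt Q w) < Linf_norm Q (Dt us) + 1"
    using \<eta>1(2) by (meson add_left_mono order_le_less_trans)
  then have wU: "w \<in> U_class \<delta> Q us vs"
    unfolding U_class_def using wC wD comp by blast
  have "bounded H" using Q(2) HQ by (rule bounded_subset)
  then have Hm: "H \<in> lmeasurable" using \<open>open H\<close> by (rule lmeasurable_open)
  have Dm: "D \<in> lmeasurable" using p(1) by (rule lmeasurable_compact)
  have m: "D \<in> lmeasurable" "Bad \<in> lmeasurable" "H - D \<in> lmeasurable"
    using Dm p(9) fmeasurable_Diff[OF Hm, of D] by (auto dest: fmeasurableD)
  \<comment> \<open>On \<open>S_set \<delta>\<close> the integrand is at most \<open>1\<close>, since both \<open>|\<beta>|\<close> and \<open>|sigma p|\<close> are at most \<open>1 / 2\<close> there.\<close>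
  have "(LINT z:Q|lebesgue. norm (wDt Q v2 z - sigma (wDx Q w z))) \<le>
      (LINT z|lebesgue. e * indicator D z + indicator Bad z + indicator (H - D) z)"
    unfolding set_lebesgue_integral_def
  proof (rule integral_mono_AE')
    show "integrable lebesgue (\<lambda>z. e * indicator D z + indicator Bad z + indicator (H - D) z)"
      using m by (intro Bochner_Integration.integrable_add integrable_mult_right integrable_real_indicator) (auto simp: fmeasurable_def)
    show "AE z in lebesgue. 0 \<le> e * indicator D z + indicator Bad z + indicator (H - D) z"
      using e by simp
    show "AE z in lebesgue. indicator Q z *\<^sub>R norm (wDt Q v2 z - sigma (wDx Q w z))
        \<le> e * indicator D z + indicator Bad z + indicator (H - D) z"
      using classical wx v2t SK
    proof eventually_elim
      case (elim z)
      show ?case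
      proof (cases "z \<in> Q")
        case False
        then show ?thesis using e by (simp add: indicator_def)
      next
        case True
        define p1 \<beta>1 where "p1 = P z + (\<chi> i. \<phi>' z (axis i 1, 0))" and "\<beta>1 = V z + \<psi>' z (0, 1)"
        have eq: "wDx Q w z = p1" "wDt Q v2 z = \<beta>1"
          using elim True by (auto simp: p1_def \<beta>1_def)
        have le1: "norm (\<beta>1 - sigma p1) \<le> 1" if "(p1, \<beta>1) \<in> S_set \<delta>"
          using norm_triangle_ineq4[of \<beta>1 "sigma p1"] S_set_norm_le[OF that] norm_sigma_le[of p1] \<open>\<delta> > 0\<close> by simp
        consider "z \<in> D - Bad" | "z \<in> Bad" | "z \<in> H - D" | "z \<notin> H" using D(1) p(10) by blast
        then show ?thesis
        proof cases
          case 1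
          then show ?thesis using p(13)[OF 1] True by (simp add: eq p1_def \<beta>1_def indicator_def)
        next
          case 2
          then have "z \<in> D" using p(10) by blast
          then have "norm (\<beta>1 - sigma p1) \<le> 1" using le1 p(12) by (simp add: p1_def \<beta>1_def)
          then show ?thesis using 2 \<open>z \<in> D\<close> e True by (simp add: eq)
        next
          case 3
          then have "norm (\<beta>1 - sigma p1) \<le> 1"
            using le1 out[of z] by (simp add: p1_def \<beta>1_def H_def zero_vec_def[symmetric])
          then show ?thesis using 3 e True by (simp add: eq indicator_def)
        next
          case 4
          then have zD: "z \<notin> D" using D(1) by blast
          have *: "p1 = P z" "\<beta>1 = V z" using out[OF zD] by (simp_all add: p1_def \<beta>1_def zero_vec_def[symmetric])
          have "(P z, V z) \<in> K_set \<delta>" using 4 elim True by (auto simp: H_def)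
          then have "\<beta>1 = sigma p1" unfolding * by (auto simp: K_set_def)
          then show ?thesis using e by (simp add: eq)
        qed
      qed
    qed
  qed
  also have "\<dots> = e * measure lebesgue D + measure lebesgue Bad + measure lebesgue (H - D)"
  proof -
    have i: "integrable lebesgue (indicator A :: _ \<Rightarrow> real)" if "A \<in> lmeasurable" for A :: "((real^'n) \<times> real) set"
      using that by (intro integrable_real_indicator) (auto simp: fmeasurable_def)
    show ?thesis using i[OF m(1)] i[OF m(2)] i[OF m(3)] m by simp
  qed
  also have "\<dots> \<le> e * measure lebesgue Q + e * measure lebesgue Q + e * measure lebesgue Q"
  proof -
    have "measure lebesgue D \<le> measure lebesgue Q"
      using DQ Qm p(1) by (intro measure_mono_fmeasurable) (auto intro: lmeasurable_compact fmeasurableD)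
    then have "e * measure lebesgue D \<le> e * measure lebesgue Q" using e by (intro mult_left_mono) auto
    then show ?thesis using p(11) D(3) by linarith
  qed
  also have "\<dots> = \<epsilon> * measure lebesgue Q" by (simp add: e_def)
  finally have "w \<in> U_eps_class \<epsilon> \<delta> Q us vs"
    unfolding U_eps_class_def using wU comp by blast
  moreover have "Linf_norm Q (\<lambda>z. w z - u z) < ennreal \<eta>"
  proof -
    have "Linf_norm Q \<phi> \<le> ennreal \<eta>2"
      by (rule Linf_norm_le) (use p(7) in \<open>auto intro!: measurable_continuous_lebesgue_on C1_field_continuous[OF p(2)] ennreal_leI\<close>)
    also have "\<dots> < ennreal \<eta>" using \<eta>2 by (simp add: ennreal_less_iff)
    finally show ?thesis by (simp add: w_def)
  qed
  ultimately show ?thesis by blast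
qed

theorem theorem6p1:
  fixes \<Omega> :: "(real^'n) set"
    and \<alpha> T M \<delta> \<Lambda> \<theta> \<Theta> \<epsilon> :: real
    and u0 h :: "real^'n \<Rightarrow> real"
    and \<rho>s :: "real \<Rightarrow> real"
    and us :: "(real^'n) \<times> real \<Rightarrow> real"
  assumes "0 < \<alpha>" "\<alpha> < 1" "0 < T"
    and "open \<Omega>" "connected \<Omega>" "\<Omega> \<noteq> {}" "bounded \<Omega>" "convex \<Omega>"
    and "C2alpha_boundary \<alpha> \<Omega>"
    and "C2alpha \<alpha> \<Omega> u0" "\<exists>x\<in>\<Omega>. grad u0 x \<noteq> 0" "neumann0 \<Omega> u0"
    and "(LINT x:\<Omega>|lebesgue. u0 x) = 0"
    and "M = enn2real (Linf_norm \<Omega> (grad u0))"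
    and "(0 < M \<and> M < 1 \<and> 0 < \<delta> \<and> \<delta> < M / (1 + M\<^sup>2) \<and> 1 < \<Lambda> \<and> \<Lambda> < m_plus \<delta>) \<or>
         (1 \<le> M \<and> (\<exists>l>0. \<delta> = (M + l) / (1 + (M + l)\<^sup>2) \<and> M < \<Lambda> \<and> \<Lambda> < M + l))"
    and "modified_profile \<delta> \<Lambda> \<theta> \<Theta> \<rho>s"
    and "classical_solution \<alpha> \<Omega> T \<rho>s u0 us"
    and "C2alpha \<alpha> \<Omega> h" "\<forall>x\<in>\<Omega>. laplacian h x = u0 x" "neumann0 \<Omega> h"
    and "0 < \<epsilon>"
  shows "\<forall>u \<in> U_class \<delta> (cyl \<Omega> T) us (v_star \<rho>s h us). \<forall>\<eta>>0.
           \<exists>w \<in> U_eps_class \<epsilon> \<delta> (cyl \<Omega> T) us (v_star \<rho>s h us).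
             Linf_norm (cyl \<Omega> T) (\<lambda>z. w z - u z) < ennreal \<eta>"
proof -
  have "\<delta> > 0"
    using assms(15) by (auto intro!: divide_pos_pos add_pos_nonneg)
  moreover have "open (cyl \<Omega> T)" "bounded (cyl \<Omega> T)" "cyl \<Omega> T \<noteq> {}"
    using assms(3,4,6,7) by (auto simp: cyl_def intro: open_Times bounded_Times)
  ultimately show ?thesis
    using U_eps_class_dense \<open>0 < \<epsilon>\<close> by blast
qed

end
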